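(* Let $\mathbf{X}\subset\mathbb{R}$ be a Poisson cluster process with immigrant intensity $\nu>0$, number of points per cluster $S$ and cluster radius $L$. Assume $$\mathrm{E}[\mathrm{e}^{\theta S}]<\infty\quad\text{for each }\theta\in\mathbb{R}\qquad\text{and}\qquad \mathrm{E}[L\mathrm{e}^{\theta S}]<\infty\quad\text{for each }\theta\in\mathbb{R}.$$ Then the family of processes $\left\{\frac{N_{\mathbf{X}}(0,\alpha\,\cdot\,]}{\alpha}\right\}_{\alpha>0}$, i.e. $t\mapsto N_{\mathbf{X}}(0,\alpha t]/\alpha$, $t\in[0,1]$, satisfies a large deviation principle on $D[0,1]$, equipped with the topology of uniform convergence, with speed $\alpha$ and good rate function $$J(f)=\begin{cases}\displaystyle\int_0^1\Lambda^*(\dot f(t))\,\mathrm{d}t & \text{if } f\in AC_0[0,1],\\ \infty & \text{otherwise,}\end{cases}$$ where $\Lambda^*(x)=\sup_{\theta\in\mathbb{R}}(\theta x-\Lambda(\theta))$ with $\Lambda(\theta)=\nu(\mathrm{E}[\mathrm{e}^{\theta S}]-1)$.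
   Context: Poisson cluster process. (a) The immigrants form a homogeneous Poisson process $I$ on $\mathbb{R}$ with points $X_i$ and intensity $\nu>0$. (b) Each immigrant $X_i$ generates a cluster $C_i=C_{X_i}$, a finite point process on $\mathbb{R}$ containing $X_i$. (c) Given the immigrants, the centered clusters $C_i-X_i=\{Y-X_i: Y\in C_i\}$ are independent, identically distributed, and independent of $I$. (d) $\mathbf{X}$ is the union of all clusters. $C_0$ denotes the cluster generated by an immigrant at $0$ (i.e. a point process with the common law of the centered clusters); $S$ is the number of points in $C_0$; $L=\sup_{Y\in C_0}|Y|$ is the radius of $C_0$. $N_{\mathbf{Y}}(0,t]$ is the number of points of a point process $\mathbf{Y}$ in $(0,t]$. $D[0,1]$ is the space of c\`adl\`ag real functions on $[0,1]$; $AC_0[0,1]$ is the family of absolutely continuous functions $f$ on $[0,1]$ with $f(0)=0$. Large deviation principle (LDP): a family $\{V_\alpha\}_{\alpha\in(0,\infty)}$ of random variables with values in a topological space $M$ satisfies the LDP with rate function $J$ and speed $v$ if $J:M\to[0,\infty]$ is lower semi-continuous, $v:[0,\infty)\to[0,\infty)$ is measurable and increases to infinity, and for every Borel set $B\subset M$, $$-\inf_{x\in B^\circ}J(x)\le\liminf_{\alpha\to\infty}\frac{1}{v(\alpha)}\log P(V_\alpha\in B)\le\limsup_{\alpha\to\infty}\frac{1}{v(\alpha)}\log P(V_\alpha\in B)\le-\inf_{x\in\overline{B}}J(x).$$ The rate function is good if its level sets $\{x:J(x)\le a\}$, $a\ge 0$, are compact. *)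

theory Defs
  imports "HOL-Probability.Probability"
begin

section \<open>Poisson cluster processes\<close>

text \<open>
  A finite point process is a random finite multiset of reals; multiplicities are allowed and
  simple clusters are a special case. The space of finite configurations carries the usual
  sigma-algebra, generated by the counting maps of Borel sets.
\<close>

definition config_space :: "real multiset measure" where
  "config_space =
     sigma UNIV {{m. size {#y \<in># m. y \<in> A#} = k} | A k. A \<in> sets borel}"

text \<open>The number of points in a set, for a point process listed as a sequence.\<close>

definition point_count :: "(nat \<Rightarrow> real) \<Rightarrow> real set \<Rightarrow> ennreal" where
  "point_count x A = (\<Sum>i. indicator A (x i))"

locale homogeneous_poisson_process = prob_space M
  for M :: "'w measure" +
  fixes \<nu> :: real and X :: "nat \<Rightarrow> 'w \<Rightarrow> real"
  assumes intensity_pos: "\<nu> > 0"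
    and random_points: "\<And>i. random_variable borel (X i)"
    and count_poisson:
      "\<And>A k. A \<in> sets borel \<Longrightarrow> bounded A \<Longrightarrow>
         prob {\<omega> \<in> space M. point_count (\<lambda>i. X i \<omega>) A = of_nat k}
           = pmf (poisson_pmf (\<nu> * measure lborel A)) k"
    and count_indep:
      "\<And>(A :: nat \<Rightarrow> real set) n.
         (\<And>j. j < n \<Longrightarrow> A j \<in> sets borel \<and> bounded (A j)) \<Longrightarrow>
         disjoint_family_on A {..<n} \<Longrightarrow>
         indep_vars (\<lambda>_. borel) (\<lambda>j \<omega>. point_count (\<lambda>i. X i \<omega>) (A j)) {..<n}"

text \<open>
  The multiset \<open>C i \<omega>\<close> is the centered cluster of the immigrant at \<open>X i \<omega>\<close>, that is, the cluster
  translated by \<open>- X i \<omega>\<close>. The measure \<open>Q\<close> is the common law of the centered clusters, so the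
  generic cluster of an immigrant at \<open>0\<close>, its size and its radius are random variables on \<open>Q\<close>.
\<close>

locale poisson_cluster_process = homogeneous_poisson_process M \<nu> X
  for M :: "'w measure" and \<nu> :: real and X :: "nat \<Rightarrow> 'w \<Rightarrow> real" +
  fixes C :: "nat \<Rightarrow> 'w \<Rightarrow> real multiset" and Q :: "real multiset measure"
  assumes clusters_indep: "indep_vars (\<lambda>_. config_space) C UNIV"
    and clusters_law: "\<And>i. distr M config_space (C i) = Q"
    and clusters_indep_immigrants:
      "indep_set
         (sets (vimage_algebra (space M) (\<lambda>\<omega> i. X i \<omega>) (PiM UNIV (\<lambda>_. borel))))
         (sets (vimage_algebra (space M) (\<lambda>\<omega> i. C i \<omega>) (PiM UNIV (\<lambda>_. config_space))))"
    and immigrant_in_cluster: "AE m in Q. 0 \<in># m"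

text \<open>
  The number of points of the superposition of all clusters in a set, with multiplicity. Different
  clusters almost surely have no common point (the immigrants have diffuse positions independent
  of the centered clusters), so for simple clusters this counts the points of the union.
\<close>

definition cluster_process_count ::
    "(nat \<Rightarrow> 'w \<Rightarrow> real) \<Rightarrow> (nat \<Rightarrow> 'w \<Rightarrow> real multiset) \<Rightarrow> 'w \<Rightarrow> real set \<Rightarrow> ennreal" where
  "cluster_process_count X C \<omega> A = (\<Sum>i. of_nat (size {#y \<in># C i \<omega>. X i \<omega> + y \<in> A#}))"

definition cluster_radius :: "real multiset \<Rightarrow> real" where
  "cluster_radius m = (SUP y\<in>set_mset m. \<bar>y\<bar>)"

text \<open>
  The path \<open>t \<mapsto> N(0, \<alpha> t] / \<alpha>\<close> on the unit interval. The conversion \<open>enn2real\<close> sends an infinite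
  count to \<open>0\<close>.
\<close>

definition scaled_count_path ::
    "(nat \<Rightarrow> 'w \<Rightarrow> real) \<Rightarrow> (nat \<Rightarrow> 'w \<Rightarrow> real multiset) \<Rightarrow> real \<Rightarrow> 'w \<Rightarrow> real \<Rightarrow> real" where
  "scaled_count_path X C \<alpha> \<omega> =
     (\<lambda>t\<in>{0..1}. enn2real (cluster_process_count X C \<omega> {0<..\<alpha> * t}) / \<alpha>)"


section \<open>Path spaces\<close>

text \<open>Functions on \<open>[0,1]\<close> are represented by functions that are \<open>undefined\<close> outside \<open>[0,1]\<close>.\<close>

definition cadlag_space :: "(real \<Rightarrow> real) set" where
  "cadlag_space = {f \<in> extensional {0..1}.
     (\<forall>t\<in>{0..<1}. (f \<longlongrightarrow> f t) (at_right t)) \<and>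
     (\<forall>t\<in>{0<..1}. \<exists>l. (f \<longlongrightarrow> l) (at_left t))}"

definition cadlag_uniform_topology :: "(real \<Rightarrow> real) topology" where
  "cadlag_uniform_topology =
     mtopology_of (submetric (funspace {0..1} euclidean_metric) cadlag_space)"

text \<open>
  The metric space \<open>funspace\<close> consists of the bounded functions only; this loses nothing.
\<close>

lemma cadlag_bounded:
  assumes "f \<in> cadlag_space"
  shows "bounded (f ` {0..1})"
proof -
  have loc: "\<exists>d>0. \<forall>s\<in>{0..1}. \<bar>s - t\<bar> < d \<longrightarrow> \<bar>f s\<bar> \<le> K" if "t \<in> {0..1}"
    and K: "K = Max {\<bar>f t\<bar>, kr, kl}"
    and r: "t < 1 \<Longrightarrow> eventually (\<lambda>s. \<bar>f s\<bar> \<le> kr) (at_right t)"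
    and l: "0 < t \<Longrightarrow> eventually (\<lambda>s. \<bar>f s\<bar> \<le> kl) (at_left t)" for t K kr kl
  proof -
    obtain d1 where d1: "d1 > 0" "\<And>s. t < s \<Longrightarrow> s < t + d1 \<Longrightarrow> s \<le> 1 \<Longrightarrow> \<bar>f s\<bar> \<le> kr"
    proof (cases "t < 1")
      case True
      then obtain b where "b > t" "\<And>s. t < s \<Longrightarrow> s < b \<Longrightarrow> \<bar>f s\<bar> \<le> kr"
        using r[OF True] unfolding eventually_at_right_field by auto
      then show ?thesis using that[of "b - t"] by auto
    qed (use that[of 1] in auto)
    obtain d2 where d2: "d2 > 0" "\<And>s. s < t \<Longrightarrow> t - d2 < s \<Longrightarrow> 0 \<le> s \<Longrightarrow> \<bar>f s\<bar> \<le> kl"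
    proof (cases "0 < t")
      case True
      then obtain b where "b < t" "\<And>s. b < s \<Longrightarrow> s < t \<Longrightarrow> \<bar>f s\<bar> \<le> kl"
        using l[OF True] unfolding eventually_at_left_field by auto
      then show ?thesis using that[of "t - b"] by auto
    qed (use that[of 1] in auto)
    have "\<bar>f s\<bar> \<le> K" if s: "s \<in> {0..1}" "\<bar>s - t\<bar> < min d1 d2" for s
    proof (cases s t rule: linorder_cases)
      case less
      then show ?thesis using d2(2)[of s] s K by auto
    next
      case greater
      then show ?thesis using d1(2)[of s] s K by auto
    qed (use K in auto)
    then show ?thesis using d1(1) d2(1) by (intro exI[of _ "min d1 d2"]) auto
  qed
  have ev: "\<exists>k. eventually (\<lambda>s. \<bar>f s\<bar> \<le> k) F" if "(f \<longlongrightarrow> l) F" for l :: real and F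
  proof -
    have "eventually (\<lambda>s. \<bar>f s\<bar> < \<bar>l\<bar> + 1) F"
      using order_tendstoD(2)[OF tendsto_rabs[OF that], of "\<bar>l\<bar> + 1"] by simp
    then show ?thesis by (intro exI[of _ "\<bar>l\<bar> + 1"]) (auto elim: eventually_mono)
  qed
  have loc': "\<exists>K. \<exists>d>0. \<forall>s\<in>{0..1}. \<bar>s - t\<bar> < d \<longrightarrow> \<bar>f s\<bar> \<le> K" if t: "t \<in> {0..1}" for t
  proof -
    have "\<exists>k. t < 1 \<longrightarrow> eventually (\<lambda>s. \<bar>f s\<bar> \<le> k) (at_right t)"
    proof (cases "t < 1")
      case True
      then have "(f \<longlongrightarrow> f t) (at_right t)" using assms t by (simp add: cadlag_space_def)
      from ev[OF this] show ?thesis by blast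
    qed simp
    then obtain kr where kr: "t < 1 \<Longrightarrow> eventually (\<lambda>s. \<bar>f s\<bar> \<le> kr) (at_right t)" by blast
    have "\<exists>k. 0 < t \<longrightarrow> eventually (\<lambda>s. \<bar>f s\<bar> \<le> k) (at_left t)"
    proof (cases "0 < t")
      case True
      then obtain l where "(f \<longlongrightarrow> l) (at_left t)" using assms t unfolding cadlag_space_def by fastforce
      from ev[OF this] show ?thesis by blast
    qed simp
    then obtain kl where kl: "0 < t \<Longrightarrow> eventually (\<lambda>s. \<bar>f s\<bar> \<le> kl) (at_left t)" by blast
    show ?thesis using loc[OF t refl kr kl] by blast
  qed
  have "bounded (f ` ({0..1} \<inter> {0..1}))"
  proof (rule Bolzano[where P = "\<lambda>a b. bounded (f ` ({a..b} \<inter> {0..1}))"])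
    fix a b c :: real
    assume A: "bounded (f ` ({a..b} \<inter> {0..1}))" "bounded (f ` ({b..c} \<inter> {0..1}))"
    have "{a..c} \<inter> {0..1} \<subseteq> ({a..b} \<inter> {0..1}) \<union> ({b..c} \<inter> {0..1})"
      by auto
    from image_mono[OF this, of f] show "bounded (f ` ({a..c} \<inter> {0..1}))"
      using A by (metis bounded_Un bounded_subset image_Un)
  next
    fix t :: real
    assume "0 \<le> t" "t \<le> 1"
    then have "t \<in> {0..1}" by simp
    from loc'[OF this] obtain K d where d: "d > 0" "\<And>s. s \<in> {0..1} \<Longrightarrow> \<bar>s - t\<bar> < d \<Longrightarrow> \<bar>f s\<bar> \<le> K"
      by blast
    show "\<exists>d>0. \<forall>a b. a \<le> t \<and> t \<le> b \<and> b - a < d \<longrightarrow> bounded (f ` ({a..b} \<inter> {0..1}))"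
    proof (intro exI[of _ d] conjI allI impI d(1))
      fix a b assume "a \<le> t \<and> t \<le> b \<and> b - a < d"
      then show "bounded (f ` ({a..b} \<inter> {0..1}))"
        unfolding bounded_real by (intro exI[of _ K]) (auto intro!: d(2))
    qed
  qed simp
  then show ?thesis by simp
qed

lemma topspace_cadlag_uniform_topology [simp]:
  "topspace cadlag_uniform_topology = cadlag_space"
proof -
  have "cadlag_space \<subseteq> mspace (funspace {0..1} euclidean_metric)"
    using cadlag_bounded
    by (auto simp: Met_TC.fspace_def cadlag_space_def)
  then show ?thesis
    by (auto simp: cadlag_uniform_topology_def)
qed

definition absolutely_continuous_fun_on :: "real set \<Rightarrow> (real \<Rightarrow> real) \<Rightarrow> bool" where
  "absolutely_continuous_fun_on S f \<longleftrightarrow>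
     (\<forall>\<epsilon>>0. \<exists>\<delta>>0. \<forall>I :: (real \<times> real) set.
        finite I \<longrightarrow>
        (\<forall>(a, b)\<in>I. a \<le> b \<and> {a..b} \<subseteq> S) \<longrightarrow>
        pairwise (\<lambda>p q. disjnt {fst p<..<snd p} {fst q<..<snd q}) I \<longrightarrow>
        (\<Sum>(a, b)\<in>I. b - a) < \<delta> \<longrightarrow>
        (\<Sum>(a, b)\<in>I. \<bar>f b - f a\<bar>) < \<epsilon>)"

definition AC0 :: "(real \<Rightarrow> real) set" where
  "AC0 = {f. absolutely_continuous_fun_on {0..1} f \<and> f 0 = 0}"


section \<open>Large deviation principles\<close>

definition ln_ereal :: "ennreal \<Rightarrow> ereal" where
  "ln_ereal p = (if p = 0 then -\<infinity> else if p = \<infinity> then \<infinity> else ereal (ln (enn2real p)))"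

definition inner_measure_of :: "'w measure \<Rightarrow> 'w set \<Rightarrow> ennreal" where
  "inner_measure_of M A = (SUP E \<in> {E \<in> sets M. E \<subseteq> A}. emeasure M E)"

definition lower_semicontinuous_map :: "'a topology \<Rightarrow> ('a \<Rightarrow> ennreal) \<Rightarrow> bool" where
  "lower_semicontinuous_map T J \<longleftrightarrow> (\<forall>a. closedin T {x \<in> topspace T. J x \<le> a})"

definition good_rate_function :: "'a topology \<Rightarrow> ('a \<Rightarrow> ennreal) \<Rightarrow> bool" where
  "good_rate_function T J \<longleftrightarrow>
     lower_semicontinuous_map T J \<and>
     (\<forall>a::real. a \<ge> 0 \<longrightarrow> compactin T {x \<in> topspace T. J x \<le> ennreal a})"

definition ldp_speed :: "(real \<Rightarrow> real) \<Rightarrow> bool" where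
  "ldp_speed v \<longleftrightarrow>
     v \<in> borel_measurable (restrict_space borel {0..}) \<and>
     (\<forall>\<alpha>\<ge>0. v \<alpha> \<ge> 0) \<and> mono_on {0..} v \<and> filterlim v at_top at_top"

text \<open>
  In a non-separable space such as the cadlag functions with the uniform topology,
  \<open>{\<omega>. V \<alpha> \<omega> \<in> B}\<close> need not be an event for every Borel set \<open>B\<close>. The principle is therefore stated
  with the inner probability in the lower bound and the outer probability in the upper bound;
  both equal the probability whenever \<open>{\<omega>. V \<alpha> \<omega> \<in> B}\<close> is an event. (Using \<open>measure M\<close>
  directly would silently assign probability \<open>0\<close> to non-events.)
\<close>

definition large_deviation_principle ::
    "'w measure \<Rightarrow> 'a topology \<Rightarrow> (real \<Rightarrow> 'w \<Rightarrow> 'a) \<Rightarrow> (real \<Rightarrow> real) \<Rightarrow> ('a \<Rightarrow> ennreal) \<Rightarrow> bool"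
  where
  "large_deviation_principle M T V v J \<longleftrightarrow>
     (\<forall>\<alpha>>0. AE \<omega> in M. V \<alpha> \<omega> \<in> topspace T) \<and>
     lower_semicontinuous_map T J \<and>
     ldp_speed v \<and>
     (\<forall>B \<in> sigma_sets (topspace T) {U. openin T U}.
        - enn2ereal (INF x \<in> T interior_of B. J x)
          \<le> Liminf at_top (\<lambda>\<alpha>. ereal (1 / v \<alpha>) *
               ln_ereal (inner_measure_of M {\<omega> \<in> space M. V \<alpha> \<omega> \<in> B})) \<and>
        Limsup at_top (\<lambda>\<alpha>. ereal (1 / v \<alpha>) *
               ln_ereal (outer_measure_of M {\<omega> \<in> space M. V \<alpha> \<omega> \<in> B}))
          \<le> - enn2ereal (INF x \<in> T closure_of B. J x))"


section \<open>The rate function\<close>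

definition cluster_Lambda :: "real \<Rightarrow> real multiset measure \<Rightarrow> real \<Rightarrow> real" where
  "cluster_Lambda \<nu> Q \<theta> = \<nu> * ((\<integral>m. exp (\<theta> * real (size m)) \<partial>Q) - 1)"

definition legendre_transform :: "(real \<Rightarrow> real) \<Rightarrow> real \<Rightarrow> ereal" where
  "legendre_transform \<Lambda> x = (SUP \<theta>. ereal (\<theta> * x - \<Lambda> \<theta>))"

text \<open>
  An absolutely continuous function is differentiable almost everywhere, so the arbitrary value of
  \<open>deriv\<close> elsewhere is immaterial. Nothing is lost in \<open>e2ennreal\<close> when \<open>\<Lambda> 0 = 0\<close>, since then the
  transform is nonnegative.
\<close>

definition path_rate_function :: "(real \<Rightarrow> real) \<Rightarrow> (real \<Rightarrow> real) \<Rightarrow> ennreal" where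
  "path_rate_function \<Lambda> f =
     (if f \<in> AC0 then \<integral>\<^sup>+t\<in>{0..1}. e2ennreal (legendre_transform \<Lambda> (deriv f t)) \<partial>lborel
      else \<infinity>)"

end

theory Submission
  imports Defs "HOL-Complex_Analysis.Great_Picard"
begin

text \<open>
  Assign all points of a cluster to its immigrant. The increments of the resulting compound Poisson
  process over the cells of a grid have an explicit joint exponential moment, and at a fixed time
  the two processes differ at most by the sizes of the clusters that reach across \<open>0\<close> or that time.
  The total size of the clusters that reach across a given point has exponential moments of every
  order which do not depend on the point, so the difference is negligible on the scale \<open>\<alpha>\<close>. As all
  paths are nondecreasing and the functions of finite rate are uniformly continuous, control at
  finitely many times is control in the supremum norm.

  The upper bound is Chernoff's inequality for the integer valued vector of increments, of which only
  polynomially many values matter, together with compactness of the level sets. The lower bound is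
  exponential tilting. Both produce the rate function in the discretized form of a supremum, over
  uniform grids and dual vectors \<open>\<theta>\<close>, of \<open>\<Sum>j. \<theta> j * \<Delta>f j - \<Lambda> (\<theta> j) / n\<close>. It is continuous in \<open>f\<close> term by
  term, and it equals the integral of the Legendre transform of the derivative by the fundamental
  theorem of calculus for absolutely continuous functions, Jensen's inequality and Fatou's lemma.
\<close>

section \<open>Lebesgue differentiation on the line\<close>

text \<open>The uniform topology on cadlag paths is not separable, so path events may fail to be
  measurable. Each estimate therefore concerns finitely many grid times and yields a measurable
  exceptional set, valid almost surely. That some \<open>\<theta>\<close> violates
  \<open>Phi \<le> a\<close> is a union of half-spaces, while Chernoff's inequality treats one
  half-space; integrality of the masses lets every lattice value choose its own
  \<open>\<theta>\<close> at polynomial cost. Paths of finite rate are monotone and equicontinuous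
  because \<open>\<theta>\<close> may be taken very negative or very large. The hypothesis on
  \<open>L exp (\<theta> S)\<close> controls crossing clusters: the logarithm of the exponential
  moment of their total size is at most a constant times the mean of
  \<open>(L + 1) exp (\<theta> S)\<close>, and having this for every \<open>\<theta>\<close> gives
  decay faster than any exponential rate. Tilting needs a \<open>\<theta>\<close> at which the
  derivative of \<open>\<Lambda>\<close> is a prescribed slope, which must be positive; flat
  stretches of the target path are therefore mixed with the mean rate, where the Legendre transform
  vanishes.\<close>

lemma Lebesgue_upper_derivative_le:
  fixes g :: "real \<Rightarrow> real" and p q :: real
  assumes g: "integrable lborel g" and pq: "p < q"
  shows "AE x in lborel. g x < p \<longrightarrow>
    (\<exists>d>0. \<forall>u v. u \<le> x \<longrightarrow> x \<le> v \<longrightarrow> u < v \<longrightarrow> v - u < d \<longrightarrow> (LINT y:{u..v}|lborel. g y) \<le> q * (v - u))"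
proof -
  \<comment> \<open>\<open>E\<close> is negligible by a Vitali covering: an interval on which the
    average of \<open>g\<close> exceeds \<open>q\<close> can earn its excess over \<open>p\<close>
    only outside \<open>{x. g x < p}\<close>, hence only on a set of small weighted measure.\<close>
  define E where "E = {x. g x < p \<and> (\<forall>d>0. \<exists>u v. u \<le> x \<and> x \<le> v \<and> u < v \<and> v - u < d \<and>
      (LINT y:{u..v}|lborel. g y) > q * (v - u))}"
  have [measurable]: "g \<in> borel_measurable borel" using borel_measurable_integrable[OF g] by simp
  have intg: "set_integrable lborel S g" if "S \<in> sets borel" for S
    using g that unfolding set_integrable_def by (intro integrable_mult_indicator) auto
  have neg: "negligible (E \<inter> {-m<..<m})" if "m > 0" for m :: real
    unfolding negligible_outer_le
  proof (intro allI impI)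
    fix e :: real assume e: "e > 0"
    define J where "J = {-m<..<m}"
    define A where "A = {x. g x < p} \<inter> J"
    have [measurable]: "A \<in> sets borel" "J \<in> sets borel" unfolding A_def J_def by measurable
    \<comment> \<open>With the weight \<open>\<bar>g x - p\<bar>\<close>, the mass
      \<open>N (O' - A)\<close> is exactly what is available outside \<open>A\<close>. Outer
      regularity of \<open>N\<close>, rather than of Lebesgue measure, makes it at most
      \<open>e * (q - p)\<close>.\<close>
    define N where "N = density lborel (\<lambda>x. ennreal (\<bar>g x - p\<bar> * indicator J x))"
    have sN: "sets N = sets borel" by (simp add: N_def)
    have intN: "integrable lborel (\<lambda>x. \<bar>g x - p\<bar> * indicator J x)"
    proof -
      have "integrable lborel (indicat_real J)"
        by (intro integrable_real_indicator) (use that in \<open>auto simp: J_def\<close>)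
      then have "set_integrable lborel J (\<lambda>x. g x - p)"
        by (intro set_integral_diff intg) (auto simp: set_integrable_def)
      then have "set_integrable lborel J (\<lambda>x. \<bar>g x - p\<bar>)" by (rule set_integrable_abs)
      then show ?thesis by (simp add: set_integrable_def mult.commute)
    qed
    have NU: "emeasure N (space N) \<noteq> \<infinity>"
    proof -
      have "emeasure N (space N) = (\<integral>\<^sup>+x. ennreal (\<bar>g x - p\<bar> * indicator J x) \<partial>lborel)"
        by (simp add: N_def emeasure_density)
      also have "\<dots> < \<infinity>" using intN
        by (subst nn_integral_eq_integral[OF intN]) (auto simp: less_top)
      finally show ?thesis by simp
    qed
    interpret N: finite_measure N by standard (use NU in auto)
    let ?e = "e * (q - p)"
    have ep: "?e > 0" using e pq by simp
    have "emeasure N A = (INF U\<in>{U. A \<subseteq> U \<and> open U}. emeasure N U)"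
      by (rule outer_regular[OF sN NU]) auto
    moreover have "emeasure N A < emeasure N A + ennreal ?e"
      using ep N.emeasure_finite[of A] by (metis add.right_neutral ennreal_add_left_cancel_less ennreal_less_zero_iff infinity_ennreal_def not_gr_zero)
    ultimately obtain U where U: "A \<subseteq> U" "open U" "emeasure N U < emeasure N A + ennreal ?e"
      by (auto simp: INF_less_iff)
    define O' where "O' = U \<inter> J"
    have O': "open O'" "A \<subseteq> O'" using U by (auto simp: O'_def J_def A_def)
    have [measurable]: "O' \<in> sets borel" using O' by auto
    have "emeasure N (O' - A) \<le> emeasure N (U - A)"
      using U by (intro emeasure_mono) (auto simp: O'_def sN)
    also have "\<dots> = emeasure N U - emeasure N A"
      using U by (intro emeasure_Diff) (auto simp: sN)
    also have "\<dots> \<le> ennreal ?e"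
      using U(3) by (simp add: ennreal_minus_le_iff less_imp_le)
    finally have NOA: "emeasure N (O' - A) \<le> ennreal ?e" .
    \<comment> \<open>Centres and radii of a fine cover of \<open>E \<inter> J\<close>. A point of
      \<open>E\<close> need not be the centre of its interval, hence the passage to the midpoint
      below.\<close>
    define K where "K = {(c::real, r::real). 0 < r \<and> cball c r \<subseteq> O' \<and> (LINT y:cball c r|lborel. g y) > q * (2 * r)}"
    obtain C where C: "countable C" "C \<subseteq> K"
      "pairwise (\<lambda>i j. disjnt (cball (fst i) (snd i)) (cball (fst j) (snd j))) C"
      "negligible ((E \<inter> J) - (\<Union>i\<in>C. cball (fst i) (snd i)))"
    proof (rule Vitali_covering_theorem_cballs[of K snd "E \<inter> J" fst])
      show "i \<in> K \<Longrightarrow> 0 < snd i" for i by (auto simp: K_def)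
      fix x d :: real assume x: "x \<in> E \<inter> J" and d: "0 < d"
      then have "x \<in> O'" using O' by (auto simp: E_def A_def)
      then obtain k where k: "k > 0" "cball x k \<subseteq> O'" using O'(1) open_contains_cball by blast
      from x k(1) d obtain u v where uv: "u \<le> x" "x \<le> v" "u < v" "v - u < min d k"
        "(LINT y:{u..v}|lborel. g y) > q * (v - u)"
        unfolding E_def by (auto dest!: spec[of _ "min d k"])
      have cb: "cball ((u + v) / 2) ((v - u) / 2) = {u..v}"
        by (auto simp: cball_eq_atLeastAtMost field_simps)
      have "{u..v} \<subseteq> cball x k" using uv by (auto simp: dist_real_def)
      then show "\<exists>i. i \<in> K \<and> x \<in> cball (fst i) (snd i) \<and> snd i < d"
        using uv cb k by (intro exI[of _ "((u + v) / 2, (v - u) / 2)"]) (auto simp: K_def right_diff_distrib)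
    qed
    define W where "W = (\<Union>i\<in>C. cball (fst i) (snd i))"
    have dis: "disjoint_family_on (\<lambda>i. cball (fst i) (snd i)) C"
      using C(3) by (auto simp: disjoint_family_on_def pairwise_def disjnt_def)
    define N' where "N' = density lborel (\<lambda>x. ennreal (\<bar>g x - p\<bar> * indicator J x * indicator (O' - A) x))"
    \<comment> \<open>On \<open>A\<close> the integrand \<open>g - p\<close> is negative, so
      discarding \<open>A\<close> can only increase the integral.\<close>
    have ball: "ennreal (q - p) * emeasure lborel (cball (fst i) (snd i)) \<le> emeasure N' (cball (fst i) (snd i))"
      if "i \<in> C" for i
    proof -
      obtain c r where i: "i = (c, r)" by (cases i)
      with that C(2) have r: "0 < r" "cball c r \<subseteq> O'" "(LINT y:cball c r|lborel. g y) > q * (2 * r)"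
        by (auto simp: K_def)
      let ?h = "\<lambda>x. (\<bar>g x - p\<bar> * indicator J x * indicator (O' - A) x) * indicator (cball c r) x"
      have ih: "integrable lborel ?h"
        using integrable_mult_indicator[of "cball c r \<inter> (O' - A)" lborel, OF _ intN]
        by (auto simp: mult_ac indicator_inter_arith)
      have ic: "emeasure lborel (cball c r) = ennreal (2 * r)"
        using r by (simp add: cball_eq_atLeastAtMost)
      have sp: "set_integrable lborel (cball c r) (\<lambda>_. p)"
        unfolding set_integrable_def using r
        by (intro integrable_scaleR_left integrable_real_indicator) (auto simp: cball_eq_atLeastAtMost)
      have "(q - p) * (2 * r) \<le> (LINT y:cball c r|lborel. g y) - p * (2 * r)"
        using r by (simp add: algebra_simps)
      also have "\<dots> = (LINT y:cball c r|lborel. g y - p)"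
        using r by (subst set_integral_diff(2)[OF intg sp]) (auto simp: set_lebesgue_integral_def cball_eq_atLeastAtMost)
      also have "\<dots> \<le> (\<integral>x. ?h x \<partial>lborel)"
        unfolding set_lebesgue_integral_def
      proof (rule integral_mono)
        show "integrable lborel (\<lambda>x. indicat_real (cball c r) x *\<^sub>R (g x - p))"
          using set_integral_diff(1)[OF intg sp] by (simp add: set_integrable_def)
        show "indicat_real (cball c r) x *\<^sub>R (g x - p) \<le> ?h x" for x
          using r(2) by (auto simp: indicator_def O'_def A_def)
      qed (rule ih)
      finally have "ennreal ((q - p) * (2 * r)) \<le> ennreal (\<integral>x. ?h x \<partial>lborel)"
        by (rule ennreal_leI)
      also have "\<dots> = (\<integral>\<^sup>+x. ennreal (?h x) \<partial>lborel)"
        by (intro nn_integral_eq_integral[symmetric] ih) auto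
      also have "\<dots> = emeasure N' (cball c r)"
        by (auto simp: N'_def emeasure_density intro!: nn_integral_cong split: split_indicator)
      finally show ?thesis using pq r by (simp add: i ic ennreal_mult)
    qed
    have [measurable]: "W \<in> sets borel" unfolding W_def using C(1) by (intro sets.countable_UN') auto
    have "ennreal (q - p) * emeasure lborel W = ennreal (q - p) * (\<integral>\<^sup>+i. emeasure lborel (cball (fst i) (snd i)) \<partial>count_space C)"
      unfolding W_def using C(1) dis by (subst emeasure_UN_countable) auto
    also have "\<dots> = (\<integral>\<^sup>+i. ennreal (q - p) * emeasure lborel (cball (fst i) (snd i)) \<partial>count_space C)"
      by (rule nn_integral_cmult[symmetric]) auto
    also have "\<dots> \<le> (\<integral>\<^sup>+i. emeasure N' (cball (fst i) (snd i)) \<partial>count_space C)"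
      using ball by (intro nn_integral_mono) auto
    also have "\<dots> = emeasure N' W"
      unfolding W_def using C(1) dis by (subst emeasure_UN_countable) (auto simp: N'_def)
    also have "\<dots> \<le> emeasure N' UNIV" by (intro emeasure_mono) (auto simp: N'_def)
    also have "\<dots> = emeasure N (O' - A)"
      by (auto simp: N'_def N_def emeasure_density intro!: nn_integral_cong split: split_indicator)
    also have "\<dots> \<le> ennreal (q - p) * ennreal e" using NOA pq e by (simp add: ennreal_mult[symmetric] mult.commute)
    finally have W: "emeasure lborel W \<le> ennreal e"
      using pq by (subst (asm) ennreal_mult_le_mult_iff) auto
    show "\<exists>T. E \<inter> {-m<..<m} \<subseteq> T \<and> T \<in> lmeasurable \<and> measure lebesgue T \<le> e"
    proof (intro exI conjI)
      let ?R = "(E \<inter> J) - W"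
      have R: "?R \<in> null_sets lebesgue" using C(4) by (simp add: negligible_iff_null_sets W_def)
      have Wl: "W \<in> sets lebesgue" by simp
      have em: "emeasure lebesgue (W \<union> ?R) = emeasure lborel W"
        using emeasure_Un_null_set[OF Wl R] by simp
      show "E \<inter> {-m<..<m} \<subseteq> W \<union> ?R" by (auto simp: J_def)
      have "emeasure lebesgue (W \<union> ?R) < \<infinity>" using em W by (simp add: order_le_less_trans[OF W])
      with sets.Un[OF Wl null_setsD2[OF R]] show "W \<union> ?R \<in> lmeasurable" by (intro fmeasurableI)
      show "measure lebesgue (W \<union> ?R) \<le> e"
        using em W e by (simp add: measure_def enn2real_leI)
    qed
  qed
  have "E = (\<Union>n::nat. E \<inter> {-real (Suc n)<..<real (Suc n)})"
  proof safe
    fix x :: real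
    obtain n :: nat where "\<bar>x\<bar> < real n" using reals_Archimedean2 by blast
    then show "x \<in> E \<Longrightarrow> x \<in> (\<Union>n::nat. E \<inter> {-real (Suc n)<..<real (Suc n)})"
      by (auto intro!: exI[of _ n])
  qed
  moreover have "negligible \<dots>"
  proof (intro negligible_countable_Union)
    fix S assume "S \<in> range (\<lambda>n. E \<inter> {- real (Suc n)<..<real (Suc n)})"
    then obtain n :: nat where "S = E \<inter> {- real (Suc n)<..<real (Suc n)}" by blast
    then show "negligible S" using neg[of "real (Suc n)"] by simp
  qed simp
  ultimately have "negligible E" by simp
  then have "AE x in lebesgue. x \<notin> E" using AE_not_in by (auto simp: negligible_iff_null_sets)
  then have "AE x in lborel. x \<notin> E" by (simp add: AE_completion_iff)
  then show ?thesis
    by eventually_elim (unfold E_def mem_Collect_eq, meson not_less)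
qed

lemma set_integral_lborel_Icc_eq_Ioc:
  fixes g :: "real \<Rightarrow> real"
  assumes "integrable lborel g"
  shows "(LINT y:{u..v}|lborel. g y) = (LINT y:{u<..v}|lborel. g y)"
  unfolding set_lebesgue_integral_def
proof (rule integral_cong_AE)
  have [measurable]: "g \<in> borel_measurable borel" using borel_measurable_integrable[OF assms] by simp
  show "(\<lambda>x. indicat_real {u..v} x *\<^sub>R g x) \<in> borel_measurable lborel"
    "(\<lambda>x. indicat_real {u<..v} x *\<^sub>R g x) \<in> borel_measurable lborel" by measurable
  show "AE x in lborel. indicat_real {u..v} x *\<^sub>R g x = indicat_real {u<..v} x *\<^sub>R g x"
    using AE_lborel_singleton[of u] by (auto simp: indicator_def)
qed

text \<open>The one-sided bound is used for \<open>g\<close> and for \<open>- g\<close>, with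
  rational \<open>p < q\<close> squeezed between \<open>g x\<close> and \<open>g x + e\<close>;
  rational thresholds keep the exceptional set a countable union of null sets. The intervals only
  have to contain \<open>x\<close>, which is the form that grid cells require.\<close>

theorem Lebesgue_differentiation:
  fixes g :: "real \<Rightarrow> real"
  assumes g: "integrable lborel g"
  shows "AE x in lborel. \<forall>e>0. \<exists>d>0. \<forall>u v. u \<le> x \<longrightarrow> x \<le> v \<longrightarrow> u < v \<longrightarrow> v - u < d \<longrightarrow>
    \<bar>(LINT y:{u<..v}|lborel. g y) - g x * (v - u)\<bar> \<le> e * (v - u)"
proof -
  let ?P = "\<lambda>g x p q. g x < p \<longrightarrow>
    (\<exists>d>0. \<forall>u v. u \<le> x \<longrightarrow> x \<le> v \<longrightarrow> u < v \<longrightarrow> v - u < d \<longrightarrow> (LINT y:{u..v}|lborel. g y) \<le> q * (v - u))"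
  have all: "AE x in lborel. \<forall>p\<in>\<rat>. \<forall>q\<in>\<rat>. p < q \<longrightarrow> ?P g x p q"
    if g: "integrable lborel g" for g :: "real \<Rightarrow> real"
  proof -
    have "AE x in lborel. \<forall>q\<in>\<rat>. p < q \<longrightarrow> ?P g x p q" for p
      unfolding AE_ball_countable[OF countable_rat]
      by (intro ballI AE_impI Lebesgue_upper_derivative_le g)
    then show ?thesis unfolding AE_ball_countable[OF countable_rat] by blast
  qed
  have "integrable lborel (\<lambda>x. - g x)" using g by simp
  from all[OF this] all[OF g] show ?thesis
  proof eventually_elim
    fix x
    assume m: "\<forall>p\<in>\<rat>. \<forall>q\<in>\<rat>. p < q \<longrightarrow> ?P (\<lambda>x. - g x) x p q" and h: "\<forall>p\<in>\<rat>. \<forall>q\<in>\<rat>. p < q \<longrightarrow> ?P g x p q"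
    have key: "\<exists>d>0. \<forall>u v. u \<le> x \<longrightarrow> x \<le> v \<longrightarrow> u < v \<longrightarrow> v - u < d \<longrightarrow> (LINT y:{u..v}|lborel. g y) \<le> (g x + e) * (v - u)"
      if e: "e > 0" and h: "\<forall>p\<in>\<rat>. \<forall>q\<in>\<rat>. p < q \<longrightarrow> ?P g x p q" for e and g :: "real \<Rightarrow> real"
    proof -
      obtain p where p: "p \<in> \<rat>" "g x < p" "p < g x + e" using Rats_dense_in_real[of "g x" "g x + e"] e by auto
      obtain q where q: "q \<in> \<rat>" "p < q" "q < g x + e" using Rats_dense_in_real[of p "g x + e"] p by auto
      from h p q obtain d where d: "d > 0"
        "\<And>u v. u \<le> x \<Longrightarrow> x \<le> v \<Longrightarrow> u < v \<Longrightarrow> v - u < d \<Longrightarrow> (LINT y:{u..v}|lborel. g y) \<le> q * (v - u)" by blast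
      have "q * (v - u) \<le> (g x + e) * (v - u)" if "u < v" for u v using q that by (intro mult_right_mono) auto
      with d show ?thesis by (intro exI[of _ d] conjI allI impI) (blast intro: order_trans)+
    qed
    show "\<forall>e>0. \<exists>d>0. \<forall>u v. u \<le> x \<longrightarrow> x \<le> v \<longrightarrow> u < v \<longrightarrow> v - u < d \<longrightarrow>
      \<bar>(LINT y:{u<..v}|lborel. g y) - g x * (v - u)\<bar> \<le> e * (v - u)"
    proof (intro allI impI)
      fix e :: real assume e: "e > 0"
      from key[OF e h] obtain d1 where d1: "d1 > 0"
        "\<And>u v. u \<le> x \<Longrightarrow> x \<le> v \<Longrightarrow> u < v \<Longrightarrow> v - u < d1 \<Longrightarrow> (LINT y:{u..v}|lborel. g y) \<le> (g x + e) * (v - u)" by blast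
      from key[OF e m] obtain d2 where d2: "d2 > 0"
        "\<And>u v. u \<le> x \<Longrightarrow> x \<le> v \<Longrightarrow> u < v \<Longrightarrow> v - u < d2 \<Longrightarrow> (LINT y:{u..v}|lborel. - g y) \<le> (- g x + e) * (v - u)" by blast
      have un: "(LINT y:{u..v}|lborel. - g y) = - (LINT y:{u..v}|lborel. g y)" for u v
        by (simp add: set_lebesgue_integral_def)
      show "\<exists>d>0. \<forall>u v. u \<le> x \<longrightarrow> x \<le> v \<longrightarrow> u < v \<longrightarrow> v - u < d \<longrightarrow>
        \<bar>(LINT y:{u<..v}|lborel. g y) - g x * (v - u)\<bar> \<le> e * (v - u)"
      proof (intro exI[of _ "min d1 d2"] conjI allI impI)
        fix u v assume uv: "u \<le> x" "x \<le> v" "u < v" "v - u < min d1 d2"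
        show "\<bar>(LINT y:{u<..v}|lborel. g y) - g x * (v - u)\<bar> \<le> e * (v - u)"
          using d1(2)[of u v] d2(2)[of u v] uv un[of u v] set_integral_lborel_Icc_eq_Ioc[OF g, of u v]
          by (auto simp: abs_le_iff algebra_simps)
      qed (use d1 d2 in auto)
    qed
  qed
qed

section \<open>Absolutely continuous functions\<close>

text \<open>Both endpoints are rounded down to the grid, so blocks of nonoverlapping intervals stay
  disjoint and the increments of a function telescope over a block.\<close>

definition grid_block :: "nat \<Rightarrow> real \<times> real \<Rightarrow> nat set" where
  "grid_block n p = {nat \<lfloor>real n * fst p\<rfloor>..<nat \<lfloor>real n * snd p\<rfloor>}"

definition nonoverlapping :: "(real \<times> real) set \<Rightarrow> bool" where
  "nonoverlapping I \<longleftrightarrow> finite I \<and> (\<forall>(a, b)\<in>I. a \<le> b \<and> {a..b} \<subseteq> {0..1}) \<and>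
     pairwise (\<lambda>p q. disjnt {fst p<..<snd p} {fst q<..<snd q}) I"

lemma nonoverlappingD:
  assumes "nonoverlapping I" "p \<in> I"
  shows "0 \<le> fst p" "fst p \<le> snd p" "snd p \<le> 1"
  using assms by (cases p; auto simp: nonoverlapping_def)+

lemma AC_iff:
  "absolutely_continuous_fun_on {0..1} f \<longleftrightarrow>
    (\<forall>\<epsilon>>0. \<exists>\<delta>>0. \<forall>I. nonoverlapping I \<longrightarrow> (\<Sum>p\<in>I. snd p - fst p) < \<delta> \<longrightarrow>
       (\<Sum>p\<in>I. \<bar>f (snd p) - f (fst p)\<bar>) < \<epsilon>)"
  unfolding absolutely_continuous_fun_on_def nonoverlapping_def case_prod_beta by (simp only: imp_conjL)

lemma grid_block_disjoint:
  assumes "nonoverlapping I"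
  shows "disjoint_family_on (grid_block n) I"
  unfolding disjoint_family_on_def
proof (intro ballI impI)
  fix p q assume pq: "p \<in> I" "q \<in> I" "p \<noteq> q"
  have d: "disjnt {fst p<..<snd p} {fst q<..<snd q}"
    using assms pq by (auto simp: nonoverlapping_def pairwise_def)
  note * = nonoverlappingD[OF assms pq(1)] nonoverlappingD[OF assms pq(2)]
  have m: "nat \<lfloor>real n * s\<rfloor> \<le> nat \<lfloor>real n * t\<rfloor>" if "s \<le> t" for s t
    using that by (intro nat_mono floor_mono mult_left_mono) auto
  \<comment> \<open>Intervals with disjoint open interiors are ordered unless one of them is a
    single point, and a single point has an empty block.\<close>
  consider "fst p = snd p" | "fst q = snd q" | "snd p \<le> fst q" | "snd q \<le> fst p"
  proof -
    have False if "fst p < snd p" "fst q < snd q" "snd p > fst q" "snd q > fst p"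
    proof -
      have "(max (fst p) (fst q) + min (snd p) (snd q)) / 2 \<in> {fst p<..<snd p} \<inter> {fst q<..<snd q}"
        using that by (auto simp: max_def min_def field_simps)
      with d show False by (auto simp: disjnt_def)
    qed
    with that * show ?thesis by (metis le_less linorder_not_less)
  qed
  then show "grid_block n p \<inter> grid_block n q = {}"
  proof cases
    case 3
    from m[OF this] show ?thesis by (auto simp: grid_block_def)
  next
    case 4
    from m[OF this] show ?thesis by (auto simp: grid_block_def)
  qed (auto simp: grid_block_def)
qed

lemma sum_grid_blocks:
  assumes "nonoverlapping I"
  shows "(\<Sum>p\<in>I. \<Sum>j\<in>grid_block n p. \<phi> j) = (\<Sum>j\<in>(\<Union>p\<in>I. grid_block n p). \<phi> j)"
  using assms grid_block_disjoint[OF assms, of n]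
  by (subst sum.UNION_disjoint) (auto simp: nonoverlapping_def disjoint_family_on_def grid_block_def)

lemma grid_blocks_subset:
  assumes "nonoverlapping I"
  shows "(\<Union>p\<in>I. grid_block n p) \<subseteq> {..<n}"
proof -
  have "nat \<lfloor>real n * snd p\<rfloor> \<le> n" if "p \<in> I" for p
  proof -
    have "real n * snd p \<le> real n * 1" using nonoverlappingD[OF assms that] by (intro mult_left_mono) auto
    then show ?thesis by linarith
  qed
  then show ?thesis by (fastforce simp: grid_block_def)
qed

lemma card_grid_blocks:
  assumes "nonoverlapping I"
  shows "real (card (\<Union>p\<in>I. grid_block n p)) \<le> real n * (\<Sum>p\<in>I. snd p - fst p) + real (card I)"
proof -
  have "real (card (grid_block n p)) \<le> real n * (snd p - fst p) + 1" if "p \<in> I" for p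
  proof -
    have "nat \<lfloor>real n * fst p\<rfloor> \<le> nat \<lfloor>real n * snd p\<rfloor>"
      using nonoverlappingD[OF assms that] by (intro nat_mono floor_mono mult_left_mono) auto
    moreover have "0 \<le> real n * fst p" "0 \<le> real n * snd p"
      using nonoverlappingD[OF assms that] by auto
    ultimately show ?thesis by (simp add: grid_block_def of_nat_diff algebra_simps) linarith
  qed
  then have "(\<Sum>p\<in>I. real (card (grid_block n p))) \<le> (\<Sum>p\<in>I. real n * (snd p - fst p) + 1)"
    by (rule sum_mono)
  moreover have "card (\<Union>p\<in>I. grid_block n p) = (\<Sum>p\<in>I. card (grid_block n p))"
    using sum_grid_blocks[OF assms, where n = n and \<phi> = "\<lambda>_. 1::nat"] by simp
  ultimately show ?thesis by (simp add: sum.distrib sum_distrib_left)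
qed

text \<open>Rounding costs at most one cell per interval. This error \<open>card I\<close> does not
  grow with \<open>n\<close>, so the strict slack in the total length absorbs it.\<close>

lemma eventually_card_grid_blocks:
  assumes "nonoverlapping I" "(\<Sum>p\<in>I. snd p - fst p) < \<delta>"
  shows "eventually (\<lambda>n. real (card (\<Union>p\<in>I. grid_block n p)) < \<delta> * real n) sequentially"
proof -
  let ?c = "real (card I) / (\<delta> - (\<Sum>p\<in>I. snd p - fst p))"
  have "eventually (\<lambda>n. real n > ?c) sequentially"
    using filterlim_real_sequentially by (auto simp: filterlim_at_top_dense)
  then show ?thesis
  proof eventually_elim
    case (elim n)
    then have "real n * (\<Sum>p\<in>I. snd p - fst p) + real (card I) < \<delta> * real n"
      using assms(2) by (simp add: field_simps)
    with card_grid_blocks[OF assms(1), of n] show ?case by simp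
  qed
qed

lemma sum_grid_block_telescope:
  assumes "0 \<le> fst p" "fst p \<le> snd p"
  shows "(\<Sum>j\<in>grid_block n p. f (real (Suc j) / real n) - f (real j / real n) :: real)
    = f (real (nat \<lfloor>real n * snd p\<rfloor>) / real n) - f (real (nat \<lfloor>real n * fst p\<rfloor>) / real n)"
proof -
  have "nat \<lfloor>real n * fst p\<rfloor> \<le> nat \<lfloor>real n * snd p\<rfloor>"
    using assms by (intro nat_mono floor_mono mult_left_mono) auto
  then show ?thesis
    unfolding grid_block_def using sum_Suc_diff'[of _ _ "\<lambda>j. f (real j / real n)"] by simp
qed

lemma grid_floor_tendsto:
  assumes "t \<ge> 0"
  shows "(\<lambda>n. real (nat \<lfloor>real n * t\<rfloor>) / real n) \<longlonglongrightarrow> t"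
proof (rule real_tendsto_sandwich[of "\<lambda>n. t - 1 / real n" _ _ "\<lambda>n. t"])
  have *: "real (nat \<lfloor>real n * t\<rfloor>) = of_int \<lfloor>real n * t\<rfloor>" for n using assms by simp
  show "eventually (\<lambda>n. t - 1 / real n \<le> real (nat \<lfloor>real n * t\<rfloor>) / real n) sequentially"
    using eventually_gt_at_top[of 0]
  proof eventually_elim
    case (elim n)
    have "real n * t - 1 \<le> of_int \<lfloor>real n * t\<rfloor>" by linarith
    then have "(real n * t - 1) / real n \<le> real (nat \<lfloor>real n * t\<rfloor>) / real n"
      unfolding * by (rule divide_right_mono) simp
    with elim show ?case by (simp add: diff_divide_distrib)
  qed
  show "eventually (\<lambda>n. real (nat \<lfloor>real n * t\<rfloor>) / real n \<le> t) sequentially"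
    using eventually_gt_at_top[of 0]
  proof eventually_elim
    case (elim n)
    have "of_int \<lfloor>real n * t\<rfloor> \<le> real n * t" by linarith
    then have "real (nat \<lfloor>real n * t\<rfloor>) / real n \<le> (real n * t) / real n"
      unfolding * by (rule divide_right_mono) simp
    with elim show ?case by simp
  qed
  show "(\<lambda>n. t - 1 / real n) \<longlonglongrightarrow> t"
    using tendsto_diff[OF tendsto_const lim_1_over_n, of t] by simp
qed simp

lemma grid_floor_in_unit:
  assumes "t \<in> {0..1}"
  shows "real (nat \<lfloor>real n * t\<rfloor>) / real n \<in> {0..1}"
proof -
  have "real n * t \<le> real n * 1" using assms by (intro mult_left_mono) auto
  then have "nat \<lfloor>real n * t\<rfloor> \<le> n" by linarith
  then show ?thesis by (cases "n = 0") (auto simp: divide_le_eq_1)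
qed

section \<open>Absolute continuity along grids and the dyadic total variation\<close>

lemma AC_continuous_on:
  assumes "absolutely_continuous_fun_on {0..1} f"
  shows "continuous_on {0..1} f"
  unfolding continuous_on_iff
proof (intro ballI allI impI)
  fix x e :: real assume x: "x \<in> {0..1}" and e: "e > 0"
  obtain d where d: "d > 0" "\<And>I. nonoverlapping I \<Longrightarrow> (\<Sum>p\<in>I. snd p - fst p) < d \<Longrightarrow>
       (\<Sum>p\<in>I. \<bar>f (snd p) - f (fst p)\<bar>) < e"
    using assms e unfolding AC_iff by blast
  show "\<exists>d>0. \<forall>x'\<in>{0..1}. dist x' x < d \<longrightarrow> dist (f x') (f x) < e"
  proof (intro exI[of _ d] conjI ballI impI d(1))
    fix x' assume x': "x' \<in> {0..1}" "dist x' x < d"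
    show "dist (f x') (f x) < e"
      using d(2)[of "{(min x x', max x x')}"] x x'
      by (cases "x \<le> x'") (auto simp: nonoverlapping_def dist_real_def abs_minus_commute)
  qed
qed

text \<open>A set \<open>J\<close> of cells has total length \<open>card J / n\<close>, so the
  modulus of absolute continuity becomes a bound on the proportion of cells, uniform over all
  grids.\<close>

lemma AC_grid:
  assumes "absolutely_continuous_fun_on {0..1} f" "\<epsilon> > 0"
  obtains \<delta> where "\<delta> > 0"
    "\<And>n J. n > 0 \<Longrightarrow> J \<subseteq> {..<n} \<Longrightarrow> real (card J) < \<delta> * real n \<Longrightarrow>
      (\<Sum>j\<in>J. \<bar>f (real (Suc j) / real n) - f (real j / real n)\<bar>) < \<epsilon>"
proof -
  obtain d where d: "d > 0" "\<And>I. nonoverlapping I \<Longrightarrow> (\<Sum>p\<in>I. snd p - fst p) < d \<Longrightarrow>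
       (\<Sum>p\<in>I. \<bar>f (snd p) - f (fst p)\<bar>) < \<epsilon>"
    using assms unfolding AC_iff by blast
  show ?thesis
  proof (rule that[OF d(1)])
    fix n J assume n: "n > (0::nat)" and J: "J \<subseteq> {..<n}" "real (card J) < d * real n"
    let ?c = "\<lambda>j. (real j / real n, real (Suc j) / real n)"
    have inj: "inj_on ?c J" using n by (auto simp: inj_on_def)
    have fin: "finite J" using J finite_subset by blast
    have ne: "disjnt {real i / real n<..<real (Suc i) / real n} {real j / real n<..<real (Suc j) / real n}"
      if "i \<noteq> j" for i j
    proof -
      have "real (Suc i) / real n \<le> real j / real n \<or> real (Suc j) / real n \<le> real i / real n"
        using that n by (auto simp: divide_le_cancel)
      then show ?thesis by (auto simp: disjnt_def)
    qed
    have "nonoverlapping (?c ` J)"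
      unfolding nonoverlapping_def
    proof (intro conjI)
      show "\<forall>(a, b)\<in>?c ` J. a \<le> b \<and> {a..b} \<subseteq> {0..1}"
        using n J by (force simp: divide_le_cancel field_simps)
      show "pairwise (\<lambda>p q. disjnt {fst p<..<snd p} {fst q<..<snd q}) (?c ` J)"
        using ne by (force simp: pairwise_def)
    qed (use fin in auto)
    moreover have "(\<Sum>p\<in>?c ` J. snd p - fst p) < d"
    proof -
      have "(\<Sum>p\<in>?c ` J. snd p - fst p) = (\<Sum>j\<in>J. 1 / real n)"
        by (subst sum.reindex[OF inj]) (auto intro!: sum.cong simp: diff_divide_distrib[symmetric])
      also have "\<dots> = real (card J) / real n" by simp
      also have "\<dots> < d" using J n by (simp add: field_simps)
      finally show ?thesis .
    qed
    ultimately have "(\<Sum>p\<in>?c ` J. \<bar>f (snd p) - f (fst p)\<bar>) < \<epsilon>" by (rule d(2))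
    then show "(\<Sum>j\<in>J. \<bar>f (real (Suc j) / real n) - f (real j / real n)\<bar>) < \<epsilon>"
      by (subst (asm) sum.reindex[OF inj]) simp
  qed
qed

text \<open>\<open>H\<close> is the limit of the variations of \<open>f\<close> along the dyadic
  grids. Nested grids make these variations increasing, absolute continuity keeps them bounded, and
  continuity of \<open>f\<close> carries the domination of increments from dyadic points to all
  times.\<close>

lemma AC_total_variation:
  assumes f: "absolutely_continuous_fun_on {0..1} f"
  obtains H :: "real \<Rightarrow> real" where "absolutely_continuous_fun_on {0..1} H"
    "\<And>s t. 0 \<le> s \<Longrightarrow> s \<le> t \<Longrightarrow> t \<le> 1 \<Longrightarrow> \<bar>f t - f s\<bar> \<le> H t - H s"
proof -
  define D where "D k j = \<bar>f (real (Suc j) / real (2 ^ k)) - f (real j / real (2 ^ k))\<bar>" for k j :: nat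
  define V where "V k t = (\<Sum>j<nat \<lfloor>real (2 ^ k) * t\<rfloor>. D k j)" for k t
  have D0: "D k j \<ge> 0" for k j by (simp add: D_def)
  \<comment> \<open>Triangle inequality at the midpoint of each cell: refinement never decreases the
    variation.\<close>
  have step: "(\<Sum>j<N. D k j) \<le> (\<Sum>j<2 * N. D (Suc k) j)" for N k
  proof (induction N)
    case (Suc N)
    have eq: "real (Suc (Suc (2 * N))) / real (2 ^ Suc k) = real (Suc N) / real (2 ^ k)"
      "real (2 * N) / real (2 ^ Suc k) = real N / real (2 ^ k)" by (simp_all add: field_simps)
    have "D k N \<le> D (Suc k) (2 * N) + D (Suc k) (Suc (2 * N))"
      unfolding D_def eq by linarith
    with Suc show ?case by simp
  qed simp
  have mono_k: "V k t \<le> V (Suc k) t" if "t \<ge> 0" for k t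
  proof -
    have "2 * \<lfloor>real (2 ^ k) * t\<rfloor> \<le> \<lfloor>real (2 ^ Suc k) * t\<rfloor>"
      by (simp add: mult.assoc) linarith
    then have "2 * nat \<lfloor>real (2 ^ k) * t\<rfloor> \<le> nat \<lfloor>real (2 ^ Suc k) * t\<rfloor>" by linarith
    then have "(\<Sum>j<2 * nat \<lfloor>real (2 ^ k) * t\<rfloor>. D (Suc k) j) \<le> V (Suc k) t"
      unfolding V_def by (intro sum_mono2) (auto simp: D0)
    with step[of k "nat \<lfloor>real (2 ^ k) * t\<rfloor>"] show ?thesis unfolding V_def by linarith
  qed
  have inc: "incseq (\<lambda>k. V k t)" if "t \<ge> 0" for t by (intro incseq_SucI mono_k that)
  have fl: "nat \<lfloor>real (2 ^ k) * s\<rfloor> \<le> nat \<lfloor>real (2 ^ k) * t\<rfloor>" if "s \<le> t" for s t k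
    using that by (intro nat_mono floor_mono mult_left_mono) auto
  have mono_t: "V k s \<le> V k t" if "s \<le> t" for s t k
    unfolding V_def using fl[OF that] by (intro sum_mono2) (auto simp: D0)
  obtain B where B: "\<And>k. V k 1 \<le> B"
  proof -
    obtain d where d: "d > 0"
      "\<And>n J. n > 0 \<Longrightarrow> J \<subseteq> {..<n} \<Longrightarrow> real (card J) < d * real n \<Longrightarrow>
      (\<Sum>j\<in>J. \<bar>f (real (Suc j) / real n) - f (real j / real n)\<bar>) < 1"
      using AC_grid[OF f, of 1] by auto
    \<comment> \<open>A dyadic interval of length \<open>(1/2) ^ k0\<close> has variation at most 1
      on every finer grid, and the unit interval consists of \<open>2 ^ k0\<close> of them.\<close>
    obtain k0 where k0: "(1/2) ^ k0 < d" using real_arch_pow_inv[OF d(1), of "1/2"] by auto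
    have bd: "V k 1 \<le> 2 ^ k0" if "k \<ge> k0" for k
    proof -
      have fk: "nat \<lfloor>real (2 ^ k) * 1\<rfloor> = 2 ^ k"
        by (metis floor_of_nat mult.right_neutral nat_int)
      have "V k 1 = (\<Sum>j<2 ^ k0 * 2 ^ (k - k0). D k j)"
        unfolding V_def fk using that by (simp flip: power_add)
      also have "\<dots> = (\<Sum>m<2 ^ k0. sum (D k) {m * 2 ^ (k - k0)..<m * 2 ^ (k - k0) + 2 ^ (k - k0)})"
        by (rule sum.nat_group[symmetric])
      also have "\<dots> \<le> (\<Sum>m<(2::nat) ^ k0. 1)"
      proof (rule sum_mono)
        fix m :: nat assume "m \<in> {..<2 ^ k0}"
        then have m: "Suc m \<le> 2 ^ k0" by simp
        have "m * 2 ^ (k - k0) + 2 ^ (k - k0) = Suc m * 2 ^ (k - k0)" by simp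
        also have "\<dots> \<le> 2 ^ k0 * 2 ^ (k - k0)" using m by (rule mult_right_mono) simp
        also have "\<dots> = 2 ^ k" using that by (simp flip: power_add)
        finally have "{m * 2 ^ (k - k0)..<m * 2 ^ (k - k0) + 2 ^ (k - k0)} \<subseteq> {..<2 ^ k}" by auto
        moreover have "real (card {m * 2 ^ (k - k0)..<m * 2 ^ (k - k0) + 2 ^ (k - k0)}) < d * real (2 ^ k)"
        proof -
          have "(2::real) ^ (k - k0) = (1/2) ^ k0 * 2 ^ k"
            using that by (simp add: power_diff power_divide)
          also have "\<dots> < d * 2 ^ k" using k0 by simp
          finally show ?thesis by simp
        qed
        ultimately show "sum (D k) {m * 2 ^ (k - k0)..<m * 2 ^ (k - k0) + 2 ^ (k - k0)} \<le> 1"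
          unfolding D_def by (intro d(2)[THEN order.strict_implies_order]) auto
      qed
      finally show ?thesis by simp
    qed
    have "V k 1 \<le> 2 ^ k0" for k
      using bd[of "max k k0"] incseqD[OF inc, of 1 k "max k k0"] by simp
    then show ?thesis by (rule that)
  qed
  define H where "H t = lim (\<lambda>k. V k t)" for t
  have lim: "(\<lambda>k. V k t) \<longlonglongrightarrow> H t" if t: "t \<in> {0..1}" for t
  proof -
    have "V k t \<le> B" for k using mono_t[of t 1 k] B[of k] t by auto
    moreover have "incseq (\<lambda>k. V k t)" using t by (intro inc) auto
    ultimately obtain L where "(\<lambda>k. V k t) \<longlonglongrightarrow> L" by (metis incseq_convergent)
    then show ?thesis unfolding H_def by (simp add: limI)
  qed
  have diff: "V k t - V k s = (\<Sum>j\<in>grid_block (2 ^ k) (s, t). D k j)" if "s \<le> t" for s t k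
  proof -
    have "sum (D k) {0..<nat \<lfloor>real (2 ^ k) * s\<rfloor>} + sum (D k) {nat \<lfloor>real (2 ^ k) * s\<rfloor>..<nat \<lfloor>real (2 ^ k) * t\<rfloor>}
      = sum (D k) {0..<nat \<lfloor>real (2 ^ k) * t\<rfloor>}"
      by (rule sum.atLeastLessThan_concat[OF _ fl[OF that]]) simp
    then show ?thesis unfolding V_def grid_block_def atLeast0LessThan fst_conv snd_conv by linarith
  qed
  have two: "filterlim (\<lambda>k. 2 ^ k :: nat) at_top sequentially"
    by (rule filterlim_at_top_mono[OF filterlim_ident]) (auto intro: less_imp_le less_exp)
  show ?thesis
  proof (rule that)
    show le: "\<bar>f t - f s\<bar> \<le> H t - H s" if st: "0 \<le> s" "s \<le> t" "t \<le> 1" for s t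
    proof (rule LIMSEQ_le)
      let ?f = "\<lambda>t k. f (real (nat \<lfloor>real (2 ^ k) * t\<rfloor>) / real (2 ^ k))"
      have "(\<lambda>k. ?f t k) \<longlonglongrightarrow> f t" if "t \<in> {0..1}" for t
      proof (rule continuous_on_tendsto_compose[OF AC_continuous_on[OF f]])
        show "(\<lambda>k. real (nat \<lfloor>real (2 ^ k) * t\<rfloor>) / real (2 ^ k)) \<longlonglongrightarrow> t"
          by (rule filterlim_compose[OF grid_floor_tendsto two]) (use that in auto)
        show "\<forall>\<^sub>F k in sequentially. real (nat \<lfloor>real (2 ^ k) * t\<rfloor>) / real (2 ^ k) \<in> {0..1}"
          by (intro always_eventually allI grid_floor_in_unit that)
      qed (rule that)
      then show "(\<lambda>k. \<bar>?f t k - ?f s k\<bar>) \<longlonglongrightarrow> \<bar>f t - f s\<bar>"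
        using st by (intro tendsto_intros) auto
      show "(\<lambda>k. V k t - V k s) \<longlonglongrightarrow> H t - H s" using st by (intro tendsto_diff lim) auto
      have "\<bar>?f t k - ?f s k\<bar> \<le> V k t - V k s" for k
        using sum_grid_block_telescope[of "(s, t)" f "2 ^ k", symmetric] st
        unfolding diff[OF st(2)] D_def by (simp only: fst_conv snd_conv) (rule sum_abs)
      then show "\<exists>N. \<forall>k\<ge>N. \<bar>?f t k - ?f s k\<bar> \<le> V k t - V k s" by blast
    qed
    \<comment> \<open>The increments of \<open>V k\<close> over a family of short intervals are sums
      of \<open>D k\<close> over a small proportion of cells. The strict bound \<open>e / 2\<close>
      survives the limit only as \<open>\<le> e / 2\<close>, hence the halving.\<close>
    show "absolutely_continuous_fun_on {0..1} H"
      unfolding AC_iff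
    proof (intro allI impI)
      fix e :: real assume e: "e > 0"
      obtain d where d: "d > 0"
        "\<And>n J. n > 0 \<Longrightarrow> J \<subseteq> {..<n} \<Longrightarrow> real (card J) < d * real n \<Longrightarrow>
          (\<Sum>j\<in>J. \<bar>f (real (Suc j) / real n) - f (real j / real n)\<bar>) < e / 2"
        using AC_grid[OF f, of "e / 2"] e by auto
      show "\<exists>\<delta>>0. \<forall>I. nonoverlapping I \<longrightarrow> (\<Sum>p\<in>I. snd p - fst p) < \<delta> \<longrightarrow>
          (\<Sum>p\<in>I. \<bar>H (snd p) - H (fst p)\<bar>) < e"
      proof (intro exI[of _ d] conjI allI impI d(1))
        fix I assume I: "nonoverlapping I" "(\<Sum>p\<in>I. snd p - fst p) < d"
        note ID = nonoverlappingD[OF I(1)]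
        have "(\<Sum>p\<in>I. H (snd p) - H (fst p)) \<le> e / 2"
        proof (rule LIMSEQ_le_const2)
          show "(\<lambda>k. \<Sum>p\<in>I. V k (snd p) - V k (fst p)) \<longlonglongrightarrow> (\<Sum>p\<in>I. H (snd p) - H (fst p))"
          proof (intro tendsto_sum tendsto_diff lim)
            fix p assume "p \<in> I" from ID[OF this] show "snd p \<in> {0..1}" "fst p \<in> {0..1}" by auto
          qed
          have "eventually (\<lambda>k. real (card (\<Union>p\<in>I. grid_block (2 ^ k) p)) < d * real (2 ^ k)) sequentially"
            using eventually_card_grid_blocks[OF I] two unfolding filterlim_iff by fast
          then have "eventually (\<lambda>k. (\<Sum>p\<in>I. V k (snd p) - V k (fst p)) \<le> e / 2) sequentially"
          proof eventually_elim
            case (elim k)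
            have "(\<Sum>p\<in>I. V k (snd p) - V k (fst p)) = (\<Sum>p\<in>I. \<Sum>j\<in>grid_block (2 ^ k) p. D k j)"
              using diff ID(2) by (intro sum.cong) auto
            also have "\<dots> = (\<Sum>j\<in>(\<Union>p\<in>I. grid_block (2 ^ k) p). D k j)" by (rule sum_grid_blocks[OF I(1)])
            also have "\<dots> < e / 2" unfolding D_def
              using elim by (intro d(2) grid_blocks_subset[OF I(1)]) auto
            finally show ?case by simp
          qed
          then show "\<exists>N. \<forall>k\<ge>N. (\<Sum>p\<in>I. V k (snd p) - V k (fst p)) \<le> e / 2"
            by (simp add: eventually_sequentially)
        qed
        moreover have "\<bar>H (snd p) - H (fst p)\<bar> = H (snd p) - H (fst p)" if "p \<in> I" for p
          using le[OF ID[OF that]] by simp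
        ultimately show "(\<Sum>p\<in>I. \<bar>H (snd p) - H (fst p)\<bar>) < e" using e by (simp cong: sum.cong)
      qed
    qed
  qed
qed

text \<open>The Stieltjes measure of \<open>F\<close> vanishes on Lebesgue null sets, so the
  Radon-Nikodym theorem supplies the density.\<close>

lemma monotone_AC_density:
  assumes F: "absolutely_continuous_fun_on {0..1} F"
    and mono: "\<And>s t. 0 \<le> s \<Longrightarrow> s \<le> t \<Longrightarrow> t \<le> 1 \<Longrightarrow> F s \<le> F t"
  obtains g :: "real \<Rightarrow> real" where "integrable lborel g"
    "\<And>a b. 0 \<le> a \<Longrightarrow> a \<le> b \<Longrightarrow> b \<le> 1 \<Longrightarrow> F b - F a = (LINT y:{a<..b}|lborel. g y)"
proof -
  \<comment> \<open>Clamping the argument extends \<open>F\<close> by constants to a monotone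
    continuous function on the line, whose Stieltjes measure has no mass outside the unit
    interval.\<close>
  define G where "G x = F (max 0 (min 1 x))" for x :: real
  have G_mono: "G x \<le> G y" if "x \<le> y" for x y unfolding G_def using that by (intro mono) auto
  have G_cont: "continuous_on UNIV G"
    unfolding G_def by (rule continuous_on_compose2[OF AC_continuous_on[OF F]]) (auto intro!: continuous_intros)
  then have G_right: "continuous (at_right a) G" for a
    by (simp add: continuous_on_eq_continuous_within continuous_at_imp_continuous_within)
  have G_eq: "G x = F x" if "0 \<le> x" "x \<le> 1" for x using that by (simp add: G_def max_def min_def)
  define \<mu> where "\<mu> = interval_measure G"
  define N where "N = density \<mu> (indicator {0<..1})"
  have s\<mu>: "sets \<mu> = sets borel" by (simp add: \<mu>_def)
  have sN: "sets N = sets borel" by (simp add: N_def s\<mu>)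
  have Icc: "emeasure \<mu> {a..b} = ennreal (G b - G a)" if "a \<le> b" for a b
    unfolding \<mu>_def by (rule emeasure_interval_measure_Icc[OF that G_mono G_cont])
  have Ioc: "emeasure \<mu> {a<..b} = ennreal (G b - G a)" if "a \<le> b" for a b
    unfolding \<mu>_def by (rule emeasure_interval_measure_Ioc[OF that G_mono G_right])
  have N_eq: "emeasure N B = emeasure \<mu> (B \<inter> {0<..1})" if "B \<in> sets borel" for B
  proof -
    have [measurable_cong]: "sets \<mu> = sets borel" by (rule s\<mu>)
    have [measurable]: "B \<in> sets borel" by (rule that)
    have "emeasure N B = (\<integral>\<^sup>+x. indicator {0<..1} x * indicator B x \<partial>\<mu>)"
      unfolding N_def by (rule emeasure_density) measurable
    also have "\<dots> = (\<integral>\<^sup>+x. indicator (B \<inter> {0<..1}) x \<partial>\<mu>)"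
      by (intro nn_integral_cong) (auto split: split_indicator)
    finally have "emeasure N B = (\<integral>\<^sup>+x. indicator (B \<inter> {0<..1}) x \<partial>\<mu>)" .
    then show ?thesis using that by (simp add: s\<mu>)
  qed
  \<comment> \<open>The null set is covered by nonoverlapping closed intervals inside an open set of
    small Lebesgue measure. Absolute continuity bounds the \<open>\<mu>\<close> mass of every finite
    subfamily by \<open>e\<close>, and continuity from below extends the bound to the whole
    family.\<close>
  have null: "emeasure \<mu> S = 0" if S: "S \<in> sets borel" "S \<subseteq> {0<..1}" "emeasure lborel S = 0" for S
  proof -
    have eps: "emeasure \<mu> S \<le> 0 + ennreal e" if e: "e > 0" for e
    proof -
      obtain d where d: "d > 0" "\<And>I. nonoverlapping I \<Longrightarrow> (\<Sum>p\<in>I. snd p - fst p) < d \<Longrightarrow>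
         (\<Sum>p\<in>I. \<bar>F (snd p) - F (fst p)\<bar>) < e"
        using iffD1[OF AC_iff F, rule_format, OF e] by blast
      obtain U where U: "open U" "S \<subseteq> U" "emeasure lborel (U - S) < d"
        using outer_regular_lborel[OF S(1) d(1)] by blast
      have "emeasure lborel U = emeasure lborel ((U - S) \<union> S)" using U(2) by (simp add: Un_absorb2)
      also have "\<dots> \<le> emeasure lborel (U - S) + emeasure lborel S"
        using U(1) S(1) by (intro emeasure_subadditive) auto
      finally have Ud: "emeasure lborel U < d" using U(3) S(3) by simp
      \<comment> \<open>With this gauge the covering lemma produces intervals that meet
        \<open>S\<close> and lie inside \<open>U\<close>.\<close>
      have gauge: "gauge (\<lambda>x. if x \<in> S then U else UNIV)" using U by (auto simp: gauge_def)
      have sub: "S \<subseteq> cbox 0 1" and ne: "box 0 1 \<noteq> ({} :: real set)" using S(2) by auto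
      obtain D where D0:
        "countable D" "\<Union>D \<subseteq> cbox 0 (1::real)"
        "\<And>K. K \<in> D \<Longrightarrow> interior K \<noteq> {} \<and> (\<exists>c d. K = cbox c d)"
        "pairwise (\<lambda>A B. interior A \<inter> interior B = {}) D"
        "\<And>K. K \<in> D \<Longrightarrow> \<exists>x\<in>S \<inter> K. K \<subseteq> (if x \<in> S then U else UNIV)"
        "\<And>u v. cbox u v \<in> D \<Longrightarrow> \<exists>n. \<forall>i\<in>Basis. v \<bullet> i - u \<bullet> i = (1 \<bullet> i - 0 \<bullet> i) / 2 ^ n"
        "S \<subseteq> \<Union>D"
        by (rule covering_lemma[OF sub ne gauge]) (rule that)
      note D = D0(1-5) D0(7)
      have K: "\<exists>c d. K = {c..d} \<and> c < d \<and> 0 \<le> c \<and> d \<le> 1 \<and> K \<subseteq> U" if KD: "K \<in> D" for K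
      proof -
        obtain c d where cd: "K = {c..d}" using D(3)[OF KD] by auto
        moreover have "c < d" using D(3)[OF KD] cd by auto
        moreover have "K \<subseteq> U" using D(5)[OF KD] by (auto split: if_splits)
        moreover have "K \<subseteq> {0..1}" using D(2) KD by auto
        ultimately show ?thesis by auto
      qed
      have fin: "emeasure \<mu> (\<Union>D') \<le> ennreal e" if D': "D' \<subseteq> D" "finite D'" for D'
      proof -
        have KD: "\<exists>c d. K = {c..d} \<and> c < d \<and> 0 \<le> c \<and> d \<le> 1 \<and> K \<subseteq> U" if "K \<in> D'" for K
          using that D' by (intro K) auto
        let ?I = "(\<lambda>K. (Inf K, Sup K)) ` D'"
        have IS: "K = {Inf K..Sup K}" "Inf K < Sup K" "0 \<le> Inf K" "Sup K \<le> 1" "K \<subseteq> U" if "K \<in> D'" for K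
          using KD[OF that] by auto
        have inj: "inj_on (\<lambda>K. (Inf K, Sup K)) D'"
          by (rule inj_onI) (metis IS(1) Pair_inject)
        have disj: "disjoint_family_on interior D'"
          using D(4) D' by (auto simp: disjoint_family_on_def pairwise_def)
        have int: "interior K = {Inf K<..<Sup K}" if "K \<in> D'" for K
          using IS(1)[OF that] interior_atLeastAtMost_real by metis
        have "nonoverlapping ?I"
          unfolding nonoverlapping_def
        proof (intro conjI)
          show "\<forall>(a, b)\<in>?I. a \<le> b \<and> {a..b} \<subseteq> {0..1}" using IS(2-4) by fastforce
          show "pairwise (\<lambda>p q. disjnt {fst p<..<snd p} {fst q<..<snd q}) ?I"
            using disj int by (fastforce simp: pairwise_def disjnt_def disjoint_family_on_def)
        qed (use D' in auto)
        moreover have "(\<Sum>p\<in>?I. snd p - fst p) < d"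
        proof -
          have "ennreal (\<Sum>p\<in>?I. snd p - fst p) = (\<Sum>K\<in>D'. ennreal (Sup K - Inf K))"
            using IS(2) by (subst sum.reindex[OF inj]) (auto simp: less_imp_le)
          \<comment> \<open>The closed intervals may share endpoints, but their interiors are
            disjoint, so the lengths add up inside \<open>U\<close>.\<close>
          also have "\<dots> = (\<Sum>K\<in>D'. emeasure lborel (interior K))"
            using IS(2) int by (intro sum.cong) (auto simp: less_imp_le)
          also have "\<dots> = emeasure lborel (\<Union>K\<in>D'. interior K)"
            using disj D' by (intro sum_emeasure) auto
          also have "\<dots> \<le> emeasure lborel U"
          proof (rule emeasure_mono)
            show "(\<Union>K\<in>D'. interior K) \<subseteq> U" using IS(5) interior_subset by blast
          qed (use U(1) in simp)
          finally have "ennreal (\<Sum>p\<in>?I. snd p - fst p) < ennreal d" using Ud by simp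
          moreover have "0 \<le> (\<Sum>p\<in>?I. snd p - fst p)"
            using IS(2) by (intro sum_nonneg) (auto simp: less_imp_le)
          ultimately show ?thesis using ennreal_less_iff by blast
        qed
        ultimately have "(\<Sum>p\<in>?I. \<bar>F (snd p) - F (fst p)\<bar>) < e" by (rule d(2))
        then have le: "(\<Sum>K\<in>D'. F (Sup K) - F (Inf K)) \<le> e"
          using IS(2-4) by (subst (asm) sum.reindex[OF inj]) (auto simp: mono less_imp_le cong: sum.cong)
        have "emeasure \<mu> (\<Union>K\<in>D'. K) \<le> (\<Sum>K\<in>D'. emeasure \<mu> K)"
          using D' IS(1) by (intro emeasure_subadditive_finite) (auto simp: s\<mu>, metis atLeastAtMost_borel)
        also have "\<dots> = (\<Sum>K\<in>D'. ennreal (F (Sup K) - F (Inf K)))"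
        proof (intro sum.cong refl)
          fix K assume k: "K \<in> D'"
          note * = IS[OF k]
          have "emeasure \<mu> K = emeasure \<mu> {Inf K..Sup K}" using *(1) by simp
          also have "\<dots> = ennreal (F (Sup K) - F (Inf K))" using * by (subst Icc) (auto simp: G_eq)
          finally show "emeasure \<mu> K = ennreal (F (Sup K) - F (Inf K))" .
        qed
        also have "\<dots> = ennreal (\<Sum>K\<in>D'. F (Sup K) - F (Inf K))"
          using IS(2-4) by (intro sum_ennreal) (auto simp: mono less_imp_le)
        also have "\<dots> \<le> ennreal e" using le by (rule ennreal_leI)
        finally show ?thesis by simp
      qed
      show ?thesis
      proof (cases "D = {}")
        case True
        then show ?thesis using D(6) by simp
      next
        case False
        let ?A = "\<lambda>n. \<Union>(from_nat_into D ` {..n})"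
        have sub: "from_nat_into D ` {..n} \<subseteq> D" for n using from_nat_into[OF False] by auto
        have meas: "?A n \<in> sets \<mu>" for n
        proof -
          have "K \<in> sets borel" if "K \<in> D" for K using K[OF that] by auto
          then show ?thesis using sub[of n] by (auto simp: s\<mu> intro!: sets.finite_UN)
        qed
        have "\<Union>D = \<Union>(range (from_nat_into D))" by (simp only: range_from_nat_into[OF False D(1)])
        also have "\<dots> = (\<Union>n. ?A n)" by blast
        finally have UD: "\<Union>D = (\<Union>n. ?A n)" .
        have "emeasure \<mu> S \<le> emeasure \<mu> (\<Union>n. ?A n)"
          using D(6) meas unfolding UD by (intro emeasure_mono sets.countable_UN) auto
        also have "\<dots> = (SUP n. emeasure \<mu> (?A n))"
          using meas by (intro SUP_emeasure_incseq[symmetric]) (auto simp: incseq_def intro: order_trans)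
        also have "\<dots> \<le> ennreal e" using sub by (intro SUP_least fin) auto
        finally show ?thesis by simp
      qed
    qed
    have "emeasure \<mu> S \<le> 0" by (rule ennreal_le_epsilon) (rule eps)
    then show ?thesis by simp
  qed
  have ac: "absolutely_continuous lborel N"
    unfolding absolutely_continuous_def
  proof
    fix B :: "real set" assume B: "B \<in> null_sets lborel"
    have "emeasure lborel (B \<inter> {0<..1}) \<le> emeasure lborel B"
      using B by (intro emeasure_mono) auto
    then have "emeasure lborel (B \<inter> {0<..1}) = 0" using null_setsD1[OF B] by simp
    then have "emeasure \<mu> (B \<inter> {0<..1}) = 0" using B by (intro null) auto
    then show "B \<in> null_sets N" using B N_eq[of B] by (auto simp: null_sets_def sN)
  qed
  define R where "R = RN_deriv lborel N"
  have [measurable]: "R \<in> borel_measurable borel" unfolding R_def using borel_measurable_RN_deriv[of lborel N] by simp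
  have dens: "density lborel R = N"
    unfolding R_def by (rule sigma_finite_measure.density_RN_deriv[OF sigma_finite_lborel ac]) (simp add: sN)
  have NR: "emeasure N B = (\<integral>\<^sup>+x. R x * indicator B x \<partial>lborel)" if "B \<in> sets borel" for B
    using that by (subst dens[symmetric]) (simp add: emeasure_density)
  have "(\<integral>\<^sup>+x. R x \<partial>lborel) = emeasure \<mu> {0<..1}"
    using NR[of UNIV] N_eq[of UNIV] by simp
  then have finR: "(\<integral>\<^sup>+x. R x \<partial>lborel) \<noteq> \<infinity>" by (simp add: Ioc)
  then have AER: "AE x in lborel. R x \<noteq> \<infinity>" by (intro nn_integral_PInf_AE) auto
  define g where "g x = enn2real (R x)" for x
  have [measurable]: "g \<in> borel_measurable borel" unfolding g_def by measurable
  have AEg: "AE x in lborel. ennreal (g x) = R x"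
    using AER by eventually_elim (simp add: g_def less_top)
  have intg: "integrable lborel g"
  proof (rule integrableI_nonneg)
    have "(\<integral>\<^sup>+x. ennreal (g x) \<partial>lborel) = (\<integral>\<^sup>+x. R x \<partial>lborel)" by (rule nn_integral_cong_AE[OF AEg])
    then show "(\<integral>\<^sup>+x. ennreal (g x) \<partial>lborel) < \<infinity>" using finR by (simp add: less_top)
  qed (auto simp: g_def)
  show ?thesis
  proof (rule that[OF intg])
    fix a b :: real assume ab: "0 \<le> a" "a \<le> b" "b \<le> 1"
    have "ennreal (F b - F a) = emeasure \<mu> ({a<..b} \<inter> {0<..1})"
    proof -
      have "{a<..b} \<inter> {0<..1} = {a<..b}" using ab by auto
      then show ?thesis using ab by (simp add: Ioc G_eq)
    qed
    also have "\<dots> = (\<integral>\<^sup>+x. R x * indicator {a<..b} x \<partial>lborel)" by (subst N_eq[symmetric]) (auto simp: NR)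
    also have "\<dots> = (\<integral>\<^sup>+x. ennreal (indicator {a<..b} x *\<^sub>R g x) \<partial>lborel)"
      by (rule nn_integral_cong_AE) (use AEg in eventually_elim, auto split: split_indicator)
    finally have nn: "(\<integral>\<^sup>+x. ennreal (indicator {a<..b} x *\<^sub>R g x) \<partial>lborel) = ennreal (F b - F a)" by simp
    show "F b - F a = (LINT y:{a<..b}|lborel. g y)"
      unfolding set_lebesgue_integral_def using mono[OF ab]
      by (subst integral_eq_nn_integral, measurable) (simp_all only: nn, simp_all add: g_def)
  qed
qed

text \<open>Jordan decomposition: \<open>f\<close> is the difference of \<open>H\<close> and
  \<open>H - f\<close>. Both are monotone because \<open>H\<close> dominates the increments of
  \<open>f\<close>, and both are absolutely continuous.\<close>

theorem AC_density:
  assumes f: "absolutely_continuous_fun_on {0..1} f"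
  obtains g :: "real \<Rightarrow> real" where "integrable lborel g"
    "\<And>a b. 0 \<le> a \<Longrightarrow> a \<le> b \<Longrightarrow> b \<le> 1 \<Longrightarrow> f b - f a = (LINT y:{a<..b}|lborel. g y)"
proof -
  obtain H where H: "absolutely_continuous_fun_on {0..1} H"
    "\<And>s t. 0 \<le> s \<Longrightarrow> s \<le> t \<Longrightarrow> t \<le> 1 \<Longrightarrow> \<bar>f t - f s\<bar> \<le> H t - H s"
    using AC_total_variation[OF f] by blast
  have "absolutely_continuous_fun_on {0..1} (\<lambda>t. H t - f t)"
    unfolding AC_iff
  proof (intro allI impI)
    fix e :: real assume "e > 0"
    then have e: "e / 2 > 0" by simp
    obtain d1 where d1: "d1 > 0" "\<And>I. nonoverlapping I \<Longrightarrow> (\<Sum>p\<in>I. snd p - fst p) < d1 \<Longrightarrow>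
       (\<Sum>p\<in>I. \<bar>f (snd p) - f (fst p)\<bar>) < e / 2" using f e unfolding AC_iff by blast
    obtain d2 where d2: "d2 > 0" "\<And>I. nonoverlapping I \<Longrightarrow> (\<Sum>p\<in>I. snd p - fst p) < d2 \<Longrightarrow>
       (\<Sum>p\<in>I. \<bar>H (snd p) - H (fst p)\<bar>) < e / 2" using H(1) e unfolding AC_iff by blast
    show "\<exists>\<delta>>0. \<forall>I. nonoverlapping I \<longrightarrow> (\<Sum>p\<in>I. snd p - fst p) < \<delta> \<longrightarrow>
        (\<Sum>p\<in>I. \<bar>(H (snd p) - f (snd p)) - (H (fst p) - f (fst p))\<bar>) < e"
    proof (intro exI[of _ "min d1 d2"] conjI allI impI)
      fix I assume I: "nonoverlapping I" "(\<Sum>p\<in>I. snd p - fst p) < min d1 d2"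
      have "(\<Sum>p\<in>I. \<bar>(H (snd p) - f (snd p)) - (H (fst p) - f (fst p))\<bar>)
        \<le> (\<Sum>p\<in>I. \<bar>H (snd p) - H (fst p)\<bar> + \<bar>f (snd p) - f (fst p)\<bar>)" by (intro sum_mono) linarith
      also have "\<dots> < e" using d1(2)[OF I(1)] d2(2)[OF I(1)] I(2) by (simp add: sum.distrib)
      finally show "(\<Sum>p\<in>I. \<bar>(H (snd p) - f (snd p)) - (H (fst p) - f (fst p))\<bar>) < e" .
    qed (use d1 d2 in auto)
  qed
  then obtain g1 where g1: "integrable lborel g1"
    "\<And>a b. 0 \<le> a \<Longrightarrow> a \<le> b \<Longrightarrow> b \<le> 1 \<Longrightarrow> (H b - f b) - (H a - f a) = (LINT y:{a<..b}|lborel. g1 y)"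
    by (rule monotone_AC_density) (use H(2) in \<open>fastforce simp: abs_le_iff\<close>)+
  obtain g2 where g2: "integrable lborel g2"
    "\<And>a b. 0 \<le> a \<Longrightarrow> a \<le> b \<Longrightarrow> b \<le> 1 \<Longrightarrow> H b - H a = (LINT y:{a<..b}|lborel. g2 y)"
    by (rule monotone_AC_density[OF H(1)]) (use H(2) in \<open>fastforce simp: abs_le_iff\<close>)+
  have si: "set_integrable lborel {a<..b} g1" "set_integrable lborel {a<..b} g2" for a b
    unfolding set_integrable_def by (intro integrable_mult_indicator g1 g2; simp)+
  show ?thesis
  proof (rule that[of "\<lambda>x. g2 x - g1 x"])
    show "integrable lborel (\<lambda>x. g2 x - g1 x)" using g1 g2 by simp
    fix a b :: real assume ab: "0 \<le> a" "a \<le> b" "b \<le> 1"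
    show "f b - f a = (LINT y:{a<..b}|lborel. g2 y - g1 y)"
      using g1(2)[OF ab] g2(2)[OF ab] by (simp add: set_integral_diff(2)[OF si(2) si(1)])
  qed
qed

text \<open>A difference quotient at \<open>x\<close> is the average of \<open>g\<close> over an
  interval with endpoint \<open>x\<close>, so \<open>f\<close> is differentiable at the Lebesgue
  points of \<open>g\<close>. This identifies the \<open>deriv\<close> in the rate function with the
  density up to null sets.\<close>

lemma AE_has_derivative_density:
  assumes g: "integrable lborel g"
    and f: "\<And>a b. 0 \<le> a \<Longrightarrow> a \<le> b \<Longrightarrow> b \<le> 1 \<Longrightarrow> f b - f a = (LINT y:{a<..b}|lborel. g y)"
  shows "AE t in lborel. t \<in> {0<..<1} \<longrightarrow> (f has_real_derivative g t) (at t)"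
  using Lebesgue_differentiation[OF g]
proof eventually_elim
  case (elim x)
  show ?case
  proof
    assume x: "x \<in> {0<..<1}"
    show "(f has_real_derivative g x) (at x)"
      unfolding has_field_derivative_iff
    proof (rule tendstoI)
      fix e :: real assume e: "e > 0"
      obtain d where d: "d > 0" "\<And>u v. u \<le> x \<Longrightarrow> x \<le> v \<Longrightarrow> u < v \<Longrightarrow> v - u < d \<Longrightarrow>
        \<bar>(LINT y:{u<..v}|lborel. g y) - g x * (v - u)\<bar> \<le> (e/2) * (v - u)"
        using elim[rule_format, OF half_gt_zero[OF e]] by blast
      \<comment> \<open>The second bound keeps \<open>y\<close> in the unit interval, where the
        increments of \<open>f\<close> are integrals of \<open>g\<close>.\<close>
      define d' where "d' = min d (min x (1 - x))"
      show "\<forall>\<^sub>F y in at x. dist ((f y - f x) / (y - x)) (g x) < e"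
        unfolding eventually_at
      proof (intro exI[of _ d'] conjI ballI impI)
        show "0 < d'" using d x by (auto simp: d'_def)
        fix y assume y: "y \<noteq> x \<and> dist y x < d'"
        have "\<bar>(f y - f x) - g x * (y - x)\<bar> \<le> (e/2) * \<bar>y - x\<bar>"
        proof (cases "y < x")
          case True
          have yx: "0 \<le> y" "x - y < d" using y True x by (auto simp: d'_def dist_real_def)
          have "f x - f y = (LINT z:{y<..x}|lborel. g z)" using yx True x by (intro f) auto
          with d(2)[of y x] True yx show ?thesis by (simp add: algebra_simps abs_if split: if_splits)
        next
          case False
          then have yx: "x < y" "y \<le> 1" "y - x < d" using y x by (auto simp: d'_def dist_real_def)
          have "f y - f x = (LINT z:{x<..y}|lborel. g z)" using yx x by (intro f) auto
          with d(2)[of x y] yx show ?thesis by simp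
        qed
        then have "\<bar>(f y - f x) - g x * (y - x)\<bar> / \<bar>y - x\<bar> \<le> e/2" using y by (simp add: divide_le_eq)
        moreover have "(f y - f x) / (y - x) - g x = ((f y - f x) - g x * (y - x)) / (y - x)"
          using y by (simp add: field_simps)
        ultimately have "\<bar>(f y - f x) / (y - x) - g x\<bar> \<le> e/2" by (simp add: abs_divide)
        then show "dist ((f y - f x) / (y - x)) (g x) < e" using e by (simp add: dist_real_def)
      qed
    qed
  qed
qed

section \<open>Discretized rate functions\<close>

text \<open>The first assumption allows a coordinate to be switched off by
  \<open>\<theta> = 0\<close>. The second forces paths of finite rate to be nondecreasing, since a
  very negative \<open>\<theta>\<close> penalizes a decrease without a positive cost in
  \<open>Lam\<close>.\<close>

locale rate_exponent =
  fixes Lam :: "real \<Rightarrow> real"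
  assumes Lam_0: "Lam 0 = 0" and Lam_nonpos: "\<And>\<theta>. \<theta> \<le> 0 \<Longrightarrow> Lam \<theta> \<le> 0"
begin

definition Phi :: "nat \<Rightarrow> (nat \<Rightarrow> real) \<Rightarrow> (real \<Rightarrow> real) \<Rightarrow> real" where
  "Phi n \<theta> f = (\<Sum>j<n. \<theta> j * (f (real (Suc j) / real n) - f (real j / real n)) - Lam (\<theta> j) / real n)"

text \<open>For \<open>0 \<le> a\<close> this is the sublevel set of the rate function, as
  \<open>rate_sublevel\<close> shows. Each constraint is continuous in finitely many values of
  \<open>f\<close>, and properties of the paths follow by inserting suitable
  \<open>\<theta>\<close>.\<close>

definition level :: "real \<Rightarrow> (real \<Rightarrow> real) set" where
  "level a = {f \<in> cadlag_space. f 0 = 0 \<and> (\<forall>n>0. \<forall>\<theta>. Phi n \<theta> f \<le> a)}"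

text \<open>Dual vectors that are constant on a set of cells and 0 elsewhere probe the total
  increment over that set. The regularity of the paths in a level set is drawn from them.\<close>

lemma Phi_set:
  assumes "J \<subseteq> {..<n}"
  shows "Phi n (\<lambda>j. if j \<in> J then \<theta> else 0) f =
    \<theta> * (\<Sum>j\<in>J. f (real (Suc j) / real n) - f (real j / real n)) - real (card J) / real n * Lam \<theta>"
proof -
  define D where "D j = f (real (Suc j) / real n) - f (real j / real n)" for j
  have "Phi n (\<lambda>j. if j \<in> J then \<theta> else 0) f = (\<Sum>j<n. if j \<in> J then \<theta> * D j - Lam \<theta> / real n else 0)"
    unfolding Phi_def D_def[symmetric] by (intro sum.cong) (auto simp: Lam_0)
  also have "\<dots> = (\<Sum>j\<in>{..<n} \<inter> J. \<theta> * D j - Lam \<theta> / real n)"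
    by (rule sum.inter_restrict[symmetric]) simp
  also have "{..<n} \<inter> J = J" using assms by auto
  also have "(\<Sum>j\<in>J. \<theta> * D j - Lam \<theta> / real n) = \<theta> * (\<Sum>j\<in>J. D j) - real (card J) / real n * Lam \<theta>"
    by (simp add: sum_subtractf sum_distrib_left)
  finally show ?thesis by (simp only: D_def)
qed

section \<open>Monotonicity, equicontinuity and absolute continuity of the paths in a level
  set\<close>

context
  fixes f a assumes f: "f \<in> level a"
begin

lemma level_cadlag: "f \<in> cadlag_space" and level_0: "f 0 = 0"
  and level_Phi: "n > 0 \<Longrightarrow> Phi n \<theta> f \<le> a"
  using f by (auto simp: level_def)

lemma level_nonneg: "0 \<le> a"
  using level_Phi[of 1 "\<lambda>_. 0"] by (simp add: Phi_def Lam_0)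

lemma level_set_increment:
  assumes "J \<subseteq> {..<n}" "n > 0"
  shows "\<theta> * (\<Sum>j\<in>J. f (real (Suc j) / real n) - f (real j / real n)) \<le> a + real (card J) / real n * Lam \<theta>"
proof -
  have "Phi n (\<lambda>j. if j \<in> J then \<theta> else 0) f \<le> a" by (rule level_Phi[OF assms(2)])
  then show ?thesis unfolding Phi_set[OF assms(1)] by linarith
qed

lemma level_increment:
  assumes "j < n"
  shows "\<theta> * (f (real (Suc j) / real n) - f (real j / real n)) \<le> a + Lam \<theta> / real n"
  using level_set_increment[of "{j}" n \<theta>] assms by simp

lemma level_grid_step:
  assumes "j < n"
  shows "f (real j / real n) \<le> f (real (Suc j) / real n)"
proof (rule ccontr)
  let ?d = "f (real (Suc j) / real n) - f (real j / real n)"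
  assume "\<not> ?thesis"
  then have d: "?d < 0" by simp
  \<comment> \<open>Negative, so that \<open>Lam ?t\<close> is at most 0, and scaled so that
    \<open>?t * ?d = a + 1\<close> exceeds the allowed \<open>a\<close>.\<close>
  let ?t = "(a + 1) / ?d"
  have "?t \<le> 0" using d level_nonneg by (simp add: divide_le_0_iff)
  then have "Lam ?t / real n \<le> 0" using Lam_nonpos by (simp add: divide_le_0_iff)
  then have "?t * ?d \<le> a" using level_increment[OF assms, of ?t] by linarith
  then show False using d by simp
qed

lemma level_grid_mono:
  assumes "i \<le> j" "j \<le> n"
  shows "f (real i / real n) \<le> f (real j / real n)"
  using assms
proof (induction j rule: dec_induct)
  case (step j)
  then show ?case using level_grid_step[of j n] by auto
qed simp

text \<open>Right-continuity carries the comparison from grid points to all times. At time 1 there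
  is no limit from the right, but 1 is itself a point of every grid.\<close>

lemma level_mono:
  assumes "0 \<le> s" "s \<le> t" "t \<le> 1"
  shows "f s \<le> f t"
proof (cases "s = t")
  case False
  \<comment> \<open>The first grid point strictly to the right of \<open>x\<close>.\<close>
  define c where "c x n = real (Suc (nat \<lfloor>real n * x\<rfloor>)) / real n" for x n
  have lim: "(\<lambda>n. f (c x n)) \<longlonglongrightarrow> f x" if x: "0 \<le> x" "x < 1" for x
  proof -
    have "(f \<longlongrightarrow> f x) (at_right x)" using level_cadlag x by (simp add: cadlag_space_def)
    moreover have "filterlim (\<lambda>n. c x n) (at_right x) sequentially"
    proof (subst filterlim_at, intro conjI)
      have "(\<lambda>n. real (nat \<lfloor>real n * x\<rfloor>) / real n + 1 / real n) \<longlonglongrightarrow> x + 0"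
        by (intro tendsto_add grid_floor_tendsto x lim_1_over_n)
      then show "(\<lambda>n. c x n) \<longlonglongrightarrow> x" by (simp add: c_def add_divide_distrib add.commute)
      show "\<forall>\<^sub>F n in sequentially. c x n \<in> {x<..} \<and> c x n \<noteq> x"
        using eventually_gt_at_top[of 0]
      proof eventually_elim
        case (elim n)
        have "real n * x < real (Suc (nat \<lfloor>real n * x\<rfloor>))" using x by simp linarith
        then have "x < c x n" using elim by (simp add: c_def field_simps)
        then show ?case by simp
      qed
    qed
    ultimately show ?thesis by (rule filterlim_compose)
  qed
  have le1: "Suc (nat \<lfloor>real n * x\<rfloor>) \<le> n" if "0 \<le> x" "x < 1" "n > 0" for x n
  proof -
    have "real n * x < real n * 1" using that by (intro mult_strict_left_mono) auto
    then show ?thesis using that by (simp add: Suc_le_eq nat_less_iff floor_less_iff)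
  qed
  have s1: "s < 1" using False assms by simp
  show ?thesis
  proof (cases "t = 1")
    case True
    have "f (c s n) \<le> f t" if n: "n > 0" for n
    proof -
      have "f (c s n) \<le> f (real n / real n)"
        unfolding c_def by (rule level_grid_mono) (use le1[of s n] assms s1 n in auto)
      then show ?thesis using True n by simp
    qed
    then have "\<exists>N. \<forall>n\<ge>N. f (c s n) \<le> f t" by (intro exI[of _ 1]) auto
    with lim[OF assms(1) s1] show ?thesis by (rule LIMSEQ_le_const2)
  next
    case f: False
    then have t: "0 \<le> t" "t < 1" using assms by auto
    have "f (c s n) \<le> f (c t n)" if n: "n > 0" for n
      unfolding c_def
    proof (rule level_grid_mono)
      have "real n * s \<le> real n * t" using assms by (intro mult_left_mono) auto
      then show "Suc (nat \<lfloor>real n * s\<rfloor>) \<le> Suc (nat \<lfloor>real n * t\<rfloor>)" by (auto intro!: nat_mono floor_mono)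
      show "Suc (nat \<lfloor>real n * t\<rfloor>) \<le> n" using le1 t n by blast
    qed
    then have "\<exists>N. \<forall>n\<ge>N. f (c s n) \<le> f (c t n)" by (intro exI[of _ 1]) auto
    with lim[OF assms(1) s1] lim[OF t] show ?thesis by (rule LIMSEQ_le)
  qed
qed simp

end

text \<open>The single value \<open>\<theta> = (\<bar>a\<bar> + 1) / e\<close> suffices: on grids
  with \<open>n \<ge> \<bar>Lam \<theta>\<bar>\<close> the term \<open>Lam \<theta> / n\<close> is
  at most 1. The threshold depends on \<open>a\<close> and \<open>e\<close> only, which makes the
  level set equicontinuous.\<close>

lemma level_grid_small:
  assumes "e > 0"
  obtains n0 where "n0 > 0"
    "\<And>f n j. f \<in> level a \<Longrightarrow> n \<ge> n0 \<Longrightarrow> j < n \<Longrightarrow> f (real (Suc j) / real n) - f (real j / real n) \<le> e"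
proof -
  let ?t = "(\<bar>a\<bar> + 1) / e"
  define n0 where "n0 = Suc (nat \<lceil>\<bar>Lam ?t\<bar>\<rceil>)"
  show ?thesis
  proof (rule that[of n0])
    show "n0 > 0" by (simp add: n0_def)
    fix f n j assume f: "f \<in> level a" and n: "n \<ge> n0" and j: "j < n"
    have "\<bar>Lam ?t\<bar> \<le> real n0" unfolding n0_def by simp linarith
    with n have "\<bar>Lam ?t\<bar> \<le> real n" by linarith
    then have "Lam ?t / real n \<le> 1" using j by (simp add: divide_le_eq)
    then have "?t * (f (real (Suc j) / real n) - f (real j / real n)) \<le> \<bar>a\<bar> + 1"
      using level_increment[OF f j, of ?t] by linarith
    then have "(\<bar>a\<bar> + 1) * (f (real (Suc j) / real n) - f (real j / real n)) \<le> (\<bar>a\<bar> + 1) * e"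
      using assms by (simp add: divide_le_eq mult.commute)
    then show "f (real (Suc j) / real n) - f (real j / real n) \<le> e"
      by (subst (asm) mult_le_cancel_left_pos) auto
  qed
qed

lemma level_equicontinuous:
  assumes "e > 0"
  obtains d where "d > 0"
    "\<And>f s t. f \<in> level a \<Longrightarrow> s \<in> {0..1} \<Longrightarrow> t \<in> {0..1} \<Longrightarrow> \<bar>s - t\<bar> < d \<Longrightarrow> \<bar>f s - f t\<bar> \<le> e"
proof -
  obtain n where n: "n > 0" "\<And>f m j. f \<in> level a \<Longrightarrow> m \<ge> n \<Longrightarrow> j < m \<Longrightarrow> f (real (Suc j) / real m) - f (real j / real m) \<le> e / 2"
    using level_grid_small[of "e / 2" a] assms by auto
  \<comment> \<open>Times less than \<open>1 / n\<close> apart lie in one cell or in two adjacent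
    ones, each contributing at most \<open>e / 2\<close>; in the last cell there is no further one
    to consider.\<close>
  have main: "f t - f s \<le> e" if f: "f \<in> level a" and st: "0 \<le> s" "s \<le> t" "t \<le> 1" "t - s < 1 / real n" for f s t
  proof (cases "s = 1")
    case True
    then show ?thesis using st assms by auto
  next
    case False
    define j where "j = nat \<lfloor>real n * s\<rfloor>"
    have "real n * s < real n * 1" using False st n by (intro mult_strict_left_mono) auto
    then have j: "j < n" unfolding j_def using st by (simp add: nat_less_iff floor_less_iff)
    have js: "real j \<le> real n * s" "real n * s < real j + 1" unfolding j_def using st by (simp; linarith)+
    have nt: "real n * t < real n * s + 1" using st n by (simp add: field_simps)
    have le_s: "f (real j / real n) \<le> f s"
      using js st n by (intro level_mono[OF f]) (auto simp: field_simps)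
    have Sj: "f (real (Suc j) / real n) - f (real j / real n) \<le> e / 2" using n(2)[OF f order.refl j] .
    show ?thesis
    proof (cases "Suc j < n")
      case True
      have "f t \<le> f (real (Suc (Suc j)) / real n)"
        using js st n nt True by (intro level_mono[OF f]) (auto simp: field_simps)
      with n(2)[OF f order.refl True] Sj le_s show ?thesis by linarith
    next
      case False
      then have "Suc j = n" using j by simp
      then have "f t \<le> f (real (Suc j) / real n)"
        using st n by (intro level_mono[OF f]) (auto simp: field_simps)
      with Sj le_s assms show ?thesis by linarith
    qed
  qed
  show ?thesis
  proof (rule that[of "1 / real n"])
    show "1 / real n > 0" using n by simp
    fix f s t assume f: "f \<in> level a" and st: "s \<in> {0..1}" "t \<in> {0..1}" "\<bar>s - t\<bar> < 1 / real n"
    show "\<bar>f s - f t\<bar> \<le> e"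
    proof (cases "s \<le> t")
      case True
      with main[OF f, of s t] level_mono[OF f, of s t] st show ?thesis by auto
    next
      case False
      with main[OF f, of t s] level_mono[OF f, of t s] st show ?thesis by auto
    qed
  qed
qed

lemma level_continuous_on:
  assumes "f \<in> level a"
  shows "continuous_on {0..1} f"
  unfolding continuous_on_iff
proof (intro ballI allI impI)
  fix x e :: real assume x: "x \<in> {0..1}" and e: "e > 0"
  obtain d where d: "d > 0"
    "\<And>f s t. f \<in> level a \<Longrightarrow> s \<in> {0..1} \<Longrightarrow> t \<in> {0..1} \<Longrightarrow> \<bar>s - t\<bar> < d \<Longrightarrow> \<bar>f s - f t\<bar> \<le> e / 2"
    using level_equicontinuous[of "e / 2" a] e by auto
  show "\<exists>d>0. \<forall>x'\<in>{0..1}. dist x' x < d \<longrightarrow> dist (f x') (f x) < e"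
  proof (intro exI[of _ d] conjI ballI impI d(1))
    fix y assume "y \<in> {0..1}" "dist y x < d"
    with d(2)[OF assms, of y x] x e show "dist (f y) (f x) < e" by (simp add: dist_real_def)
  qed
qed

text \<open>As in the criterion of de la Vallee Poussin: \<open>\<theta>\<close> times the increment
  over a set of cells is at most \<open>a\<close> plus the proportion of cells times
  \<open>Lam \<theta>\<close>. A large \<open>\<theta>\<close> makes \<open>a / \<theta>\<close>
  small, and then a small total length disposes of the other term.\<close>

lemma level_AC:
  assumes f: "f \<in> level a"
  shows "f \<in> AC0"
proof -
  have "absolutely_continuous_fun_on {0..1} f"
    unfolding AC_iff
  proof (intro allI impI)
    fix e :: real assume e: "e > 0"
    have a: "0 \<le> a" by (rule level_nonneg[OF f])
    \<comment> \<open>Chosen so that \<open>(a + 1) / \<theta> = e / 2\<close>; the \<open>d\<close>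
      below keeps the term with \<open>Lam \<theta>\<close> at most 1.\<close>
    define \<theta> where "\<theta> = (2 * a + 2) / e"
    have \<theta>: "\<theta> > 0" using e a by (simp add: \<theta>_def)
    define d where "d = 1 / (\<bar>Lam \<theta>\<bar> + 1)"
    have d: "d > 0" by (simp add: d_def)
    show "\<exists>\<delta>>0. \<forall>I. nonoverlapping I \<longrightarrow> (\<Sum>p\<in>I. snd p - fst p) < \<delta> \<longrightarrow>
        (\<Sum>p\<in>I. \<bar>f (snd p) - f (fst p)\<bar>) < e"
    proof (intro exI[of _ d] conjI allI impI d)
      fix I assume I: "nonoverlapping I" "(\<Sum>p\<in>I. snd p - fst p) < d"
      note ID = nonoverlappingD[OF I(1)]
      let ?g = "\<lambda>t n. real (nat \<lfloor>real n * t\<rfloor>) / real n"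
      have lim: "(\<lambda>n. f (?g t n)) \<longlonglongrightarrow> f t" if "t \<in> {0..1}" for t
        by (rule continuous_on_tendsto_compose[OF level_continuous_on[OF f] grid_floor_tendsto])
           (use that grid_floor_in_unit[OF that] in auto)
      have "(\<Sum>p\<in>I. f (snd p) - f (fst p)) \<le> (a + 1) / \<theta>"
      proof (rule LIMSEQ_le_const2)
        show "(\<lambda>n. \<Sum>p\<in>I. f (?g (snd p) n) - f (?g (fst p) n)) \<longlonglongrightarrow> (\<Sum>p\<in>I. f (snd p) - f (fst p))"
          by (intro tendsto_sum tendsto_diff lim) (use ID in force)+
        have "eventually (\<lambda>n. (\<Sum>p\<in>I. f (?g (snd p) n) - f (?g (fst p) n)) \<le> (a + 1) / \<theta>) sequentially"
          using eventually_card_grid_blocks[OF I] eventually_gt_at_top[of 0]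
        proof eventually_elim
          case (elim n)
          let ?J = "\<Union>p\<in>I. grid_block n p"
          have "(\<Sum>p\<in>I. f (?g (snd p) n) - f (?g (fst p) n))
            = (\<Sum>p\<in>I. \<Sum>j\<in>grid_block n p. f (real (Suc j) / real n) - f (real j / real n))"
            using ID by (intro sum.cong refl sum_grid_block_telescope[symmetric]) auto
          also have "\<dots> = (\<Sum>j\<in>?J. f (real (Suc j) / real n) - f (real j / real n))"
            by (rule sum_grid_blocks[OF I(1)])
          finally have eq: "(\<Sum>p\<in>I. f (?g (snd p) n) - f (?g (fst p) n)) = \<dots>" .
          have "\<theta> * (\<Sum>j\<in>?J. f (real (Suc j) / real n) - f (real j / real n)) \<le> a + real (card ?J) / real n * Lam \<theta>"
            by (rule level_set_increment[OF f grid_blocks_subset[OF I(1)]]) (use elim in auto)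
          also have "\<dots> \<le> a + d * \<bar>Lam \<theta>\<bar>"
            using elim
            by (intro add_left_mono order_trans[OF mult_left_mono[OF abs_ge_self] mult_right_mono]) (auto simp: field_simps)
          also have "\<dots> \<le> a + 1" by (simp add: d_def field_simps)
          finally show ?case unfolding eq using \<theta> by (simp add: pos_le_divide_eq mult.commute)
        qed
        then show "\<exists>N. \<forall>n\<ge>N. (\<Sum>p\<in>I. f (?g (snd p) n) - f (?g (fst p) n)) \<le> (a + 1) / \<theta>"
          by (simp add: eventually_sequentially)
      qed
      also have "(a + 1) / \<theta> = e / 2" using a e by (simp add: \<theta>_def field_simps)
      finally have "(\<Sum>p\<in>I. f (snd p) - f (fst p)) < e" using e by linarith
      moreover have "\<bar>f (snd p) - f (fst p)\<bar> = f (snd p) - f (fst p)" if "p \<in> I" for p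
        using level_mono[OF f ID[OF that]] by simp
      ultimately show "(\<Sum>p\<in>I. \<bar>f (snd p) - f (fst p)\<bar>) < e" by (simp cong: sum.cong)
    qed
  qed
  then show ?thesis using level_0[OF f] by (simp add: AC0_def)
qed

end

section \<open>The integral representation of the rate function\<close>

context rate_exponent begin

definition Ls :: "real \<Rightarrow> ennreal" where
  "Ls x = e2ennreal (legendre_transform Lam x)"

lemma Ls_eq: "Ls x = (SUP \<theta>. ennreal (\<theta> * x - Lam \<theta>))"
proof (rule antisym)
  let ?S = "SUP \<theta>. ennreal (\<theta> * x - Lam \<theta>)"
  have "legendre_transform Lam x \<le> enn2ereal ?S" unfolding legendre_transform_def
  proof (rule SUP_least)
    fix \<theta>
    have "ereal (\<theta> * x - Lam \<theta>) \<le> enn2ereal (ennreal (\<theta> * x - Lam \<theta>))"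
      by (cases "0 \<le> \<theta> * x - Lam \<theta>") (auto simp: ennreal_neg zero_ennreal.rep_eq)
    also have "\<dots> \<le> enn2ereal ?S"
      unfolding less_eq_ennreal.rep_eq[symmetric] by (rule SUP_upper) simp
    finally show "ereal (\<theta> * x - Lam \<theta>) \<le> enn2ereal ?S" .
  qed
  from e2ennreal_mono[OF this] show "Ls x \<le> ?S" unfolding Ls_def by simp
next
  show "(SUP \<theta>. ennreal (\<theta> * x - Lam \<theta>)) \<le> Ls x"
  proof (rule SUP_least)
    fix \<theta>
    have "ereal (\<theta> * x - Lam \<theta>) \<le> legendre_transform Lam x"
      unfolding legendre_transform_def by (rule SUP_upper) simp
    from e2ennreal_mono[OF this] show "ennreal (\<theta> * x - Lam \<theta>) \<le> Ls x" by (simp add: Ls_def)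
  qed
qed

lemma Ls_ge: "ennreal (\<theta> * x - Lam \<theta>) \<le> Ls x"
  unfolding Ls_eq by (rule SUP_upper) simp

lemma Ls_lower_semicontinuous:
  assumes "X \<longlonglongrightarrow> x"
  shows "Ls x \<le> liminf (\<lambda>n. Ls (X n))"
  unfolding Ls_eq[of x]
proof (rule SUP_least)
  fix \<theta>
  have "(\<lambda>n. ennreal (\<theta> * X n - Lam \<theta>)) \<longlonglongrightarrow> ennreal (\<theta> * x - Lam \<theta>)"
    by (intro tendsto_ennrealI tendsto_intros assms)
  then have "ennreal (\<theta> * x - Lam \<theta>) = liminf (\<lambda>n. ennreal (\<theta> * X n - Lam \<theta>))"
    by (simp add: lim_imp_Liminf)
  also have "\<dots> \<le> liminf (\<lambda>n. Ls (X n))" by (intro Liminf_mono always_eventually allI Ls_ge)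
  finally show "ennreal (\<theta> * x - Lam \<theta>) \<le> liminf (\<lambda>n. Ls (X n))" .
qed

lemma Ls_measurable [measurable]: "Ls \<in> borel_measurable borel"
proof (rule borel_measurableI_le)
  fix y :: ennreal
  show "{x \<in> space borel. Ls x \<le> y} \<in> sets borel"
  proof (cases y)
    case (real r)
    have "{x \<in> space borel. Ls x \<le> y} = (\<Inter>\<theta>. {x. \<theta> * x - Lam \<theta> \<le> r})"
      using real by (auto simp: Ls_eq SUP_le_iff)
    also have "closed \<dots>" by (intro closed_INT ballI closed_Collect_le continuous_intros)
    then have "\<dots> \<in> sets borel" by (rule borel_closed)
    finally show ?thesis .
  qed simp
qed

text \<open>Coordinates of a dual vector vary independently, so a bound for all vectors gives a
  bound for the sum of the coordinatewise suprema. The summand \<open>c\<close> stores the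
  coordinates not yet replaced in the induction.\<close>

lemma sum_SUP_le:
  fixes g :: "nat \<Rightarrow> real \<Rightarrow> ennreal"
  assumes "\<And>\<theta>. c + (\<Sum>j<n. g j (\<theta> j)) \<le> A"
  shows "c + (\<Sum>j<n. SUP t. g j t) \<le> A"
  using assms
proof (induction n arbitrary: c)
  case (Suc n)
  have "c + g n t + (\<Sum>j<n. SUP t. g j t) \<le> A" for t
  proof (rule Suc.IH)
    fix \<theta> :: "nat \<Rightarrow> real"
    have "c + (\<Sum>j<Suc n. g j ((\<theta>(n := t)) j)) \<le> A" by (rule Suc.prems)
    moreover have "(\<Sum>j<n. g j ((\<theta>(n := t)) j)) = (\<Sum>j<n. g j (\<theta> j))" by (intro sum.cong) auto
    ultimately show "c + g n t + (\<Sum>j<n. g j (\<theta> j)) \<le> A" by (simp add: add_ac)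
  qed
  then have "(SUP t. (c + (\<Sum>j<n. SUP t. g j t)) + g n t) \<le> A" by (intro SUP_least) (simp add: add_ac)
  then have "(c + (\<Sum>j<n. SUP t. g j t)) + (SUP t. g n t) \<le> A" by (subst ennreal_SUP_add_right) auto
  then show ?case by (simp add: add_ac)
qed simp

text \<open>Optimizing every coordinate of \<open>\<theta>\<close> separately turns
  \<open>Phi\<close> into a Riemann sum of \<open>Ls\<close> at the difference quotients of
  \<open>f\<close>.\<close>

lemma level_sum_Ls:
  assumes f: "f \<in> level a" and n: "n > 0"
  shows "(\<Sum>j<n. ennreal (1 / real n) * Ls (real n * (f (real (Suc j) / real n) - f (real j / real n)))) \<le> ennreal a"
proof -
  define D where "D j = f (real (Suc j) / real n) - f (real j / real n)" for j
  let ?g = "\<lambda>j t. ennreal (1 / real n) * ennreal (t * (real n * D j) - Lam t)"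
  have "0 + (\<Sum>j<n. SUP t. ?g j t) \<le> ennreal a"
  proof (rule sum_SUP_le)
    fix \<theta> :: "nat \<Rightarrow> real"
    \<comment> \<open>A negative term counts as 0 in \<open>ennreal\<close>. Switching its
      coordinate off gives the same value in the real sum, so the bound on \<open>Phi\<close>
      applies.\<close>
    define \<eta> where "\<eta> j = (if 0 \<le> \<theta> j * (real n * D j) - Lam (\<theta> j) then \<theta> j else 0)" for j
    have eta0: "0 \<le> \<eta> j * D j - Lam (\<eta> j) / real n" for j
    proof (cases "0 \<le> \<theta> j * (real n * D j) - Lam (\<theta> j)")
      case True
      then have "0 \<le> (\<theta> j * (real n * D j) - Lam (\<theta> j)) / real n" by simp
      then show ?thesis using True n by (simp add: \<eta>_def diff_divide_distrib)
    qed (simp add: \<eta>_def Lam_0)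
    have "?g j (\<theta> j) = ennreal (\<eta> j * D j - Lam (\<eta> j) / real n)" for j
    proof (cases "0 \<le> \<theta> j * (real n * D j) - Lam (\<theta> j)")
      case True
      then have "?g j (\<theta> j) = ennreal (1 / real n * (\<theta> j * (real n * D j) - Lam (\<theta> j)))"
        by (intro ennreal_mult[symmetric]) auto
      also have "1 / real n * (\<theta> j * (real n * D j) - Lam (\<theta> j)) = \<theta> j * D j - Lam (\<theta> j) / real n"
        using n by (simp add: field_simps)
      finally show ?thesis using True by (simp add: \<eta>_def)
    qed (simp add: \<eta>_def Lam_0 ennreal_neg)
    then have "(\<Sum>j<n. ?g j (\<theta> j)) = ennreal (\<Sum>j<n. \<eta> j * D j - Lam (\<eta> j) / real n)"
      using eta0 by simp
    also have "\<dots> \<le> ennreal a"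
      using level_Phi[OF f n, of \<eta>] by (intro ennreal_leI) (simp only: Phi_def D_def)
    finally show "0 + (\<Sum>j<n. ?g j (\<theta> j)) \<le> ennreal a" by simp
  qed
  then show ?thesis unfolding D_def[symmetric] Ls_eq by (simp add: SUP_mult_left_ennreal)
qed

text \<open>The difference quotients over the cell containing \<open>t\<close> converge to the
  density almost everywhere. Lower semicontinuity of \<open>Ls\<close> handles the pointwise limit
  and Fatou's lemma the integrals, which are Riemann sums bounded by \<open>a\<close>.\<close>

lemma level_imp_rate_le:
  assumes f: "f \<in> level a"
  shows "path_rate_function Lam f \<le> ennreal a"
proof -
  have fAC: "f \<in> AC0" by (rule level_AC[OF f])
  then have "absolutely_continuous_fun_on {0..1} f" by (simp add: AC0_def)
  then obtain g where g: "integrable lborel g"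
    "\<And>a b. 0 \<le> a \<Longrightarrow> a \<le> b \<Longrightarrow> b \<le> 1 \<Longrightarrow> f b - f a = (LINT y:{a<..b}|lborel. g y)"
    using AC_density by blast
  have AEd: "AE t in lborel. t \<in> {0<..<1} \<longrightarrow> (f has_real_derivative g t) (at t)"
    by (rule AE_has_derivative_density[OF g(1)]) (rule g(2))
  define q where "q n t = real n * (f (real (Suc (nat \<lfloor>real n * t\<rfloor>)) / real n) - f (real (nat \<lfloor>real n * t\<rfloor>) / real n))" for n t
  have fl: "nat \<lfloor>real n * t\<rfloor> < n" "real (nat \<lfloor>real n * t\<rfloor>) \<le> real n * t" "real n * t < real (nat \<lfloor>real n * t\<rfloor>) + 1"
    if "0 \<le> t" "t < 1" "n > 0" for n t
  proof -
    have "real n * t < real n * 1" using that by (intro mult_strict_left_mono) auto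
    then show "nat \<lfloor>real n * t\<rfloor> < n" using that by (simp add: nat_less_iff floor_less_iff)
    show "real (nat \<lfloor>real n * t\<rfloor>) \<le> real n * t" "real n * t < real (nat \<lfloor>real n * t\<rfloor>) + 1"
      using that by simp_all
  qed
  have q_meas [measurable]: "(\<lambda>t. Ls (q n t)) \<in> borel_measurable borel" for n
  proof -
    have "(\<lambda>t. nat \<lfloor>real n * t\<rfloor>) \<in> borel \<rightarrow>\<^sub>M count_space UNIV" by measurable
    then show ?thesis unfolding q_def by (rule measurable_compose) simp
  qed
  have int_q: "(\<integral>\<^sup>+t. Ls (q n t) * indicator {0..1} t \<partial>lborel) \<le> ennreal a" if n: "n > 0" for n
  proof -
    let ?D = "\<lambda>j. Ls (real n * (f (real (Suc j) / real n) - f (real j / real n)))"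
    let ?c = "\<lambda>j. {real j / real n..<real (Suc j) / real n}"
    have "(\<integral>\<^sup>+t. Ls (q n t) * indicator {0..1} t \<partial>lborel) \<le> (\<integral>\<^sup>+t. (\<Sum>j<n. ?D j * indicator (?c j) t) \<partial>lborel)"
    proof (rule nn_integral_mono_AE)
      show "AE t in lborel. Ls (q n t) * indicator {0..1} t \<le> (\<Sum>j<n. ?D j * indicator (?c j) t)"
        \<comment> \<open>The half-open cells miss the endpoint 1, which is discarded as a null
          set.\<close>
        using AE_lborel_singleton[of 1]
      proof eventually_elim
        case (elim t)
        show ?case
        proof (cases "t \<in> {0..1}")
          case True
          then have t: "0 \<le> t" "t < 1" using elim by auto
          let ?j = "nat \<lfloor>real n * t\<rfloor>"
          have "t \<in> ?c ?j" using fl[OF t n] n by (auto simp: field_simps)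
          then have "Ls (q n t) * indicator {0..1} t = ?D ?j * indicator (?c ?j) t"
            using True by (simp add: q_def)
          also have "\<dots> \<le> (\<Sum>j<n. ?D j * indicator (?c j) t)"
            using fl(1)[OF t n] by (intro member_le_sum) auto
          finally show ?thesis .
        qed simp
      qed
    qed
    also have "\<dots> = (\<Sum>j<n. (\<integral>\<^sup>+t. ?D j * indicator (?c j) t \<partial>lborel))"
      by (rule nn_integral_sum) measurable
    also have "\<dots> = (\<Sum>j<n. ennreal (1 / real n) * ?D j)"
    proof (intro sum.cong refl)
      fix j
      have "(\<integral>\<^sup>+t. ?D j * indicator (?c j) t \<partial>lborel) = ?D j * emeasure lborel (?c j)"
        by (rule nn_integral_cmult_indicator) simp
      also have "emeasure lborel (?c j) = ennreal (1 / real n)"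
        using n by (simp add: divide_right_mono diff_divide_distrib[symmetric])
      finally show "(\<integral>\<^sup>+t. ?D j * indicator (?c j) t \<partial>lborel) = ennreal (1 / real n) * ?D j"
        by (simp only: mult.commute)
    qed
    also have "\<dots> \<le> ennreal a" by (rule level_sum_Ls[OF f n])
    finally show ?thesis .
  qed
  \<comment> \<open>The shift to \<open>Suc n\<close> removes the grid with 0 cells, to which
    \<open>int_q\<close> does not apply.\<close>
  have AE1: "AE t in lborel. Ls (deriv f t) * indicator {0..1} t \<le> liminf (\<lambda>n. Ls (q (Suc n) t) * indicator {0..1} t)"
    using AEd Lebesgue_differentiation[OF g(1)] AE_lborel_singleton[of 0] AE_lborel_singleton[of 1]
  proof eventually_elim
    case (elim t)
    show ?case
    proof (cases "t \<in> {0..1}")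
      case True
      then have t: "0 < t" "t < 1" using elim by auto
      have d: "deriv f t = g t" using elim(1) t by (intro DERIV_imp_deriv) auto
      have "(\<lambda>n. q (Suc n) t) \<longlonglongrightarrow> g t"
      proof (rule LIMSEQ_I)
        fix r :: real assume r: "r > 0"
        obtain d where d: "d > 0" "\<And>u v. u \<le> t \<Longrightarrow> t \<le> v \<Longrightarrow> u < v \<Longrightarrow> v - u < d \<Longrightarrow>
          \<bar>(LINT y:{u<..v}|lborel. g y) - g t * (v - u)\<bar> \<le> (r/2) * (v - u)"
          using elim(2)[rule_format, OF half_gt_zero[OF r]] by blast
        obtain N :: nat where N: "N > 0" "1 / real N < d" using d(1) by (metis nat_approx_posE of_nat_Suc zero_less_Suc)
        show "\<exists>no. \<forall>n\<ge>no. norm (q (Suc n) t - g t) < r"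
        proof (intro exI[of _ N] allI impI)
          fix n assume "n \<ge> N"
          define m where "m = Suc n"
          have m: "m > 0" "1 / real m < d"
          proof -
            have "1 / real m \<le> 1 / real N" using \<open>n \<ge> N\<close> N by (intro divide_left_mono) (auto simp: m_def)
            then show "1 / real m < d" using N by simp
          qed (simp add: m_def)
          define j where "j = nat \<lfloor>real m * t\<rfloor>"
          define u v where "u = real j / real m" and "v = real (Suc j) / real m"
          note F = fl[of t m, folded j_def]
          have uv: "u \<le> t" "t \<le> v" "u < v" "v - u = 1 / real m" "0 \<le> u" "v \<le> 1"
            using F t m by (auto simp: u_def v_def field_simps diff_divide_distrib[symmetric])
          have "\<bar>(LINT y:{u<..v}|lborel. g y) - g t * (v - u)\<bar> \<le> (r/2) * (v - u)"
            by (rule d(2)) (use uv m in auto)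
          then have "\<bar>(f v - f u) - g t * (1 / real m)\<bar> \<le> (r/2) * (1 / real m)"
            using g(2)[of u v] uv by simp
          then have "real m * \<bar>(f v - f u) - g t * (1 / real m)\<bar> \<le> real m * ((r/2) * (1 / real m))"
            by (rule mult_left_mono) simp
          moreover have "real m * \<bar>(f v - f u) - g t * (1 / real m)\<bar> = \<bar>q m t - g t\<bar>"
          proof -
            have "q m t - g t = real m * ((f v - f u) - g t * (1 / real m))"
              using m by (simp add: q_def u_def v_def j_def[symmetric] right_diff_distrib)
            then show ?thesis by (simp add: abs_mult)
          qed
          moreover have "real m * ((r/2) * (1 / real m)) = r / 2" using m by simp
          ultimately have "\<bar>q m t - g t\<bar> \<le> r / 2" by linarith
          then show "norm (q (Suc n) t - g t) < r" using r by (simp add: m_def)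
        qed
      qed
      from Ls_lower_semicontinuous[OF this] show ?thesis using d True by simp
    qed simp
  qed
  have "path_rate_function Lam f = (\<integral>\<^sup>+t. Ls (deriv f t) * indicator {0..1} t \<partial>lborel)"
    using fAC by (simp add: path_rate_function_def Ls_def)
  also have "\<dots> \<le> (\<integral>\<^sup>+t. liminf (\<lambda>n. Ls (q (Suc n) t) * indicator {0..1} t) \<partial>lborel)"
    by (rule nn_integral_mono_AE[OF AE1])
  also have "\<dots> \<le> liminf (\<lambda>n. (\<integral>\<^sup>+t. Ls (q (Suc n) t) * indicator {0..1} t \<partial>lborel))"
    by (rule nn_integral_liminf) measurable
  also have "\<dots> \<le> liminf (\<lambda>n::nat. ennreal a)"
    by (intro Liminf_mono always_eventually allI int_q) simp
  also have "\<dots> = ennreal a" by (simp add: Liminf_const)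
  finally show ?thesis .
qed

text \<open>Fenchel's inequality \<open>\<theta> * x - Lam \<theta> \<le> Ls x\<close>, applied to
  the density with a \<open>\<theta>\<close> constant on each cell, integrates to the bound on
  \<open>Phi\<close>. This is the form in which Jensen's inequality enters.\<close>

lemma rate_le_imp_level:
  assumes f: "f \<in> cadlag_space" and le: "path_rate_function Lam f \<le> ennreal a" and a: "0 \<le> a"
  shows "f \<in> level a"
proof -
  have fAC: "f \<in> AC0" using le by (auto simp: path_rate_function_def top_unique split: if_splits)
  then have AC: "absolutely_continuous_fun_on {0..1} f" and f0: "f 0 = 0" by (simp_all add: AC0_def)
  from AC obtain g where g: "integrable lborel g"
    "\<And>a b. 0 \<le> a \<Longrightarrow> a \<le> b \<Longrightarrow> b \<le> 1 \<Longrightarrow> f b - f a = (LINT y:{a<..b}|lborel. g y)"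
    using AC_density by blast
  have AEd: "AE t in lborel. t \<in> {0<..<1} \<longrightarrow> (f has_real_derivative g t) (at t)"
    by (rule AE_has_derivative_density[OF g(1)]) (rule g(2))
  have "(\<integral>\<^sup>+t. Ls (g t) * indicator {0..1} t \<partial>lborel) = (\<integral>\<^sup>+t. Ls (deriv f t) * indicator {0..1} t \<partial>lborel)"
  proof (rule nn_integral_cong_AE)
    show "AE t in lborel. Ls (g t) * indicator {0..1} t = Ls (deriv f t) * indicator {0..1} t"
      using AEd AE_lborel_singleton[of 0] AE_lborel_singleton[of 1]
    proof eventually_elim
      case (elim t)
      then have "t \<in> {0..1} \<Longrightarrow> deriv f t = g t" by (intro DERIV_imp_deriv) auto
      then show ?case by (auto simp: indicator_def)
    qed
  qed
  also have "\<dots> \<le> ennreal a" using le fAC by (simp add: path_rate_function_def Ls_def)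
  finally have int: "(\<integral>\<^sup>+t. Ls (g t) * indicator {0..1} t \<partial>lborel) \<le> ennreal a" .
  have "Phi n \<theta> f \<le> a" if n: "n > 0" for n \<theta>
  proof -
    let ?c = "\<lambda>j. {real j / real n<..real (Suc j) / real n}"
    let ?h = "\<lambda>j t. indicator (?c j) t *\<^sub>R (\<theta> j * g t - Lam (\<theta> j))"
    define H where "H t = (\<Sum>j<n. ?h j t)" for t
    have sg: "set_integrable lborel (?c j) (\<lambda>t. \<theta> j * g t)" for j
      unfolding set_integrable_def by (intro integrable_mult_indicator integrable_mult_right g(1)) simp
    have sc: "set_integrable lborel (?c j) (\<lambda>t. Lam (\<theta> j))" for j
      unfolding set_integrable_def
      by (intro integrable_scaleR_left integrable_real_indicator) (auto simp: divide_right_mono)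
    have ih: "integrable lborel (?h j)" for j
      using set_integral_diff(1)[OF sg sc] by (simp add: set_integrable_def)
    have iH: "integrable lborel H" unfolding H_def by (intro Bochner_Integration.integrable_sum ih)
    have "(\<integral>t. H t \<partial>lborel) = (\<Sum>j<n. \<integral>t. ?h j t \<partial>lborel)"
      unfolding H_def by (rule Bochner_Integration.integral_sum[OF ih])
    also have "\<dots> = Phi n \<theta> f"
      unfolding Phi_def
    proof (intro sum.cong refl)
      fix j assume j: "j \<in> {..<n}"
      have "(\<integral>t. ?h j t \<partial>lborel) = (LINT t:?c j|lborel. \<theta> j * g t) - (LINT t:?c j|lborel. Lam (\<theta> j))"
        using set_integral_diff(2)[OF sg sc] by (simp add: set_lebesgue_integral_def)
      also have "(LINT t:?c j|lborel. \<theta> j * g t) = \<theta> j * (f (real (Suc j) / real n) - f (real j / real n))"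
        using j n by (subst g(2)) (auto simp: divide_right_mono set_lebesgue_integral_def mult.left_commute)
      also have "(LINT t:?c j|lborel. Lam (\<theta> j)) = Lam (\<theta> j) / real n"
        using n by (simp add: set_lebesgue_integral_def divide_right_mono diff_divide_distrib[symmetric])
      finally show "(\<integral>t. ?h j t \<partial>lborel) = \<theta> j * (f (real (Suc j) / real n) - f (real j / real n)) - Lam (\<theta> j) / real n" .
    qed
    finally have PH: "Phi n \<theta> f = (\<integral>t. H t \<partial>lborel)" ..
    \<comment> \<open>\<open>H\<close> can be negative, so its positive part is compared with the
      nonnegative integrand \<open>Ls (g t)\<close>.\<close>
    have iM: "integrable lborel (\<lambda>t. max 0 (H t))" by (intro integrable_max iH) simp
    have pt: "ennreal (max 0 (H t)) \<le> Ls (g t) * indicator {0..1} t" for t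
    proof (cases "\<exists>j<n. t \<in> ?c j")
      case True
      then obtain j where j: "j < n" "t \<in> ?c j" by blast
      have un: "i = j" if "t \<in> ?c i" for i
      proof -
        have "real i < real (Suc j)" "real j < real (Suc i)"
          using that j(2) n by (auto simp: field_simps)
        then show ?thesis by linarith
      qed
      have "H t = (\<Sum>i<n. if i = j then \<theta> j * g t - Lam (\<theta> j) else 0)"
        unfolding H_def
      proof (intro sum.cong refl)
        fix i show "?h i t = (if i = j then \<theta> j * g t - Lam (\<theta> j) else 0)"
        proof (cases "t \<in> ?c i")
          case True
          with un[OF True] show ?thesis by simp
        next
          case False
          with j(2) show ?thesis by (cases "i = j") simp_all
        qed
      qed
      also have "\<dots> = \<theta> j * g t - Lam (\<theta> j)" using j by simp
      finally have "ennreal (max 0 (H t)) = ennreal (\<theta> j * g t - Lam (\<theta> j))" by (simp add: max_def ennreal_neg)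
      also have "\<dots> \<le> Ls (g t)" by (rule Ls_ge)
      finally have le: "ennreal (max 0 (H t)) \<le> Ls (g t)" .
      have "0 \<le> real j / real n" "real (Suc j) / real n \<le> 1" using j(1) n by auto
      with j(2) have "t \<in> {0..1}" unfolding atLeastAtMost_iff greaterThanAtMost_iff by linarith
      with le show ?thesis by simp
    next
      case False
      then have "H t = 0" unfolding H_def by (intro sum.neutral) (auto simp: indicator_def)
      then show ?thesis by simp
    qed
    have "Phi n \<theta> f \<le> (\<integral>t. max 0 (H t) \<partial>lborel)"
      unfolding PH by (intro integral_mono iH iM) auto
    moreover have "ennreal (\<integral>t. max 0 (H t) \<partial>lborel) \<le> ennreal a"
    proof -
      have "ennreal (\<integral>t. max 0 (H t) \<partial>lborel) = (\<integral>\<^sup>+t. ennreal (max 0 (H t)) \<partial>lborel)"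
        by (intro nn_integral_eq_integral[symmetric] iM) auto
      also have "\<dots> \<le> (\<integral>\<^sup>+t. Ls (g t) * indicator {0..1} t \<partial>lborel)" by (intro nn_integral_mono pt)
      finally show ?thesis using int by (rule order_trans)
    qed
    then have "(\<integral>t. max 0 (H t) \<partial>lborel) \<le> a" using a by (simp add: ennreal_le_iff)
    ultimately show ?thesis by linarith
  qed
  with f f0 show ?thesis by (simp add: level_def)
qed

end

section \<open>Compactness of the level sets\<close>

definition cadlag_metric :: "(real \<Rightarrow> real) metric" where
  "cadlag_metric = submetric (funspace {0..1} euclidean_metric) cadlag_space"

lemma cadlag_space_subset_funspace: "cadlag_space \<subseteq> mspace (funspace {0..1} euclidean_metric)"
  using cadlag_bounded by (auto simp: Met_TC.fspace_def cadlag_space_def)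

lemma mspace_cadlag_metric [simp]: "mspace cadlag_metric = cadlag_space"
  using cadlag_space_subset_funspace unfolding cadlag_metric_def by auto

lemma cadlag_mdist_le:
  assumes "f \<in> cadlag_space" "g \<in> cadlag_space"
  shows "mdist cadlag_metric f g \<le> b \<longleftrightarrow> (\<forall>t\<in>{0..1}. \<bar>f t - g t\<bar> \<le> b)"
proof -
  have "f \<in> mspace (funspace {0..1} euclidean_metric)" "g \<in> mspace (funspace {0..1} euclidean_metric)"
    using assms cadlag_space_subset_funspace by blast+
  then have "mdist (funspace {0..1} euclidean_metric) f g \<le> b \<longleftrightarrow> (\<forall>t\<in>{0..1}. mdist euclidean_metric (f t) (g t) \<le> b)"
    by (rule funspace_mdist_le) simp
  then show ?thesis by (simp add: cadlag_metric_def dist_real_def)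
qed

interpretation cadlag: Metric_space cadlag_space "mdist cadlag_metric"
  using Metric_space_mspace_mdist[of cadlag_metric] by simp

lemma cadlag_mtopology: "cadlag.mtopology = cadlag_uniform_topology"
  unfolding cadlag_uniform_topology_def mtopology_of_def cadlag_metric_def[symmetric] by simp

lemma openin_cadlagD:
  assumes "openin cadlag_uniform_topology U" "f \<in> U"
  obtains e where "e > 0" "\<And>h. h \<in> cadlag_space \<Longrightarrow> (\<And>t. t \<in> {0..1} \<Longrightarrow> \<bar>h t - f t\<bar> \<le> e) \<Longrightarrow> h \<in> U"
proof -
  have U: "U \<subseteq> cadlag_space" "\<exists>r>0. cadlag.mball f r \<subseteq> U"
    using assms unfolding cadlag_mtopology[symmetric] cadlag.openin_mtopology by auto
  then obtain r where r: "r > 0" "cadlag.mball f r \<subseteq> U" by blast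
  show ?thesis
  proof (rule that[of "r / 2"])
    fix h assume h: "h \<in> cadlag_space" "\<And>t. t \<in> {0..1} \<Longrightarrow> \<bar>h t - f t\<bar> \<le> r / 2"
    have f: "f \<in> cadlag_space" using U assms by blast
    have "mdist cadlag_metric f h \<le> r / 2"
      using h(2) by (subst cadlag_mdist_le[OF f h(1)]) (auto simp: abs_minus_commute)
    then have "h \<in> cadlag.mball f r" using r f h by (auto simp: cadlag.in_mball)
    then show "h \<in> U" using r by blast
  qed (use r in simp)
qed

lemma restrict_continuous_cadlag:
  fixes g :: "real \<Rightarrow> real"
  assumes "continuous_on {0..1} g"
  shows "restrict g {0..1} \<in> cadlag_space"
proof -
  have t: "(g \<longlongrightarrow> g t) (at t within S)" if "t \<in> {0..1}" "S \<subseteq> {0..1}" for t S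
    using assms that unfolding continuous_on_def by (meson tendsto_within_subset)
  have r: "(restrict g {0..1} \<longlongrightarrow> restrict g {0..1} t) (at_right t)" if "t \<in> {0..<1}" for t
  proof -
    have "(g \<longlongrightarrow> g t) (at t within {t..1})" using that by (intro t) auto
    then have "(g \<longlongrightarrow> g t) (at_right t)" using that by (simp add: at_within_Icc_at_right)
    moreover have "eventually (\<lambda>s. g s = restrict g {0..1} s) (at_right t)"
      by (rule eventually_mono[OF eventually_at_right_real[of t 1]]) (use that in auto)
    ultimately have "(restrict g {0..1} \<longlongrightarrow> g t) (at_right t)" by (rule Lim_transform_eventually)
    then show ?thesis using that by simp
  qed
  have l: "\<exists>l. (restrict g {0..1} \<longlongrightarrow> l) (at_left t)" if "t \<in> {0<..1}" for t
  proof -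
    have "(g \<longlongrightarrow> g t) (at t within {0..t})" using that by (intro t) auto
    then have "(g \<longlongrightarrow> g t) (at_left t)" using that by (simp add: at_within_Icc_at_left)
    moreover have "eventually (\<lambda>s. g s = restrict g {0..1} s) (at_left t)"
      by (rule eventually_mono[OF eventually_at_left_real[of 0 t]]) (use that in auto)
    ultimately have "(restrict g {0..1} \<longlongrightarrow> g t) (at_left t)" by (rule Lim_transform_eventually)
    then show ?thesis by blast
  qed
  show ?thesis unfolding cadlag_space_def using r l by auto
qed

context rate_exponent begin

lemma level_bounded:
  assumes f: "f \<in> level a" and t: "t \<in> {0..1}"
  shows "\<bar>f t\<bar> \<le> a + Lam 1"
proof -
  have "f 0 \<le> f t" "f t \<le> f 1" using level_mono[OF f, of 0 t] level_mono[OF f, of t 1] t by auto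
  moreover have "f 1 - f 0 \<le> a + Lam 1" using level_increment[OF f, of 0 1 1] by simp
  ultimately show ?thesis using level_0[OF f] by simp
qed

text \<open>Arzela-Ascoli applies because the bounds on size and oscillation are uniform over the
  level set. The limit stays in it, since each \<open>Phi n \<theta>\<close> is continuous under
  pointwise convergence.\<close>

lemma level_compactin: "compactin cadlag_uniform_topology (level a)"
  unfolding cadlag_mtopology[symmetric] cadlag.compactin_sequentially
proof (intro conjI allI impI)
  show "level a \<subseteq> cadlag_space" by (auto simp: level_def)
  fix \<sigma> :: "nat \<Rightarrow> real \<Rightarrow> real" assume "range \<sigma> \<subseteq> level a"
  then have \<sigma>: "\<sigma> n \<in> level a" for n by auto
  obtain g k where g: "continuous_on {0..1} g" and k: "strict_mono (k :: nat \<Rightarrow> nat)"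
    and conv: "\<And>e. 0 < e \<Longrightarrow> \<exists>N. \<forall>n x. n \<ge> N \<and> x \<in> {0..1} \<longrightarrow> norm (\<sigma> (k n) x - g x) < e"
  proof (rule Arzela_Ascoli[of "{0..1::real}" \<sigma> "a + Lam 1"])
    show "norm (\<sigma> n x) \<le> a + Lam 1" if "x \<in> {0..1}" for n x using level_bounded[OF \<sigma> that] by simp
    fix x e :: real assume x: "x \<in> {0..1}" and e: "0 < e"
    obtain d where d: "d > 0"
      "\<And>f s t. f \<in> level a \<Longrightarrow> s \<in> {0..1} \<Longrightarrow> t \<in> {0..1} \<Longrightarrow> \<bar>s - t\<bar> < d \<Longrightarrow> \<bar>f s - f t\<bar> \<le> e / 2"
      using level_equicontinuous[of "e / 2" a] e by auto
    show "\<exists>d>0. \<forall>n y. y \<in> {0..1} \<and> norm (x - y) < d \<longrightarrow> norm (\<sigma> n x - \<sigma> n y) < e"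
    proof (intro exI[of _ d] conjI allI impI d(1))
      fix n y assume "y \<in> {0..1} \<and> norm (x - y) < d"
      then show "norm (\<sigma> n x - \<sigma> n y) < e" using d(2)[OF \<sigma>, of x y n] x e by simp
    qed
  qed auto
  define h where "h = restrict g {0..1}"
  have hc: "h \<in> cadlag_space" unfolding h_def by (rule restrict_continuous_cadlag[OF g])
  have pt: "(\<lambda>n. \<sigma> (k n) t) \<longlonglongrightarrow> h t" if "t \<in> {0..1}" for t
  proof (rule LIMSEQ_I)
    fix r :: real assume "r > 0"
    from conv[OF this] that show "\<exists>no. \<forall>n\<ge>no. norm (\<sigma> (k n) t - h t) < r" by (auto simp: h_def)
  qed
  have "h \<in> level a"
  proof -
    have "(\<lambda>n. \<sigma> (k n) 0) \<longlonglongrightarrow> h 0" by (rule pt) simp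
    then have "h 0 = 0" using level_0[OF \<sigma>] by (simp add: LIMSEQ_const_iff)
    moreover have "Phi n \<theta> h \<le> a" if n: "n > 0" for n \<theta>
    proof (rule LIMSEQ_le_const2)
      show "(\<lambda>m. Phi n \<theta> (\<sigma> (k m))) \<longlonglongrightarrow> Phi n \<theta> h"
        unfolding Phi_def using n by (intro tendsto_intros pt) (auto simp: divide_le_eq_1)
      show "\<exists>N. \<forall>m\<ge>N. Phi n \<theta> (\<sigma> (k m)) \<le> a" using level_Phi[OF \<sigma> n] by blast
    qed
    ultimately show ?thesis using hc by (simp add: level_def)
  qed
  moreover have "limitin cadlag.mtopology (\<sigma> \<circ> k) h sequentially"
    unfolding cadlag.limitin_metric
  proof (intro conjI allI impI hc)
    fix e :: real assume e: "e > 0"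
    then obtain N where N: "\<forall>n x. n \<ge> N \<and> x \<in> {0..1} \<longrightarrow> norm (\<sigma> (k n) x - g x) < e / 2"
      using conv[of "e / 2"] by auto
    show "\<forall>\<^sub>F n in sequentially. (\<sigma> \<circ> k) n \<in> cadlag_space \<and> mdist cadlag_metric ((\<sigma> \<circ> k) n) h < e"
      unfolding eventually_sequentially
    proof (intro exI[of _ N] allI impI)
      fix n assume n: "n \<ge> N"
      have c: "\<sigma> (k n) \<in> cadlag_space" using level_cadlag[OF \<sigma>] .
      have "mdist cadlag_metric (\<sigma> (k n)) h \<le> e / 2"
        using N n by (subst cadlag_mdist_le[OF c hc]) (auto simp: h_def less_imp_le)
      then show "(\<sigma> \<circ> k) n \<in> cadlag_space \<and> mdist cadlag_metric ((\<sigma> \<circ> k) n) h < e" using c e by simp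
    qed
  qed
  ultimately show "\<exists>l r. l \<in> level a \<and> strict_mono r \<and> limitin cadlag.mtopology (\<sigma> \<circ> r) l sequentially"
    using k by blast
qed

lemma level_closedin: "closedin cadlag_uniform_topology (level a)"
  using level_compactin cadlag.Hausdorff_space_mtopology unfolding cadlag_mtopology
  by (rule compactin_imp_closedin[rotated])

text \<open>A compact set has positive uniform distance from a disjoint closed set: otherwise
  approximating pairs would have a common limit. The margin \<open>e\<close> tells the upper bound
  how finely paths must be resolved.\<close>

lemma level_separation:
  assumes F: "closedin cadlag_uniform_topology F" and disj: "level a \<inter> F = {}"
  obtains e where "e > 0"
    "\<And>f h. f \<in> level a \<Longrightarrow> h \<in> F \<Longrightarrow> (\<And>t. t \<in> {0..1} \<Longrightarrow> \<bar>h t - f t\<bar> \<le> e) \<Longrightarrow> False"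
proof (rule ccontr)
  assume "\<not> thesis"
  with that have "\<not> (\<exists>e>0. \<forall>f\<in>level a. \<forall>h\<in>F. \<not> (\<forall>t\<in>{0..1}. \<bar>h t - f t\<bar> \<le> e))" by blast
  moreover have "1 / real (Suc n) > 0" for n by simp
  ultimately have "\<forall>n. \<exists>f h. f \<in> level a \<and> h \<in> F \<and> (\<forall>t\<in>{0..1}. \<bar>h t - f t\<bar> \<le> 1 / real (Suc n))"
    by blast
  then obtain f h where fh: "\<And>n. f n \<in> level a" "\<And>n. h n \<in> F"
    "\<And>n. \<forall>t\<in>{0..1}. \<bar>h n t - f n t\<bar> \<le> 1 / real (Suc n)" by metis
  have FS: "F \<subseteq> cadlag_space" using closedin_subset[OF F] by simp
  obtain l r where l: "l \<in> level a" "strict_mono r" "limitin cadlag.mtopology (f \<circ> r) l sequentially"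
    using level_compactin[of a] fh(1) unfolding cadlag_mtopology[symmetric] cadlag.compactin_sequentially
    by (meson image_subsetI)
  have lim: "limitin cadlag.mtopology (h \<circ> r) l sequentially"
    unfolding cadlag.limitin_metric
  proof (intro conjI allI impI)
    show lc: "l \<in> cadlag_space" by (rule level_cadlag[OF l(1)])
    fix e :: real assume e: "e > 0"
    have "\<forall>\<^sub>F n in sequentially. 1 / real (Suc (r n)) < e / 2"
    proof -
      have "(\<lambda>n. 1 / real (Suc n)) \<longlonglongrightarrow> 0" by (rule LIMSEQ_Suc[OF lim_1_over_n])
      then have "(\<lambda>n. 1 / real (Suc (r n))) \<longlonglongrightarrow> 0"
        using filterlim_compose filterlim_subseq[OF l(2)] by fast
      then show ?thesis using e by (intro order_tendstoD) auto
    qed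
    moreover have "\<forall>\<^sub>F n in sequentially. mdist cadlag_metric ((f \<circ> r) n) l < e / 2"
      using l(3) e unfolding cadlag.limitin_metric by (auto dest!: spec[of _ "e / 2"] elim: eventually_mono)
    ultimately show "\<forall>\<^sub>F n in sequentially. (h \<circ> r) n \<in> cadlag_space \<and> mdist cadlag_metric ((h \<circ> r) n) l < e"
    proof eventually_elim
      case (elim n)
      have hc: "h (r n) \<in> cadlag_space" using FS fh(2) by blast
      have fc: "f (r n) \<in> cadlag_space" by (rule level_cadlag[OF fh(1)])
      have "mdist cadlag_metric (h (r n)) (f (r n)) \<le> 1 / real (Suc (r n))"
        using fh(3) cadlag_mdist_le[OF hc fc] by blast
      with elim cadlag.triangle[OF hc fc lc] show ?case using hc by simp
    qed
  qed
  have "\<forall>\<^sub>F n in sequentially. (h \<circ> r) n \<in> F" using fh(2) by simp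
  with lim F have "l \<in> F" unfolding cadlag_mtopology
    by (rule limitin_closedin) simp
  with l(1) disj show False by blast
qed

end

section \<open>Piecewise linear interpolation\<close>

text \<open>For \<open>t \<ge> 0\<close> and \<open>n > 0\<close> this is the length of the part of
  the cell from \<open>j / n\<close> to \<open>(j + 1) / n\<close> that lies before
  \<open>t\<close>. The interpolant is therefore the integral of a step function whose values are
  the slopes.\<close>

definition ramp :: "nat \<Rightarrow> nat \<Rightarrow> real \<Rightarrow> real" where
  "ramp n j t = max 0 (min (t - real j / real n) (1 / real n))"

definition linear_interpolant :: "nat \<Rightarrow> (nat \<Rightarrow> real) \<Rightarrow> real \<Rightarrow> real" where
  "linear_interpolant n z = restrict (\<lambda>t. \<Sum>j<n. real n * (z (Suc j) - z j) * ramp n j t) {0..1}"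

lemma ramp_mono: "s \<le> t \<Longrightarrow> ramp n j s \<le> ramp n j t"
  by (auto simp: ramp_def)

lemma sum_ramp:
  assumes "n > 0" "t \<ge> 0"
  shows "(\<Sum>j<N. ramp n j t) = min t (real N / real n)"
proof (induction N)
  case (Suc N)
  define c where "c = 1 / real n"
  have "real (Suc N) / real n = real N / real n + c" by (simp add: add_divide_distrib c_def)
  moreover have "0 < c" using assms by (simp add: c_def)
  moreover have "ramp n N t = max 0 (min (t - real N / real n) c)" by (simp add: ramp_def c_def)
  ultimately show ?case using Suc by (auto simp: min_def max_def)
qed (use assms in simp)

lemma ramp_grid:
  assumes "n > 0"
  shows "ramp n j (real i / real n) = (if j < i then 1 / real n else 0)"
proof -
  have "real i / real n - real j / real n = (real i - real j) / real n" by (simp add: diff_divide_distrib)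
  then show ?thesis using assms
    by (auto simp: ramp_def divide_right_mono min_def max_def divide_le_0_iff divide_le_cancel zero_le_divide_iff)
qed

lemma linear_interpolant_grid:
  assumes n: "n > 0" and i: "i \<le> n" and z: "z 0 = 0"
  shows "linear_interpolant n z (real i / real n) = z i"
proof -
  have "real i / real n \<in> {0..1}" using i n by simp
  then have "linear_interpolant n z (real i / real n) = (\<Sum>j<n. if j < i then z (Suc j) - z j else 0)"
    unfolding linear_interpolant_def restrict_def using n by (simp add: ramp_grid if_distrib cong: if_cong)
  also have "\<dots> = (\<Sum>j\<in>{..<n} \<inter> {..<i}. z (Suc j) - z j)"
    by (subst sum.inter_restrict) (auto intro!: sum.cong)
  also have "{..<n} \<inter> {..<i} = {..<i}" using i by auto
  also have "(\<Sum>j<i. z (Suc j) - z j) = z i" using z by (simp add: sum_lessThan_telescope)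
  finally show ?thesis .
qed

context rate_exponent begin

text \<open>The constraint is assumed on the grid of the interpolant alone but is needed on every
  grid \<open>m\<close>. The slope is constant on each of the \<open>n\<close> cells, so for each of
  them the best of the \<open>m\<close> values of \<open>\<theta>\<close> does at least as well as
  any of their averages.\<close>

lemma linear_interpolant_level:
  assumes n: "n > 0" and z: "z 0 = 0"
    and le: "\<And>\<theta>. (\<Sum>j<n. \<theta> j * (z (Suc j) - z j) - Lam (\<theta> j) / real n) \<le> a"
  shows "linear_interpolant n z \<in> level a"
proof -
  define w where "w j = real n * (z (Suc j) - z j)" for j
  have cont: "continuous_on {0..1} (\<lambda>t. \<Sum>j<n. w j * ramp n j t)"
    unfolding ramp_def by (intro continuous_intros)
  then have cad: "linear_interpolant n z \<in> cadlag_space"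
    unfolding linear_interpolant_def w_def by (rule restrict_continuous_cadlag)
  have z0: "linear_interpolant n z 0 = 0" using linear_interpolant_grid[where i = 0 and n = n and z = z] n z by simp
  have "Phi m \<theta> (linear_interpolant n z) \<le> a" if m: "m > 0" for m \<theta>
  proof -
    \<comment> \<open>Length of the overlap of cell \<open>i\<close> of grid \<open>m\<close> with
      cell \<open>j\<close> of grid \<open>n\<close>. The rows sum to \<open>1 / m\<close> and the
      columns to \<open>1 / n\<close>, so \<open>Phi m \<theta>\<close> is a weighted sum over pairs
      of cells.\<close>
    define l where "l i j = ramp n j (real (Suc i) / real m) - ramp n j (real i / real m)" for i j
    have l0: "0 \<le> l i j" for i j unfolding l_def using ramp_mono[of "real i / real m" "real (Suc i) / real m" n j] by (simp add: divide_right_mono)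
    have row: "(\<Sum>j<n. l i j) = 1 / real m" if "i < m" for i
    proof -
      have "real (Suc i) / real m \<le> 1" "real i / real m \<le> 1" using that by auto
      then show ?thesis
        unfolding l_def sum_subtractf using n sum_ramp[OF n, of "real (Suc i) / real m" n] sum_ramp[OF n, of "real i / real m" n]
        by (simp add: diff_divide_distrib[symmetric])
    qed
    have col: "(\<Sum>i<m. l i j) = 1 / real n" if "j < n" for j
    proof -
      have "(\<Sum>i<m. l i j) = ramp n j (real m / real m) - ramp n j (real 0 / real m)"
        unfolding l_def by (rule sum_lessThan_telescope)
      moreover have e: "real m / real m = real n / real n" "real 0 / real m = real 0 / real n" using m n by auto
      ultimately show ?thesis unfolding e ramp_grid[OF n] using that by simp
    qed
    have ex: "\<exists>i<m. \<forall>k<m. h k \<le> h i" for h :: "nat \<Rightarrow> real"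
    proof -
      have "Max (h ` {..<m}) \<in> h ` {..<m}" using m by (intro Max_in) auto
      then obtain i where "i < m" "h i = Max (h ` {..<m})" by auto
      then show ?thesis by (intro exI[of _ i]) auto
    qed
    \<comment> \<open>In each column \<open>j\<close> the maximum over the finitely many
      \<open>\<theta> k\<close> yields a dual vector on grid \<open>n\<close>.\<close>
    have "\<exists>\<theta>'. \<forall>j. \<forall>k<m. \<theta> k * w j - Lam (\<theta> k) \<le> \<theta>' j * w j - Lam (\<theta>' j)"
    proof (intro choice allI)
      fix j show "\<exists>y. \<forall>k<m. \<theta> k * w j - Lam (\<theta> k) \<le> y * w j - Lam y"
        using ex[of "\<lambda>k. \<theta> k * w j - Lam (\<theta> k)"] by blast
    qed
    then obtain \<theta>' where \<theta>': "\<And>j k. k < m \<Longrightarrow> \<theta> k * w j - Lam (\<theta> k) \<le> \<theta>' j * w j - Lam (\<theta>' j)" by blast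
    have inc: "linear_interpolant n z (real (Suc i) / real m) - linear_interpolant n z (real i / real m) = (\<Sum>j<n. w j * l i j)"
      if "i < m" for i
    proof -
      have "real (Suc i) / real m \<in> {0..1}" "real i / real m \<in> {0..1}" using that by auto
      then show ?thesis
        unfolding linear_interpolant_def l_def w_def by (simp add: sum_subtractf right_diff_distrib)
    qed
    have "Phi m \<theta> (linear_interpolant n z) = (\<Sum>i<m. \<Sum>j<n. l i j * (\<theta> i * w j - Lam (\<theta> i)))"
      unfolding Phi_def
    proof (intro sum.cong refl)
      fix i assume i: "i \<in> {..<m}"
      have "Lam (\<theta> i) / real m = Lam (\<theta> i) * (\<Sum>j<n. l i j)" using row i by simp
      then show "\<theta> i * (linear_interpolant n z (real (Suc i) / real m) - linear_interpolant n z (real i / real m)) - Lam (\<theta> i) / real m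
        = (\<Sum>j<n. l i j * (\<theta> i * w j - Lam (\<theta> i)))"
        using inc i by (simp add: sum_distrib_left sum_subtractf[symmetric] algebra_simps)
    qed
    also have "\<dots> \<le> (\<Sum>i<m. \<Sum>j<n. l i j * (\<theta>' j * w j - Lam (\<theta>' j)))"
      by (intro sum_mono mult_left_mono \<theta>' l0) auto
    also have "\<dots> = (\<Sum>j<n. \<Sum>i<m. l i j * (\<theta>' j * w j - Lam (\<theta>' j)))" by (rule sum.swap)
    also have "\<dots> = (\<Sum>j<n. (1 / real n) * (\<theta>' j * w j - Lam (\<theta>' j)))"
      by (intro sum.cong refl) (simp add: sum_distrib_right[symmetric] col)
    also have "\<dots> = (\<Sum>j<n. \<theta>' j * (z (Suc j) - z j) - Lam (\<theta>' j) / real n)"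
      using n by (intro sum.cong refl) (simp add: w_def field_simps)
    also have "\<dots> \<le> a" by (rule le)
    finally show ?thesis .
  qed
  with cad z0 show ?thesis by (simp add: level_def)
qed

end

section \<open>The generating functional of the marked Poisson process\<close>

lemma space_config_space [simp]: "space config_space = UNIV"
  by (simp add: config_space_def)

lemma size_measurable_config [measurable]: "size \<in> config_space \<rightarrow>\<^sub>M count_space UNIV"
  unfolding measurable_count_space_eq_countable[OF countableI_type]
proof (intro conjI ballI)
  fix k :: nat
  have "size -` {k} \<inter> space config_space = {m :: real multiset. size {#y \<in># m. y \<in> UNIV#} = k}" by auto
  also have "\<dots> \<in> sets config_space"
    unfolding config_space_def
    by (subst sets_measure_of, simp, rule sigma_sets.Basic, rule CollectI, rule exI[of _ UNIV], rule exI[of _ k], simp)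
  finally show "size -` {k} \<inter> space config_space \<in> sets config_space" .
qed auto

lemma point_count_eq_card:
  assumes "finite {i. x i \<in> A}"
  shows "point_count x A = of_nat (card {i. x i \<in> A})"
proof -
  have "point_count x A = (\<Sum>i\<in>{i. x i \<in> A}. indicator A (x i))"
    unfolding point_count_def by (rule suminf_finite[OF assms]) auto
  then show ?thesis by simp
qed

lemma finite_if_point_count_finite:
  assumes "point_count x A \<noteq> \<infinity>"
  shows "finite {i. x i \<in> A}"
proof (rule ccontr)
  assume inf: "infinite {i. x i \<in> A}"
  have "of_nat n \<le> point_count x A" for n
  proof -
    obtain F where F: "finite F" "card F = n" "F \<subseteq> {i. x i \<in> A}"
      using infinite_arbitrarily_large[OF inf] by blast
    have "of_nat n = (\<Sum>i\<in>F. indicator A (x i) :: ennreal)" using F by (simp add: subset_eq)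
    also have "\<dots> \<le> point_count x A" unfolding point_count_def by (rule sum_le_suminf) (use F in auto)
    finally show ?thesis .
  qed
  moreover obtain n where "point_count x A < of_nat n"
    using assms by (metis ennreal_Ex_less_of_nat infinity_ennreal_def less_top)
  ultimately show False by (meson leD)
qed

text \<open>The product runs over a random index set. Truncating to the indices below
  \<open>n\<close>, on the event that no later point falls in the regions, gives products over fixed
  finite index sets that increase to it, so independence and monotone convergence can be
  applied.\<close>

lemma SUP_truncated_prod:
  fixes v :: "nat \<Rightarrow> nat \<Rightarrow> ennreal" and A :: "nat \<Rightarrow> 'b set"
  assumes fin: "finite {i. x i \<in> (\<Union>j<k. A j)}"
  shows "(SUP n. indicator {y. \<forall>i\<ge>n. y i \<notin> (\<Union>j<k. A j)} x * (\<Prod>i<n. \<Prod>j<k. if x i \<in> A j then v j i else 1))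
    = (\<Prod>j<k. \<Prod>i\<in>{i. x i \<in> A j}. v j i)" (is "(SUP n. ?I n * ?P n) = ?W")
proof -
  have eq: "?I n * ?P n = (if \<forall>i\<ge>n. x i \<notin> (\<Union>j<k. A j) then ?W else 0)" for n
  proof (cases "\<forall>i\<ge>n. x i \<notin> (\<Union>j<k. A j)")
    case True
    have "?P n = (\<Prod>j<k. \<Prod>i<n. if x i \<in> A j then v j i else 1)" by (rule prod.swap)
    also have "\<dots> = ?W"
    proof (rule prod.cong[OF refl])
      fix j assume j: "j \<in> {..<k}"
      have "(\<Prod>i<n. if x i \<in> A j then v j i else 1) = (\<Prod>i\<in>{i \<in> {..<n}. x i \<in> A j}. v j i)"
        by (rule prod.inter_filter[symmetric]) simp
      also have "{i \<in> {..<n}. x i \<in> A j} = {i. x i \<in> A j}" using True j by (auto simp: not_le[symmetric])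
      finally show "(\<Prod>i<n. if x i \<in> A j then v j i else 1) = (\<Prod>i\<in>{i. x i \<in> A j}. v j i)" .
    qed
    finally show ?thesis using True by (simp add: indicator_def)
  next
    case False
    then have "?I n = 0" by (simp add: indicator_def)
    with False show ?thesis by (simp only: mult_zero_left if_False)
  qed
  obtain N where "\<forall>i\<in>{i. x i \<in> (\<Union>j<k. A j)}. i < N"
    using fin finite_nat_set_iff_bounded by blast
  then have N: "\<forall>i\<ge>N. x i \<notin> (\<Union>j<k. A j)" by (auto simp: not_le[symmetric])
  have "(SUP n. ?I n * ?P n) = (SUP n. if \<forall>i\<ge>n. x i \<notin> (\<Union>j<k. A j) then ?W else 0)"
    by (rule SUP_cong[OF refl eq])
  also have "\<dots> = ?W"
  proof (rule antisym)
    show "(SUP n. if \<forall>i\<ge>n. x i \<notin> (\<Union>j<k. A j) then ?W else 0) \<le> ?W" by (intro SUP_least) auto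
    show "?W \<le> (SUP n. if \<forall>i\<ge>n. x i \<notin> (\<Union>j<k. A j) then ?W else 0)"
      by (rule SUP_upper2[of N]) (use N in auto)
  qed
  finally show ?thesis .
qed

lemma incseq_truncated_prod:
  fixes v :: "nat \<Rightarrow> nat \<Rightarrow> ennreal" and A :: "nat \<Rightarrow> 'b set"
  shows "incseq (\<lambda>n. indicator {y. \<forall>i\<ge>n. y i \<notin> (\<Union>j<k. A j)} x * (\<Prod>i<n. \<Prod>j<k. if x i \<in> A j then v j i else 1))"
proof (rule incseq_SucI)
  fix n
  show "indicator {y. \<forall>i\<ge>n. y i \<notin> (\<Union>j<k. A j)} x * (\<Prod>i<n. \<Prod>j<k. if x i \<in> A j then v j i else 1)
    \<le> indicator {y. \<forall>i\<ge>Suc n. y i \<notin> (\<Union>j<k. A j)} x * (\<Prod>i<Suc n. \<Prod>j<k. if x i \<in> A j then v j i else 1)"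
  proof (cases "\<forall>i\<ge>n. x i \<notin> (\<Union>j<k. A j)")
    case True
    then have "(\<Prod>j<k. if x n \<in> A j then v j n else 1) = 1" by (intro prod.neutral) auto
    with True show ?thesis by (simp add: indicator_def)
  qed (simp add: indicator_def)
qed

section \<open>The law of the immigrants with their clusters as marks\<close>

context poisson_cluster_process begin

lemma X_measurable [measurable]: "X i \<in> borel_measurable M"
  by (rule random_points)

lemma C_measurable [measurable]: "C i \<in> M \<rightarrow>\<^sub>M config_space"
  using clusters_indep by (simp add: indep_vars_def)

lemma sets_Q [measurable_cong, simp]: "sets Q = sets config_space"
  unfolding clusters_law[of 0, symmetric] by (rule sets_distr)

lemma space_Q [simp]: "space Q = UNIV"
  using sets_eq_imp_space_eq[OF sets_Q] by simp

lemma prob_space_Q: "prob_space Q"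
  using prob_space_distr[OF C_measurable[of 0]] clusters_law[of 0] by simp

lemma nn_integral_Q:
  "f \<in> borel_measurable config_space \<Longrightarrow> (\<integral>\<^sup>+m. f m \<partial>Q) = (\<integral>\<^sup>+\<omega>. f (C i \<omega>) \<partial>M)"
  unfolding clusters_law[of i, symmetric] by (rule nn_integral_distr[OF C_measurable]) simp

lemma point_count_measurable [measurable]:
  assumes [measurable]: "A \<in> sets borel"
  shows "(\<lambda>\<omega>. point_count (\<lambda>i. X i \<omega>) A) \<in> borel_measurable M"
  unfolding point_count_def by measurable

lemma poisson_sums:
  assumes "0 < measure lborel A"
  shows "(\<lambda>k. pmf (poisson_pmf (\<nu> * measure lborel A)) k * c ^ k) sums exp (\<nu> * measure lborel A * (c - 1))"
proof -
  let ?r = "\<nu> * measure lborel A"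
  have r: "0 < ?r" using intensity_pos assms by simp
  have "(\<lambda>k. (?r * c) ^ k /\<^sub>R fact k) sums exp (?r * c)" by (rule exp_converges)
  then have "(\<lambda>k. exp (- ?r) * ((?r * c) ^ k /\<^sub>R fact k)) sums (exp (- ?r) * exp (?r * c))" by (rule sums_mult)
  moreover have "exp (- ?r) * ((?r * c) ^ k /\<^sub>R fact k) = pmf (poisson_pmf ?r) k * c ^ k" for k
    using r by (simp add: pmf_poisson power_mult_distrib divide_inverse mult_ac)
  moreover have "exp (- ?r) * exp (?r * c) = exp (?r * (c - 1))" by (simp add: exp_add[symmetric] algebra_simps)
  ultimately show ?thesis by simp
qed

text \<open>The Poisson weights sum to 1, so the count is almost surely a natural number rather than
  infinite.\<close>

lemma AE_finite_points:
  assumes "A \<in> sets borel" "bounded A"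
  shows "AE \<omega> in M. finite {i. X i \<omega> \<in> A}"
proof -
  \<comment> \<open>Adjoining an interval makes the Poisson parameter positive, as
    \<open>poisson_sums\<close> requires, also for null sets \<open>A\<close>.\<close>
  define A' where "A' = A \<union> {0..1}"
  have A: "A' \<in> sets borel" "bounded A'" using assms by (auto simp: A'_def)
  have pos: "0 < measure lborel A'"
  proof -
    have "measure lborel {0..1::real} \<le> measure lborel A'"
      unfolding A'_def using assms bounded_Un[of A "{0..1}"]
      by (intro measure_mono_fmeasurable) (auto intro!: fmeasurableI emeasure_bounded_finite)
    then show ?thesis by simp
  qed
  note [measurable] = A(1)
  let ?E = "\<lambda>k. {\<omega> \<in> space M. point_count (\<lambda>i. X i \<omega>) A' = of_nat k}"
  have [measurable]: "?E k \<in> sets M" for k by measurable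
  have "(\<lambda>k. prob (?E k)) sums prob (\<Union>k. ?E k)"
    by (rule finite_measure_UNION) (auto simp: disjoint_family_on_def)
  moreover have "(\<lambda>k. prob (?E k)) sums 1"
    using poisson_sums[OF pos, of 1] count_poisson[OF A] by simp
  ultimately have "prob (\<Union>k. ?E k) = 1" by (rule sums_unique2)
  then have "AE \<omega> in M. \<omega> \<in> (\<Union>k. ?E k)" by (subst (asm) prob_eq_1) auto
  then show ?thesis
  proof eventually_elim
    case (elim \<omega>)
    then have "finite {i. X i \<omega> \<in> A'}" by (intro finite_if_point_count_finite) auto
    then show ?case by (rule finite_subset[rotated]) (auto simp: A'_def)
  qed
qed

text \<open>The generating function of a Poisson variable. The expression with \<open>nat\<close>
  and the floor is a measurable way to read the almost surely finite count as a natural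
  number.\<close>

lemma nn_integral_power_points:
  assumes A: "A \<in> sets borel" "bounded A" and pos: "0 < measure lborel A" and c: "0 \<le> c"
  shows "(\<integral>\<^sup>+\<omega>. ennreal c ^ nat \<lfloor>enn2real (point_count (\<lambda>i. X i \<omega>) A)\<rfloor> \<partial>M)
    = ennreal (exp (\<nu> * measure lborel A * (c - 1)))"
proof -
  note [measurable] = A(1)
  let ?N = "\<lambda>\<omega>. point_count (\<lambda>i. X i \<omega>) A"
  let ?E = "\<lambda>k. {\<omega> \<in> space M. ?N \<omega> = of_nat k}"
  have "(\<integral>\<^sup>+\<omega>. ennreal c ^ nat \<lfloor>enn2real (?N \<omega>)\<rfloor> \<partial>M) = (\<integral>\<^sup>+\<omega>. (\<Sum>k. ennreal (c ^ k) * indicator (?E k) \<omega>) \<partial>M)"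
  proof (rule nn_integral_cong_AE)
    show "AE \<omega> in M. ennreal c ^ nat \<lfloor>enn2real (?N \<omega>)\<rfloor> = (\<Sum>k. ennreal (c ^ k) * indicator (?E k) \<omega>)"
      using AE_finite_points[OF A] AE_space
    proof eventually_elim
      case (elim \<omega>)
      let ?n = "card {i. X i \<omega> \<in> A}"
      have N: "?N \<omega> = of_nat ?n" by (rule point_count_eq_card) (rule elim(1))
      have "(\<Sum>k. ennreal (c ^ k) * indicator (?E k) \<omega>) = (\<Sum>k\<in>{?n}. ennreal (c ^ k) * indicator (?E k) \<omega>)"
        by (rule suminf_finite) (use N elim in \<open>auto simp: indicator_def\<close>)
      then show ?case using N elim c by (simp add: ennreal_power enn2real_of_nat)
    qed
  qed
  also have "\<dots> = (\<Sum>k. \<integral>\<^sup>+\<omega>. ennreal (c ^ k) * indicator (?E k) \<omega> \<partial>M)"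
    by (rule nn_integral_suminf) measurable
  also have "\<dots> = (\<Sum>k. ennreal (pmf (poisson_pmf (\<nu> * measure lborel A)) k * c ^ k))"
  proof (intro suminf_cong)
    fix k
    have "(\<integral>\<^sup>+\<omega>. ennreal (c ^ k) * indicator (?E k) \<omega> \<partial>M) = ennreal (c ^ k) * emeasure M (?E k)"
      by (rule nn_integral_cmult_indicator) measurable
    also have "emeasure M (?E k) = ennreal (pmf (poisson_pmf (\<nu> * measure lborel A)) k)"
      by (simp add: emeasure_eq_measure count_poisson[OF A])
    finally show "(\<integral>\<^sup>+\<omega>. ennreal (c ^ k) * indicator (?E k) \<omega> \<partial>M) = ennreal (pmf (poisson_pmf (\<nu> * measure lborel A)) k * c ^ k)"
      using c by (simp add: ennreal_mult[symmetric] mult.commute)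
  qed
  also have "\<dots> = ennreal (exp (\<nu> * measure lborel A * (c - 1)))"
    by (rule suminf_ennreal_eq[OF _ poisson_sums[OF pos]]) (use c in simp)
  finally show ?thesis .
qed

lemma nn_integral_prod_power_points:
  fixes k :: nat
  assumes A: "\<And>j. j < k \<Longrightarrow> A j \<in> sets borel \<and> bounded (A j)"
    and pos: "\<And>j. j < k \<Longrightarrow> 0 < measure lborel (A j)" and dis: "disjoint_family_on A {..<k}"
    and c: "\<And>j. j < k \<Longrightarrow> 0 \<le> c j"
  shows "(\<integral>\<^sup>+\<omega>. (\<Prod>j<k. ennreal (c j) ^ nat \<lfloor>enn2real (point_count (\<lambda>i. X i \<omega>) (A j))\<rfloor>) \<partial>M)
    = ennreal (exp (\<Sum>j<k. \<nu> * measure lborel (A j) * (c j - 1)))"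
proof -
  have "indep_vars (\<lambda>_. borel) (\<lambda>j \<omega>. point_count (\<lambda>i. X i \<omega>) (A j)) {..<k}"
    by (rule count_indep) (use A dis in auto)
  then have ind: "indep_vars (\<lambda>_. borel) (\<lambda>j \<omega>. ennreal (c j) ^ nat \<lfloor>enn2real (point_count (\<lambda>i. X i \<omega>) (A j))\<rfloor>) {..<k}"
    by (rule indep_vars_compose2[where Y = "\<lambda>j x. ennreal (c j) ^ nat \<lfloor>enn2real x\<rfloor>"]) measurable
  have "(\<integral>\<^sup>+\<omega>. (\<Prod>j<k. ennreal (c j) ^ nat \<lfloor>enn2real (point_count (\<lambda>i. X i \<omega>) (A j))\<rfloor>) \<partial>M)
    = (\<Prod>j<k. \<integral>\<^sup>+\<omega>. ennreal (c j) ^ nat \<lfloor>enn2real (point_count (\<lambda>i. X i \<omega>) (A j))\<rfloor> \<partial>M)"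
    by (rule indep_vars_nn_integral[OF _ ind]) auto
  also have "\<dots> = (\<Prod>j<k. ennreal (exp (\<nu> * measure lborel (A j) * (c j - 1))))"
    using A c pos by (intro prod.cong refl nn_integral_power_points) auto
  also have "\<dots> = ennreal (exp (\<Sum>j<k. \<nu> * measure lborel (A j) * (c j - 1)))"
    by (subst prod_ennreal) (auto simp: exp_sum)
  finally show ?thesis .
qed

text \<open>Independence of the two generated sigma-algebras is recast as a product law, the form to
  which Fubini's theorem applies.\<close>

lemma immigrants_clusters_joint_law:
  defines "S \<equiv> PiM UNIV (\<lambda>_::nat. borel :: real measure)" and "T \<equiv> PiM UNIV (\<lambda>_::nat. config_space)"
  shows "(\<lambda>\<omega> i. X i \<omega>) \<in> M \<rightarrow>\<^sub>M S" "(\<lambda>\<omega> i. C i \<omega>) \<in> M \<rightarrow>\<^sub>M T"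
    "distr M S (\<lambda>\<omega> i. X i \<omega>) \<Otimes>\<^sub>M distr M T (\<lambda>\<omega> i. C i \<omega>) = distr M (S \<Otimes>\<^sub>M T) (\<lambda>\<omega>. (\<lambda>i. X i \<omega>, \<lambda>i. C i \<omega>))"
proof -
  let ?X = "\<lambda>\<omega> i. X i \<omega>" and ?C = "\<lambda>\<omega> i. C i \<omega>"
  show rv: "?X \<in> M \<rightarrow>\<^sub>M S" "?C \<in> M \<rightarrow>\<^sub>M T" unfolding S_def T_def by (rule measurable_PiM_single'; auto)+
  note [measurable] = rv
  interpret PX: prob_space "distr M S ?X" by (rule prob_space_distr[OF rv(1)])
  interpret PC: prob_space "distr M T ?C" by (rule prob_space_distr[OF rv(2)])
  show "distr M S ?X \<Otimes>\<^sub>M distr M T ?C = distr M (S \<Otimes>\<^sub>M T) (\<lambda>\<omega>. (?X \<omega>, ?C \<omega>))"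
  proof (rule pair_measure_eqI[OF PX.sigma_finite_measure_axioms PC.sigma_finite_measure_axioms])
    show "sets (distr M S ?X \<Otimes>\<^sub>M distr M T ?C) = sets (distr M (S \<Otimes>\<^sub>M T) (\<lambda>\<omega>. (?X \<omega>, ?C \<omega>)))"
      by (simp cong: sets_pair_measure_cong)
    fix A B assume "A \<in> sets (distr M S ?X)" "B \<in> sets (distr M T ?C)"
    then have [measurable]: "A \<in> sets S" "B \<in> sets T" by simp_all
    have "prob ((?X -` A \<inter> space M) \<inter> (?C -` B \<inter> space M)) = prob (?X -` A \<inter> space M) * prob (?C -` B \<inter> space M)"
      by (rule indep_setD[OF clusters_indep_immigrants])
         (use \<open>A \<in> sets S\<close> \<open>B \<in> sets T\<close> in \<open>auto simp: S_def T_def intro!: in_vimage_algebra\<close>)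
    moreover have "(\<lambda>\<omega>. (?X \<omega>, ?C \<omega>)) -` (A \<times> B) \<inter> space M = (?X -` A \<inter> space M) \<inter> (?C -` B \<inter> space M)" by auto
    ultimately show "emeasure (distr M S ?X) A * emeasure (distr M T ?C) B = emeasure (distr M (S \<Otimes>\<^sub>M T) (\<lambda>\<omega>. (?X \<omega>, ?C \<omega>))) (A \<times> B)"
      by (simp add: emeasure_distr emeasure_eq_measure ennreal_mult[symmetric])
  qed
qed

text \<open>By Fubini the immigrants may be held fixed while the independent clusters are integrated
  one at a time. The factor \<open>\<rho>\<close> is there to carry the truncation event, which
  depends on all immigrants.\<close>

lemma nn_integral_marked_prod:
  fixes u :: "real \<Rightarrow> real multiset \<Rightarrow> ennreal"
  assumes \<rho> [measurable]: "\<rho> \<in> borel_measurable (PiM UNIV (\<lambda>_. borel))"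
    and u [measurable]: "case_prod u \<in> borel_measurable (borel \<Otimes>\<^sub>M config_space)"
  shows "(\<integral>\<^sup>+\<omega>. \<rho> (\<lambda>i. X i \<omega>) * (\<Prod>i<n. u (X i \<omega>) (C i \<omega>)) \<partial>M)
    = (\<integral>\<^sup>+\<omega>. \<rho> (\<lambda>i. X i \<omega>) * (\<Prod>i<n. \<integral>\<^sup>+m. u (X i \<omega>) m \<partial>Q) \<partial>M)"
proof -
  let ?S = "PiM UNIV (\<lambda>_::nat. borel :: real measure)" and ?T = "PiM UNIV (\<lambda>_::nat. config_space)"
  let ?X = "\<lambda>\<omega> i. X i \<omega>" and ?C = "\<lambda>\<omega> i. C i \<omega>"
  let ?F = "\<lambda>(x, c). \<rho> x * (\<Prod>i<n. u (x i) (c i))"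
  have rvX [measurable]: "?X \<in> M \<rightarrow>\<^sub>M ?S" and rvC [measurable]: "?C \<in> M \<rightarrow>\<^sub>M ?T"
    and distr: "distr M ?S ?X \<Otimes>\<^sub>M distr M ?T ?C = distr M (?S \<Otimes>\<^sub>M ?T) (\<lambda>\<omega>. (?X \<omega>, ?C \<omega>))"
    by (rule immigrants_clusters_joint_law)+
  interpret PX: prob_space "distr M ?S ?X" by (rule prob_space_distr[OF rvX])
  interpret PC: prob_space "distr M ?T ?C" by (rule prob_space_distr[OF rvC])
  have F [measurable]: "?F \<in> borel_measurable (?S \<Otimes>\<^sub>M ?T)" by measurable
  have uc: "(\<lambda>m. u x m) \<in> borel_measurable config_space" for x by measurable
  have h [measurable]: "(\<lambda>x. \<integral>\<^sup>+m. u x m \<partial>Q) \<in> borel_measurable borel"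
  proof -
    interpret Q: prob_space Q by (rule prob_space_Q)
    show ?thesis by measurable
  qed
  have "(\<integral>\<^sup>+\<omega>. \<rho> (?X \<omega>) * (\<Prod>i<n. u (X i \<omega>) (C i \<omega>)) \<partial>M) = (\<integral>\<^sup>+\<omega>. ?F (?X \<omega>, ?C \<omega>) \<partial>M)" by simp
  also have "\<dots> = (\<integral>\<^sup>+z. ?F z \<partial>distr M (?S \<Otimes>\<^sub>M ?T) (\<lambda>\<omega>. (?X \<omega>, ?C \<omega>)))"
    by (rule nn_integral_distr[symmetric]) measurable
  also have "\<dots> = (\<integral>\<^sup>+z. ?F z \<partial>(distr M ?S ?X \<Otimes>\<^sub>M distr M ?T ?C))" by (simp only: distr)
  also have "\<dots> = (\<integral>\<^sup>+x. (\<integral>\<^sup>+c. ?F (x, c) \<partial>distr M ?T ?C) \<partial>distr M ?S ?X)"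
    by (rule PC.nn_integral_fst[symmetric]) measurable
  also have "\<dots> = (\<integral>\<^sup>+x. \<rho> x * (\<Prod>i<n. \<integral>\<^sup>+m. u (x i) m \<partial>Q) \<partial>distr M ?S ?X)"
  proof (intro nn_integral_cong)
    fix x :: "nat \<Rightarrow> real"
    have "(\<integral>\<^sup>+c. ?F (x, c) \<partial>distr M ?T ?C) = \<rho> x * (\<integral>\<^sup>+c. (\<Prod>i<n. u (x i) (c i)) \<partial>distr M ?T ?C)"
      by (simp, rule nn_integral_cmult) measurable
    also have "(\<integral>\<^sup>+c. (\<Prod>i<n. u (x i) (c i)) \<partial>distr M ?T ?C) = (\<integral>\<^sup>+\<omega>. (\<Prod>i<n. u (x i) (C i \<omega>)) \<partial>M)"
      by (rule nn_integral_distr) measurable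
    also have "\<dots> = (\<Prod>i<n. \<integral>\<^sup>+\<omega>. u (x i) (C i \<omega>) \<partial>M)"
    proof (rule indep_vars_nn_integral)
      have "indep_vars (\<lambda>_. config_space) C {..<n}" by (rule indep_vars_subset[OF clusters_indep]) auto
      then show "indep_vars (\<lambda>_. borel) (\<lambda>i \<omega>. u (x i) (C i \<omega>)) {..<n}"
        by (rule indep_vars_compose2[where Y = "\<lambda>i m. u (x i) m"]) (rule uc)
    qed auto
    also have "\<dots> = (\<Prod>i<n. \<integral>\<^sup>+m. u (x i) m \<partial>Q)"
      by (intro prod.cong refl nn_integral_Q[symmetric] uc)
    finally show "(\<integral>\<^sup>+c. ?F (x, c) \<partial>distr M ?T ?C) = \<rho> x * (\<Prod>i<n. \<integral>\<^sup>+m. u (x i) m \<partial>Q)" .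
  qed
  also have "\<dots> = (\<integral>\<^sup>+\<omega>. \<rho> (?X \<omega>) * (\<Prod>i<n. \<integral>\<^sup>+m. u (X i \<omega>) m \<partial>Q) \<partial>M)"
    by (rule nn_integral_distr) measurable
  finally show ?thesis .
qed

text \<open>Given the immigrants, each point in \<open>A j\<close> contributes the mean mark
  \<open>c j\<close>. What remains is the generating function of independent Poisson counts,
  evaluated at the \<open>c j\<close>.\<close>

theorem marked_generating_functional:
  fixes A :: "nat \<Rightarrow> real set" and w :: "nat \<Rightarrow> real multiset \<Rightarrow> ennreal" and c :: "nat \<Rightarrow> real"
  assumes A: "\<And>j. j < k \<Longrightarrow> A j \<in> sets borel \<and> bounded (A j)"
    and pos: "\<And>j. j < k \<Longrightarrow> 0 < measure lborel (A j)" and dis: "disjoint_family_on A {..<k}"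
    and w: "\<And>j. j < k \<Longrightarrow> w j \<in> borel_measurable config_space"
    and c: "\<And>j. j < k \<Longrightarrow> 0 \<le> c j" "\<And>j. j < k \<Longrightarrow> (\<integral>\<^sup>+m. w j m \<partial>Q) = ennreal (c j)"
  shows "(\<integral>\<^sup>+\<omega>. (\<Prod>j<k. \<Prod>i\<in>{i. X i \<omega> \<in> A j}. w j (C i \<omega>)) \<partial>M)
    = ennreal (exp (\<Sum>j<k. \<nu> * measure lborel (A j) * (c j - 1)))"
proof -
  define B where "B = (\<Union>j<k. A j)"
  have Am: "j \<in> {..<k} \<Longrightarrow> A j \<in> sets borel" for j using A by auto
  have B: "B \<in> sets borel" "bounded B" unfolding B_def using A by (auto intro!: bounded_UN)
  note [measurable] = B(1)
  \<comment> \<open>Since the regions are disjoint, at most one factor differs from 1; this lets the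
    mean of \<open>u x\<close> be computed factor by factor.\<close>
  define u where "u x m = (\<Prod>j<k. if x \<in> A j then w j m else 1)" for x m
  have u: "case_prod u \<in> borel_measurable (borel \<Otimes>\<^sub>M config_space)"
    unfolding u_def split_beta
  proof (rule borel_measurable_prod_ennreal)
    fix j assume j: "j \<in> {..<k}"
    then have [measurable]: "A j \<in> sets borel" "w j \<in> borel_measurable config_space" using A w by auto
    show "(\<lambda>z. if fst z \<in> A j then w j (snd z) else 1) \<in> borel_measurable (borel \<Otimes>\<^sub>M config_space)"
      by measurable
  qed
  \<comment> \<open>The truncation event: no immigrant with index at least \<open>n\<close> lies in
    any of the regions.\<close>
  define \<rho> where "\<rho> n = (indicator {y. \<forall>i\<ge>n. y i \<notin> B} :: (nat \<Rightarrow> real) \<Rightarrow> ennreal)" for n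
  have \<rho> [measurable]: "\<rho> n \<in> borel_measurable (PiM UNIV (\<lambda>_. borel))" for n
  proof -
    have "{y \<in> space (PiM UNIV (\<lambda>_. borel)). \<forall>i\<ge>n. y i \<notin> B} \<in> sets (PiM UNIV (\<lambda>_::nat. borel :: real measure))"
      by measurable
    then show ?thesis unfolding \<rho>_def by (simp add: space_PiM PiE_def extensional_def)
  qed
  have h: "(\<integral>\<^sup>+m. u x m \<partial>Q) = (\<Prod>j<k. if x \<in> A j then ennreal (c j) else 1)" for x
  proof (cases "\<exists>j<k. x \<in> A j")
    case True
    then obtain j where j: "j < k" "x \<in> A j" by blast
    have un: "i = j" if "i < k" "x \<in> A i" for i
      using dis that j unfolding disjoint_family_on_def by (metis IntI emptyE lessThan_iff)
    have "(\<Prod>i<k. if x \<in> A i then v i else 1) = (\<Prod>i<k. if i = j then v j else 1)" for v :: "nat \<Rightarrow> ennreal"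
    proof (rule prod.cong[OF refl])
      fix i assume "i \<in> {..<k}"
      then have "x \<in> A i \<longleftrightarrow> i = j" using un j(2) by blast
      then show "(if x \<in> A i then v i else 1) = (if i = j then v j else 1)" by simp
    qed
    then have "(\<Prod>i<k. if x \<in> A i then v i else 1) = v j" for v :: "nat \<Rightarrow> ennreal" using j by simp
    then show ?thesis unfolding u_def using c(2)[OF j(1)] by simp
  next
    case False
    then have "(\<Prod>i<k. if x \<in> A i then v i else 1) = (1::ennreal)" for v by (intro prod.neutral) auto
    then show ?thesis unfolding u_def using prob_space.emeasure_space_1[OF prob_space_Q] by simp
  qed
  have hm: "(\<lambda>x. \<Prod>j<k. if x \<in> A j then ennreal (c j) else 1) \<in> borel_measurable borel"
    using Am by (intro borel_measurable_prod_ennreal) (auto intro!: measurable_If_set)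
  note [measurable] = u hm
  have um [measurable]: "(\<lambda>\<omega>. u (X i \<omega>) (C i \<omega>)) \<in> borel_measurable M" for i
    using measurable_compose[OF measurable_Pair[OF X_measurable C_measurable] u, of i i] by simp
  have Xm [measurable]: "(\<lambda>\<omega> i. X i \<omega>) \<in> M \<rightarrow>\<^sub>M PiM UNIV (\<lambda>_. borel)" by (rule measurable_PiM_single') auto
  have \<rho>m [measurable]: "(\<lambda>\<omega>. \<rho> n (\<lambda>i. X i \<omega>)) \<in> borel_measurable M" for n
    by (rule measurable_compose[OF Xm \<rho>])
  have hXm [measurable]: "(\<lambda>\<omega>. \<Prod>j<k. if X i \<omega> \<in> A j then ennreal (c j) else 1) \<in> borel_measurable M" for i
    by (rule measurable_compose[OF X_measurable hm])
  have "(\<integral>\<^sup>+\<omega>. (\<Prod>j<k. \<Prod>i\<in>{i. X i \<omega> \<in> A j}. w j (C i \<omega>)) \<partial>M)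
    = (\<integral>\<^sup>+\<omega>. (SUP n. \<rho> n (\<lambda>i. X i \<omega>) * (\<Prod>i<n. u (X i \<omega>) (C i \<omega>))) \<partial>M)"
  proof (rule nn_integral_cong_AE, use AE_finite_points[OF B] in eventually_elim)
    case (elim \<omega>)
    then show ?case unfolding u_def \<rho>_def B_def
      by (rule SUP_truncated_prod[where x = "\<lambda>i. X i \<omega>" and v = "\<lambda>j i. w j (C i \<omega>)", symmetric])
  qed
  also have "\<dots> = (SUP n. \<integral>\<^sup>+\<omega>. \<rho> n (\<lambda>i. X i \<omega>) * (\<Prod>i<n. u (X i \<omega>) (C i \<omega>)) \<partial>M)"
  proof (rule nn_integral_monotone_convergence_SUP)
    show "incseq (\<lambda>n \<omega>. \<rho> n (\<lambda>i. X i \<omega>) * (\<Prod>i<n. u (X i \<omega>) (C i \<omega>)))"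
      unfolding incseq_def le_fun_def
    proof (intro allI impI)
      fix m n \<omega> assume mn: "m \<le> (n::nat)"
      show "\<rho> m (\<lambda>i. X i \<omega>) * (\<Prod>i<m. u (X i \<omega>) (C i \<omega>)) \<le> \<rho> n (\<lambda>i. X i \<omega>) * (\<Prod>i<n. u (X i \<omega>) (C i \<omega>))"
        unfolding u_def \<rho>_def B_def
        by (rule incseqD[OF incseq_truncated_prod[where x = "\<lambda>i. X i \<omega>" and v = "\<lambda>j i. w j (C i \<omega>)"] mn])
    qed
  qed measurable
  also have "\<dots> = (SUP n. \<integral>\<^sup>+\<omega>. \<rho> n (\<lambda>i. X i \<omega>) * (\<Prod>i<n. \<Prod>j<k. if X i \<omega> \<in> A j then ennreal (c j) else 1) \<partial>M)"
    unfolding nn_integral_marked_prod[OF \<rho> u] h ..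
  also have "\<dots> = (\<integral>\<^sup>+\<omega>. (SUP n. \<rho> n (\<lambda>i. X i \<omega>) * (\<Prod>i<n. \<Prod>j<k. if X i \<omega> \<in> A j then ennreal (c j) else 1)) \<partial>M)"
  proof (rule nn_integral_monotone_convergence_SUP[symmetric])
    show "incseq (\<lambda>n \<omega>. \<rho> n (\<lambda>i. X i \<omega>) * (\<Prod>i<n. \<Prod>j<k. if X i \<omega> \<in> A j then ennreal (c j) else 1))"
      unfolding incseq_def le_fun_def
    proof (intro allI impI)
      fix m n \<omega> assume mn: "m \<le> (n::nat)"
      show "\<rho> m (\<lambda>i. X i \<omega>) * (\<Prod>i<m. \<Prod>j<k. if X i \<omega> \<in> A j then ennreal (c j) else 1)
        \<le> \<rho> n (\<lambda>i. X i \<omega>) * (\<Prod>i<n. \<Prod>j<k. if X i \<omega> \<in> A j then ennreal (c j) else 1)"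
        unfolding \<rho>_def B_def
        by (rule incseqD[OF incseq_truncated_prod[where x = "\<lambda>i. X i \<omega>" and v = "\<lambda>j i. ennreal (c j)"] mn])
    qed
  qed measurable
  also have "\<dots> = (\<integral>\<^sup>+\<omega>. (\<Prod>j<k. \<Prod>i\<in>{i. X i \<omega> \<in> A j}. ennreal (c j)) \<partial>M)"
  proof (rule nn_integral_cong_AE, use AE_finite_points[OF B] in eventually_elim)
    case (elim \<omega>)
    then show ?case unfolding \<rho>_def B_def
      by (rule SUP_truncated_prod[where x = "\<lambda>i. X i \<omega>" and v = "\<lambda>j i. ennreal (c j)"])
  qed
  also have "\<dots> = (\<integral>\<^sup>+\<omega>. (\<Prod>j<k. ennreal (c j) ^ nat \<lfloor>enn2real (point_count (\<lambda>i. X i \<omega>) (A j))\<rfloor>) \<partial>M)"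
  proof (rule nn_integral_cong_AE, use AE_finite_points[OF B] in eventually_elim, rule prod.cong[OF refl])
    fix \<omega> j assume fin: "finite {i. X i \<omega> \<in> B}" and j: "j \<in> {..<k}"
    have "finite {i. X i \<omega> \<in> A j}" by (rule finite_subset[OF _ fin]) (use j in \<open>auto simp: B_def\<close>)
    then show "(\<Prod>i\<in>{i. X i \<omega> \<in> A j}. ennreal (c j)) = ennreal (c j) ^ nat \<lfloor>enn2real (point_count (\<lambda>i. X i \<omega>) (A j))\<rfloor>"
      by (simp add: point_count_eq_card enn2real_of_nat)
  qed
  also have "\<dots> = ennreal (exp (\<Sum>j<k. \<nu> * measure lborel (A j) * (c j - 1)))"
    by (rule nn_integral_prod_power_points[OF A pos dis c(1)])
  finally show ?thesis .
qed

end

section \<open>Clusters crossing a point\<close>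

context poisson_cluster_process begin

definition marked_sum :: "(real multiset \<Rightarrow> real) \<Rightarrow> real set \<Rightarrow> 'w \<Rightarrow> ennreal" where
  "marked_sum s A \<omega> = (\<Sum>i. ennreal (s (C i \<omega>)) * indicator A (X i \<omega>))"

lemma marked_sum_measurable [measurable]:
  assumes [measurable]: "s \<in> borel_measurable config_space" "A \<in> sets borel"
  shows "marked_sum s A \<in> borel_measurable M"
  unfolding marked_sum_def by measurable

lemma marked_sum_eq:
  assumes "finite {i. X i \<omega> \<in> A}" "\<And>m. 0 \<le> s m"
  shows "marked_sum s A \<omega> = ennreal (\<Sum>i\<in>{i. X i \<omega> \<in> A}. s (C i \<omega>))"
proof -
  have "marked_sum s A \<omega> = (\<Sum>i\<in>{i. X i \<omega> \<in> A}. ennreal (s (C i \<omega>)) * indicator A (X i \<omega>))"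
    unfolding marked_sum_def by (rule suminf_finite[OF assms(1)]) auto
  also have "\<dots> = (\<Sum>i\<in>{i. X i \<omega> \<in> A}. ennreal (s (C i \<omega>)))" by (intro sum.cong) auto
  also have "\<dots> = ennreal (\<Sum>i\<in>{i. X i \<omega> \<in> A}. s (C i \<omega>))" by (rule sum_ennreal) (rule assms(2))
  finally show ?thesis .
qed

text \<open>The marks \<open>exp (\<theta> j * s j m)\<close> in the generating functional give the
  joint exponential moment of independent compound Poisson variables.\<close>

lemma marked_sum_exp_moment:
  fixes k :: nat and A :: "nat \<Rightarrow> real set" and s :: "nat \<Rightarrow> real multiset \<Rightarrow> real"
  assumes A: "\<And>j. j < k \<Longrightarrow> A j \<in> sets borel \<and> bounded (A j)"
    and pos: "\<And>j. j < k \<Longrightarrow> 0 < measure lborel (A j)" and dis: "disjoint_family_on A {..<k}"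
    and s: "\<And>j. s j \<in> borel_measurable config_space" and s0: "\<And>j m. 0 \<le> s j m"
    and int: "\<And>j. j < k \<Longrightarrow> integrable Q (\<lambda>m. exp (\<theta> j * s j m))"
  shows "(\<integral>\<^sup>+\<omega>. ennreal (exp (\<Sum>j<k. \<theta> j * enn2real (marked_sum (s j) (A j) \<omega>))) \<partial>M)
    = ennreal (exp (\<Sum>j<k. \<nu> * measure lborel (A j) * ((\<integral>m. exp (\<theta> j * s j m) \<partial>Q) - 1)))"
proof -
  define B where "B = (\<Union>j<k. A j)"
  have B: "B \<in> sets borel" "bounded B" unfolding B_def using A by (auto intro!: bounded_UN)
  note [measurable] = s
  have "(\<integral>\<^sup>+\<omega>. ennreal (exp (\<Sum>j<k. \<theta> j * enn2real (marked_sum (s j) (A j) \<omega>))) \<partial>M)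
    = (\<integral>\<^sup>+\<omega>. (\<Prod>j<k. \<Prod>i\<in>{i. X i \<omega> \<in> A j}. ennreal (exp (\<theta> j * s j (C i \<omega>)))) \<partial>M)"
  proof (rule nn_integral_cong_AE, use AE_finite_points[OF B] in eventually_elim)
    case (elim \<omega>)
    have fin: "finite {i. X i \<omega> \<in> A j}" if "j < k" for j
      by (rule finite_subset[OF _ elim]) (use that in \<open>auto simp: B_def\<close>)
    have "ennreal (exp (\<Sum>j<k. \<theta> j * enn2real (marked_sum (s j) (A j) \<omega>)))
      = ennreal (\<Prod>j<k. exp (\<theta> j * enn2real (marked_sum (s j) (A j) \<omega>)))" by (simp add: exp_sum)
    also have "\<dots> = (\<Prod>j<k. ennreal (exp (\<theta> j * enn2real (marked_sum (s j) (A j) \<omega>))))" by (simp add: prod_ennreal)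
    also have "\<dots> = (\<Prod>j<k. \<Prod>i\<in>{i. X i \<omega> \<in> A j}. ennreal (exp (\<theta> j * s j (C i \<omega>))))"
    proof (rule prod.cong[OF refl])
      fix j assume j: "j \<in> {..<k}"
      then have fj: "finite {i. X i \<omega> \<in> A j}" using fin by simp
      have "enn2real (marked_sum (s j) (A j) \<omega>) = (\<Sum>i\<in>{i. X i \<omega> \<in> A j}. s j (C i \<omega>))"
        using marked_sum_eq[OF fj, of "s j"] s0 by (simp add: sum_nonneg)
      then have "exp (\<theta> j * enn2real (marked_sum (s j) (A j) \<omega>)) = (\<Prod>i\<in>{i. X i \<omega> \<in> A j}. exp (\<theta> j * s j (C i \<omega>)))"
        by (simp add: sum_distrib_left exp_sum[OF fj])
      then show "ennreal (exp (\<theta> j * enn2real (marked_sum (s j) (A j) \<omega>))) = (\<Prod>i\<in>{i. X i \<omega> \<in> A j}. ennreal (exp (\<theta> j * s j (C i \<omega>))))"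
        by (simp add: prod_ennreal)
    qed
    finally show ?case .
  qed
  also have "\<dots> = ennreal (exp (\<Sum>j<k. \<nu> * measure lborel (A j) * ((\<integral>m. exp (\<theta> j * s j m) \<partial>Q) - 1)))"
  proof (rule marked_generating_functional[OF A pos dis])
    fix j assume j: "j < k"
    show "(\<lambda>m. ennreal (exp (\<theta> j * s j m))) \<in> borel_measurable config_space" by measurable
    show "0 \<le> (\<integral>m. exp (\<theta> j * s j m) \<partial>Q)" by simp
    show "(\<integral>\<^sup>+m. ennreal (exp (\<theta> j * s j m)) \<partial>Q) = ennreal (\<integral>m. exp (\<theta> j * s j m) \<partial>Q)"
      by (rule nn_integral_eq_integral[OF int[OF j]]) simp
  qed
  finally show ?thesis .
qed

end

locale exponential_cluster_process = poisson_cluster_process M \<nu> X C Q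
  for M :: "'w measure" and \<nu> :: real and X :: "nat \<Rightarrow> 'w \<Rightarrow> real"
    and C :: "nat \<Rightarrow> 'w \<Rightarrow> real multiset" and Q :: "real multiset measure" +
  assumes size_exp: "\<And>\<theta>::real. integrable Q (\<lambda>m. exp (\<theta> * real (size m)))"
    and radius_exp: "\<And>\<theta>::real. integrable Q (\<lambda>m. cluster_radius m * exp (\<theta> * real (size m)))"
begin

text \<open>Measurability is read off from the moment hypothesis at \<open>\<theta> = 0\<close>,
  since integrable functions are measurable.\<close>

lemma cluster_radius_measurable [measurable]: "cluster_radius \<in> borel_measurable config_space"
  using borel_measurable_integrable[OF radius_exp[of 0]] by (simp cong: measurable_cong_sets)

lemma radius_ge: "y \<in># m \<Longrightarrow> \<bar>y\<bar> \<le> cluster_radius m"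
  unfolding cluster_radius_def by (rule cSUP_upper) auto

lemma AE_cluster: "AE m in Q. 0 \<le> cluster_radius m \<and> 1 \<le> size m"
  using immigrant_in_cluster
proof eventually_elim
  case (elim m)
  with radius_ge[OF elim] show ?case by (cases m) auto
qed

definition crossing :: "real \<Rightarrow> 'w \<Rightarrow> ennreal" where
  "crossing c \<omega> = (\<Sum>i. if \<bar>X i \<omega> - c\<bar> \<le> cluster_radius (C i \<omega>) then of_nat (size (C i \<omega>)) else 0)"

lemma crossing_measurable [measurable]: "crossing c \<in> borel_measurable M"
  unfolding crossing_def by measurable

text \<open>Bounds the logarithm of the exponential moment of \<open>crossing c\<close>. A unit
  shell about \<open>c\<close> has length 2, and a cluster of radius \<open>L\<close> can reach
  \<open>c\<close> from at most \<open>L + 1\<close> shells.\<close>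

definition crossing_bound :: "real \<Rightarrow> real" where
  "crossing_bound \<theta> = 2 * \<nu> * (\<integral>m. (cluster_radius m + 1) * exp (\<theta> * real (size m)) \<partial>Q)"

text \<open>Summing over the shells inside the expectation, only those \<open>k\<close> with
  \<open>k \<le> L\<close> contribute, and there are at most \<open>L + 1\<close> of them. This is
  where the joint moment of radius and size is used.\<close>

lemma crossing_exp_bound:
  fixes K :: nat
  assumes \<theta>: "\<theta> \<ge> 0"
  defines "s \<equiv> \<lambda>(k::nat) m. if real k \<le> cluster_radius m then real (size m) else 0"
  shows "integrable Q (\<lambda>m. exp (\<theta> * s k m))"
    and "(\<Sum>k<K. 2 * \<nu> * ((\<integral>m. exp (\<theta> * s k m) \<partial>Q) - 1)) \<le> crossing_bound \<theta>"
proof -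
  interpret Q: prob_space Q by (rule prob_space_Q)
  have int: "integrable Q (\<lambda>m. exp (\<theta> * s k m))" for k
  proof (rule Bochner_Integration.integrable_bound[OF size_exp[of \<theta>]])
    show "(\<lambda>m. exp (\<theta> * s k m)) \<in> borel_measurable Q" unfolding s_def by measurable
  qed (use \<theta> in \<open>auto simp: s_def\<close>)
  then show "integrable Q (\<lambda>m. exp (\<theta> * s k m))" .
  have intL: "integrable Q (\<lambda>m. (cluster_radius m + 1) * exp (\<theta> * real (size m)))"
    using radius_exp[of \<theta>] size_exp[of \<theta>] by (simp add: distrib_right)
  have "(\<Sum>k<K. (\<integral>m. exp (\<theta> * s k m) \<partial>Q) - 1) = (\<Sum>k<K. \<integral>m. exp (\<theta> * s k m) - 1 \<partial>Q)"
    using int Q.prob_space by simp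
  also have "\<dots> = (\<integral>m. (\<Sum>k<K. exp (\<theta> * s k m) - 1) \<partial>Q)"
    using int by (intro Bochner_Integration.integral_sum[symmetric]) simp
  also have "\<dots> \<le> (\<integral>m. (cluster_radius m + 1) * exp (\<theta> * real (size m)) \<partial>Q)"
  proof (rule integral_mono_AE[OF _ intL])
    show "integrable Q (\<lambda>m. \<Sum>k<K. exp (\<theta> * s k m) - 1)" using int by simp
    show "AE m in Q. (\<Sum>k<K. exp (\<theta> * s k m) - 1) \<le> (cluster_radius m + 1) * exp (\<theta> * real (size m))"
      using AE_cluster
    proof eventually_elim
      case (elim m)
      have "(\<Sum>k<K. exp (\<theta> * s k m) - 1) = (\<Sum>k<K. if real k \<le> cluster_radius m then exp (\<theta> * real (size m)) - 1 else 0)"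
        by (intro sum.cong) (auto simp: s_def)
      also have "\<dots> = (\<Sum>k\<in>{k \<in> {..<K}. real k \<le> cluster_radius m}. exp (\<theta> * real (size m)) - 1)"
        by (rule sum.inter_filter[symmetric]) simp
      also have "\<dots> = real (card {k \<in> {..<K}. real k \<le> cluster_radius m}) * (exp (\<theta> * real (size m)) - 1)" by simp
      also have "\<dots> \<le> (cluster_radius m + 1) * exp (\<theta> * real (size m))"
      proof (rule mult_mono)
        have "card {k \<in> {..<K}. real k \<le> cluster_radius m} \<le> card {..nat \<lfloor>cluster_radius m\<rfloor>}"
          by (intro card_mono) (auto simp: le_nat_floor)
        also have "\<dots> = Suc (nat \<lfloor>cluster_radius m\<rfloor>)" by simp
        finally show "real (card {k \<in> {..<K}. real k \<le> cluster_radius m}) \<le> cluster_radius m + 1"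
          using elim by linarith
      qed (use \<theta> elim in auto)
      finally show ?case .
    qed
  qed
  finally have "2 * \<nu> * (\<Sum>k<K. (\<integral>m. exp (\<theta> * s k m) \<partial>Q) - 1) \<le> crossing_bound \<theta>"
    unfolding crossing_bound_def using intensity_pos by (intro mult_left_mono) auto
  then show "(\<Sum>k<K. 2 * \<nu> * ((\<integral>m. exp (\<theta> * s k m) \<partial>Q) - 1)) \<le> crossing_bound \<theta>"
    by (simp add: sum_distrib_left)
qed

text \<open>Chernoff's inequality for the sum over unit shells about \<open>c\<close>, on which the
  cluster sizes form independent compound Poisson variables. The bound depends neither on
  \<open>c\<close> nor on the number of shells, so it survives the passage to the whole
  line.\<close>

lemma crossing_tail:
  assumes \<theta>: "\<theta> \<ge> 0" and r: "r \<ge> 0"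
  shows "emeasure M {\<omega> \<in> space M. ennreal r < crossing c \<omega>} \<le> ennreal (exp (crossing_bound \<theta> - \<theta> * r))"
proof -
  \<comment> \<open>Only immigrants within distance \<open>K\<close> of \<open>c\<close>: the
    exponential moment formula concerns finitely many bounded regions.\<close>
  define F where "F K \<omega> = (\<Sum>i. if \<bar>X i \<omega> - c\<bar> \<le> cluster_radius (C i \<omega>) \<and> \<bar>X i \<omega> - c\<bar> < real K
    then of_nat (size (C i \<omega>)) else 0 :: ennreal)" for K :: nat and \<omega>
  have [measurable]: "F K \<in> borel_measurable M" for K unfolding F_def by measurable
  have inc: "incseq (\<lambda>K. F K \<omega>)" for \<omega>
    unfolding F_def by (intro incseq_SucI suminf_le) auto
  have SUP: "crossing c \<omega> = (SUP K. F K \<omega>)" for \<omega>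
  proof -
    let ?f = "\<lambda>K i. if \<bar>X i \<omega> - c\<bar> \<le> cluster_radius (C i \<omega>) \<and> \<bar>X i \<omega> - c\<bar> < real K
      then of_nat (size (C i \<omega>)) else 0 :: ennreal"
    have "(SUP K. F K \<omega>) = (\<Sum>i. SUP K. ?f K i)"
      unfolding F_def by (rule ennreal_suminf_SUP_eq[symmetric]) (auto simp: incseq_def)
    also have "\<dots> = crossing c \<omega>"
      unfolding crossing_def
    proof (rule suminf_cong)
      fix i
      obtain K :: nat where K: "\<bar>X i \<omega> - c\<bar> < real K" using reals_Archimedean2 by blast
      show "(SUP K. ?f K i) = (if \<bar>X i \<omega> - c\<bar> \<le> cluster_radius (C i \<omega>) then of_nat (size (C i \<omega>)) else 0)"
      proof (rule antisym)
        show "(SUP K. ?f K i) \<le> (if \<bar>X i \<omega> - c\<bar> \<le> cluster_radius (C i \<omega>) then of_nat (size (C i \<omega>)) else 0)"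
          by (intro SUP_least) auto
        show "(if \<bar>X i \<omega> - c\<bar> \<le> cluster_radius (C i \<omega>) then of_nat (size (C i \<omega>)) else 0) \<le> (SUP K. ?f K i)"
          by (rule SUP_upper2[of K]) (use K in auto)
      qed
    qed
    finally show ?thesis ..
  qed
  have step: "emeasure M {\<omega> \<in> space M. ennreal r < F K \<omega>} \<le> ennreal (exp (crossing_bound \<theta> - \<theta> * r))" for K
  proof -
    define s where "s = (\<lambda>(k::nat) m. if real k \<le> cluster_radius m then real (size m) else 0)"
    have s [measurable]: "s k \<in> borel_measurable config_space" for k unfolding s_def by measurable
    have s0: "0 \<le> s k m" for k m by (simp add: s_def)
    define A where "A k = {x. real k \<le> \<bar>x - c\<bar> \<and> \<bar>x - c\<bar> < real k + 1}" for k :: nat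
    have A [measurable]: "A k \<in> sets borel" for k unfolding A_def by measurable
    have Asub: "A k \<subseteq> {c - real k - 1..c - real k} \<union> {c + real k..c + real k + 1}" for k
      by (auto simp: A_def abs_if split: if_splits)
    have Abd: "bounded (A k)" for k by (rule bounded_subset[OF _ Asub]) simp
    have Ale: "measure lborel (A k) \<le> 2" for k
    proof -
      have "measure lborel (A k) \<le> measure lborel ({c - real k - 1..c - real k} \<union> {c + real k..c + real k + 1})"
        using Asub A by (intro measure_mono_fmeasurable) (auto intro!: fmeasurableI emeasure_bounded_finite)
      also have "\<dots> \<le> measure lborel {c - real k - 1..c - real k} + measure lborel {c + real k..c + real k + 1}"
        by (rule measure_Un_le) auto
      finally show ?thesis by simp
    qed
    have Apos: "0 < measure lborel (A k)" for k
    proof -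
      have "measure lborel {c + real k<..<c + real k + 1} \<le> measure lborel (A k)"
        using A Abd by (intro measure_mono_fmeasurable) (auto simp: A_def intro!: fmeasurableI emeasure_bounded_finite)
      then show ?thesis by simp
    qed
    have dis: "disjoint_family_on A {..<K}"
      unfolding disjoint_family_on_def
    proof (intro ballI impI)
      fix i j :: nat assume "i \<noteq> j"
      have False if "x \<in> A i" "x \<in> A j" for x
      proof -
        have "real i < real (Suc j)" "real j < real (Suc i)" using that by (auto simp: A_def)
        then show False using \<open>i \<noteq> j\<close> by linarith
      qed
      then show "A i \<inter> A j = {}" by blast
    qed
    \<comment> \<open>Replacing the distance of an immigrant by its integer part \<open>k\<close>
      only weakens the condition to reach \<open>c\<close>, and makes the mark the same function
      throughout a shell.\<close>
    have F_le: "F K \<omega> \<le> (\<Sum>k<K. marked_sum (s k) (A k) \<omega>)" for \<omega>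
    proof -
      have "(\<Sum>k<K. marked_sum (s k) (A k) \<omega>) = (\<Sum>i. \<Sum>k<K. ennreal (s k (C i \<omega>)) * indicator (A k) (X i \<omega>))"
        unfolding marked_sum_def by (rule suminf_sum[symmetric]) simp
      moreover have "F K \<omega> \<le> (\<Sum>i. \<Sum>k<K. ennreal (s k (C i \<omega>)) * indicator (A k) (X i \<omega>))"
        unfolding F_def
      proof (intro suminf_le)
        fix i
        show "(if \<bar>X i \<omega> - c\<bar> \<le> cluster_radius (C i \<omega>) \<and> \<bar>X i \<omega> - c\<bar> < real K then of_nat (size (C i \<omega>)) else 0)
          \<le> (\<Sum>k<K. ennreal (s k (C i \<omega>)) * indicator (A k) (X i \<omega>))"
        proof (cases "\<bar>X i \<omega> - c\<bar> \<le> cluster_radius (C i \<omega>) \<and> \<bar>X i \<omega> - c\<bar> < real K")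
          case True
          define k where "k = nat \<lfloor>\<bar>X i \<omega> - c\<bar>\<rfloor>"
          have k: "real k \<le> \<bar>X i \<omega> - c\<bar>" "\<bar>X i \<omega> - c\<bar> < real k + 1" unfolding k_def by simp_all
          have kK: "k < K" using True k by linarith
          have "of_nat (size (C i \<omega>)) = ennreal (s k (C i \<omega>)) * indicator (A k) (X i \<omega>)"
            using k True by (simp add: s_def A_def ennreal_of_nat_eq_real_of_nat)
          also have "\<dots> \<le> (\<Sum>k<K. ennreal (s k (C i \<omega>)) * indicator (A k) (X i \<omega>))"
            using kK by (intro member_le_sum) auto
          finally show ?thesis using True by simp
        next
          case False
          then show ?thesis by (simp only: if_False zero_le)
        qed
      qed auto
      ultimately show ?thesis by simp
    qed
    have AEfin: "AE \<omega> in M. \<forall>k<K. finite {i. X i \<omega> \<in> A k}"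
      using AE_finite_points[OF A Abd] by (simp add: AE_all_countable)
    let ?G = "\<lambda>\<omega>. \<Sum>k<K. \<theta> * enn2real (marked_sum (s k) (A k) \<omega>)"
    let ?E = "{\<omega> \<in> space M. ennreal r < F K \<omega>}"
    have "ennreal (exp (\<theta> * r)) * emeasure M ?E = (\<integral>\<^sup>+\<omega>. ennreal (exp (\<theta> * r)) * indicator ?E \<omega> \<partial>M)"
      by (rule nn_integral_cmult_indicator[symmetric]) measurable
    also have "\<dots> \<le> (\<integral>\<^sup>+\<omega>. ennreal (exp (?G \<omega>)) \<partial>M)"
    proof (rule nn_integral_mono_AE, use AEfin in eventually_elim)
      case (elim \<omega>)
      show ?case
      proof (cases "\<omega> \<in> ?E")
        case True
        have m: "marked_sum (s k) (A k) \<omega> = ennreal (enn2real (marked_sum (s k) (A k) \<omega>))" if "k < K" for k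
          using elim that marked_sum_eq[of \<omega> "A k" "s k"] s0 by simp
        have "ennreal r < (\<Sum>k<K. marked_sum (s k) (A k) \<omega>)" using True F_le[of \<omega>] by (auto intro: order_less_le_trans)
        also have "\<dots> = (\<Sum>k<K. ennreal (enn2real (marked_sum (s k) (A k) \<omega>)))" using m by (intro sum.cong) auto
        also have "\<dots> = ennreal (\<Sum>k<K. enn2real (marked_sum (s k) (A k) \<omega>))" by (rule sum_ennreal) simp
        finally have "r < (\<Sum>k<K. enn2real (marked_sum (s k) (A k) \<omega>))" using r by (simp add: ennreal_less_iff)
        then have "\<theta> * r \<le> ?G \<omega>" using \<theta> by (simp add: sum_distrib_left[symmetric] mult_left_mono)
        then show ?thesis using True by (simp add: ennreal_leI)
      qed simp
    qed
    also have "\<dots> = ennreal (exp (\<Sum>k<K. \<nu> * measure lborel (A k) * ((\<integral>m. exp (\<theta> * s k m) \<partial>Q) - 1)))"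
      by (rule marked_sum_exp_moment[where \<theta> = "\<lambda>_. \<theta>"])
         (use A Abd Apos dis s s0 crossing_exp_bound(1)[OF \<theta>] in \<open>auto simp: s_def\<close>)
    also have "\<dots> \<le> ennreal (exp (crossing_bound \<theta>))"
    proof (intro ennreal_leI, unfold exp_le_cancel_iff)
      interpret Q: prob_space Q by (rule prob_space_Q)
      have ge1: "1 \<le> (\<integral>m. exp (\<theta> * s k m) \<partial>Q)" for k
        using crossing_exp_bound(1)[OF \<theta>, of k] s0 \<theta>
        by (intro Q.integral_ge_const) (auto simp: s_def)
      have "(\<Sum>k<K. \<nu> * measure lborel (A k) * ((\<integral>m. exp (\<theta> * s k m) \<partial>Q) - 1))
        \<le> (\<Sum>k<K. 2 * \<nu> * ((\<integral>m. exp (\<theta> * s k m) \<partial>Q) - 1))"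
        using Ale ge1 intensity_pos by (intro sum_mono mult_right_mono) (auto simp: mult.commute)
      also have "\<dots> \<le> crossing_bound \<theta>" unfolding s_def by (rule crossing_exp_bound(2)[OF \<theta>])
      finally show "(\<Sum>k<K. \<nu> * measure lborel (A k) * ((\<integral>m. exp (\<theta> * s k m) \<partial>Q) - 1)) \<le> crossing_bound \<theta>" .
    qed
    finally have "ennreal (exp (- \<theta> * r)) * (ennreal (exp (\<theta> * r)) * emeasure M ?E) \<le> ennreal (exp (- \<theta> * r)) * ennreal (exp (crossing_bound \<theta>))"
      by (rule mult_left_mono) simp
    moreover have "ennreal (exp (- \<theta> * r)) * (ennreal (exp (\<theta> * r)) * emeasure M ?E) = emeasure M ?E"
      by (simp add: mult.assoc[symmetric] ennreal_mult[symmetric] exp_add[symmetric])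
    moreover have "ennreal (exp (- \<theta> * r)) * ennreal (exp (crossing_bound \<theta>)) = ennreal (exp (crossing_bound \<theta> - \<theta> * r))"
      by (simp add: ennreal_mult[symmetric] exp_add[symmetric])
    ultimately show ?thesis by simp
  qed
  have "{\<omega> \<in> space M. ennreal r < crossing c \<omega>} = (\<Union>K. {\<omega> \<in> space M. ennreal r < F K \<omega>})"
    unfolding SUP less_SUP_iff by auto
  then have "emeasure M {\<omega> \<in> space M. ennreal r < crossing c \<omega>} = (SUP K. emeasure M {\<omega> \<in> space M. ennreal r < F K \<omega>})"
    using inc by (simp, intro SUP_emeasure_incseq[symmetric]) (auto simp: incseq_def intro: order_less_le_trans)
  also have "\<dots> \<le> ennreal (exp (crossing_bound \<theta> - \<theta> * r))" by (intro SUP_least step)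
  finally show ?thesis .
qed

lemma AE_crossing_finite: "AE \<omega> in M. crossing c \<omega> < \<infinity>"
proof -
  have "prob {\<omega> \<in> space M. crossing c \<omega> = \<infinity>} \<le> exp (crossing_bound 1 - r)" if "r \<ge> 0" for r
  proof -
    have "emeasure M {\<omega> \<in> space M. crossing c \<omega> = \<infinity>} \<le> emeasure M {\<omega> \<in> space M. ennreal r < crossing c \<omega>}"
      by (intro emeasure_mono) auto
    also have "\<dots> \<le> ennreal (exp (crossing_bound 1 - 1 * r))" by (rule crossing_tail) (use that in auto)
    finally show ?thesis by (simp add: emeasure_eq_measure)
  qed
  then have "prob {\<omega> \<in> space M. crossing c \<omega> = \<infinity>} \<le> 0 + e" if e: "e > 0" for e
  proof -
    \<comment> \<open>The level is chosen so that the tail bound is at most \<open>e\<close>; the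
      maximum keeps it nonnegative.\<close>
    have "prob {\<omega> \<in> space M. crossing c \<omega> = \<infinity>} \<le> exp (crossing_bound 1 - max 0 (crossing_bound 1 - ln e))"
      using \<open>\<And>r. r \<ge> 0 \<Longrightarrow> _\<close>[of "max 0 (crossing_bound 1 - ln e)"] by simp
    also have "\<dots> \<le> exp (ln e)" by (subst exp_le_cancel_iff) auto
    finally show ?thesis using e by simp
  qed
  then have "prob {\<omega> \<in> space M. crossing c \<omega> = \<infinity>} \<le> 0" by (rule field_le_epsilon)
  then have "{\<omega> \<in> space M. crossing c \<omega> = \<infinity>} \<in> null_sets M"
    by (intro null_setsI) (simp_all add: emeasure_eq_measure measure_le_0_iff)
  from AE_not_in[OF this] AE_space show ?thesis by eventually_elim (simp add: less_top)
qed

section \<open>Comparison of the counts with the compound Poisson totals\<close>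

abbreviation count :: "'w \<Rightarrow> real \<Rightarrow> ennreal" where
  "count \<omega> t \<equiv> cluster_process_count X C \<omega> {0<..t}"

abbreviation total :: "'w \<Rightarrow> real \<Rightarrow> ennreal" where
  "total \<omega> t \<equiv> marked_sum (\<lambda>m. real (size m)) {0<..t} \<omega>"

text \<open>A cluster that reaches neither 0 nor \<open>t\<close> lies entirely in
  \<open>{0<..t}\<close> or entirely outside, together with its immigrant, so it counts equally on
  both sides. Any other cluster contributes at most its size, which a crossing term
  contains.\<close>

lemma count_total_bounds:
  assumes t: "0 \<le> t"
  shows "count \<omega> t \<le> total \<omega> t + crossing 0 \<omega> + crossing t \<omega>"
    and "total \<omega> t \<le> count \<omega> t + crossing 0 \<omega> + crossing t \<omega>"
proof -
  let ?n = "\<lambda>i. of_nat (size {#y \<in># C i \<omega>. X i \<omega> + y \<in> {0<..t}#}) :: ennreal"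
  let ?z = "\<lambda>i. ennreal (real (size (C i \<omega>))) * indicator {0<..t} (X i \<omega>)"
  let ?r = "\<lambda>c i. if \<bar>X i \<omega> - c\<bar> \<le> cluster_radius (C i \<omega>) then of_nat (size (C i \<omega>)) else 0 :: ennreal"
  have main: "?n i \<le> ?z i + ?r 0 i + ?r t i" "?z i \<le> ?n i + ?r 0 i + ?r t i" for i
  proof -
    have n: "?n i \<le> of_nat (size (C i \<omega>))" by (simp add: size_filter_mset_lesseq)
    have z: "?z i \<le> of_nat (size (C i \<omega>))" by (auto simp: indicator_def ennreal_of_nat_eq_real_of_nat)
    have "(?n i \<le> ?z i + ?r 0 i + ?r t i) \<and> (?z i \<le> ?n i + ?r 0 i + ?r t i)"
    proof (cases "\<bar>X i \<omega> - 0\<bar> \<le> cluster_radius (C i \<omega>) \<or> \<bar>X i \<omega> - t\<bar> \<le> cluster_radius (C i \<omega>)")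
      case True
      then have "of_nat (size (C i \<omega>)) \<le> ?r 0 i + ?r t i"
        by (elim disjE) (simp_all add: add_increasing2 add_increasing)
      moreover have "?r 0 i + ?r t i \<le> ?z i + ?r 0 i + ?r t i" "?r 0 i + ?r t i \<le> ?n i + ?r 0 i + ?r t i"
        by (simp_all add: add.assoc add_increasing)
      ultimately show ?thesis using n z by (meson order_trans)
    next
      case False
      have "X i \<omega> + y \<in> {0<..t} \<longleftrightarrow> X i \<omega> \<in> {0<..t}" if "y \<in># C i \<omega>" for y
        using radius_ge[OF that] False t by (auto simp: abs_if split: if_splits)
      then have "{#y \<in># C i \<omega>. X i \<omega> + y \<in> {0<..t}#} = {#y \<in># C i \<omega>. X i \<omega> \<in> {0<..t}#}"
        by (rule filter_mset_cong[OF refl])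
      then have "?n i = ?z i"
        by (cases "X i \<omega> \<in> {0<..t}") (simp_all add: ennreal_of_nat_eq_real_of_nat)
      then show ?thesis by (simp add: add.assoc add_increasing2)
    qed
    then show "?n i \<le> ?z i + ?r 0 i + ?r t i" "?z i \<le> ?n i + ?r 0 i + ?r t i" by blast+
  qed
  have sum: "(\<Sum>i. f i) + (\<Sum>i. g i) + (\<Sum>i. h i) = (\<Sum>i. f i + g i + h i)" for f g h :: "nat \<Rightarrow> ennreal"
    by (simp add: suminf_add)
  show "count \<omega> t \<le> total \<omega> t + crossing 0 \<omega> + crossing t \<omega>"
    unfolding cluster_process_count_def marked_sum_def crossing_def sum by (intro suminf_le main) auto
  show "total \<omega> t \<le> count \<omega> t + crossing 0 \<omega> + crossing t \<omega>"
    unfolding cluster_process_count_def marked_sum_def crossing_def sum by (intro suminf_le main) auto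
qed

lemma count_mono: "s \<le> t \<Longrightarrow> count \<omega> s \<le> count \<omega> t"
  unfolding cluster_process_count_def
proof (intro suminf_le of_nat_mono)
  fix i assume "s \<le> t"
  then have "{#y \<in># C i \<omega>. X i \<omega> + y \<in> {0<..s}#} = {#y \<in># {#y \<in># C i \<omega>. X i \<omega> + y \<in> {0<..t}#}. X i \<omega> + y \<in> {0<..s}#}"
    unfolding filter_filter_mset by (intro filter_mset_cong) auto
  then show "size {#y \<in># C i \<omega>. X i \<omega> + y \<in> {0<..s}#} \<le> size {#y \<in># C i \<omega>. X i \<omega> + y \<in> {0<..t}#}"
    by (simp only: size_filter_mset_lesseq)
qed auto

lemma AE_total_finite: "AE \<omega> in M. total \<omega> t < \<infinity>"
proof -
  have "AE \<omega> in M. finite {i. X i \<omega> \<in> {0<..t}}" by (rule AE_finite_points) auto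
  then show ?thesis by eventually_elim (simp add: marked_sum_eq)
qed

lemma AE_count_finite:
  assumes "0 \<le> t" shows "AE \<omega> in M. count \<omega> t < \<infinity>"
  using AE_total_finite[of t] AE_crossing_finite[of 0] AE_crossing_finite[of t]
proof eventually_elim
  case (elim \<omega>)
  then have "total \<omega> t + crossing 0 \<omega> + crossing t \<omega> < \<infinity>" by simp
  with count_total_bounds(1)[OF assms, of \<omega>] show ?case by (rule order_le_less_trans)
qed

end

section \<open>The cumulant function and the counting paths\<close>

context exponential_cluster_process begin

abbreviation mgf :: "real \<Rightarrow> real" where
  "mgf \<theta> \<equiv> \<integral>m. exp (\<theta> * real (size m)) \<partial>Q"

abbreviation Lam :: "real \<Rightarrow> real" where
  "Lam \<equiv> cluster_Lambda \<nu> Q"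

lemma Lam_eq: "Lam \<theta> = \<nu> * (mgf \<theta> - 1)"
  by (simp add: cluster_Lambda_def)

lemma size_Q_measurable [measurable]: "(\<lambda>m. real (size m)) \<in> borel_measurable Q"
  by (simp cong: measurable_cong_sets)

lemma measure_Q_UNIV [simp]: "measure Q UNIV = 1"
  using prob_space.prob_space[OF prob_space_Q] by simp

lemma integrable_size_exp: "integrable Q (\<lambda>m. real (size m) * exp (\<theta> * real (size m)))"
proof (rule Bochner_Integration.integrable_bound[OF size_exp[of "\<theta> + 1"]])
  show "AE m in Q. norm (real (size m) * exp (\<theta> * real (size m))) \<le> norm (exp ((\<theta> + 1) * real (size m)))"
  proof (intro AE_I2)
    fix m :: "real multiset"
    have "real (size m) \<le> exp (real (size m))" using exp_ge_add_one_self[of "real (size m)"] by linarith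
    then show "norm (real (size m) * exp (\<theta> * real (size m))) \<le> norm (exp ((\<theta> + 1) * real (size m)))"
      by (simp add: distrib_right exp_add mult.commute)
  qed
qed measurable

text \<open>Differentiation under the expectation by the second-order Taylor remainder. For
  \<open>\<bar>h\<bar> \<le> 1\<close> the factors \<open>exp \<bar>h * s\<bar>\<close> and
  \<open>s\<^sup>2 / 2\<close> are each at most \<open>exp s\<close>, whence the moment at
  \<open>\<theta> + 2\<close>.\<close>

lemma Lam_has_derivative:
  "(Lam has_real_derivative \<nu> * (\<integral>m. real (size m) * exp (\<theta> * real (size m)) \<partial>Q)) (at \<theta>)"
proof -
  let ?D = "\<integral>m. real (size m) * exp (\<theta> * real (size m)) \<partial>Q"
  have quad: "\<bar>exp y - 1 - y\<bar> \<le> exp \<bar>y\<bar> / 2 * y\<^sup>2" for y :: real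
  proof -
    obtain t where t: "\<bar>t\<bar> \<le> \<bar>y\<bar>" "exp y = (\<Sum>m<2. y ^ m / fact m) + exp t / fact 2 * y ^ 2"
      using Maclaurin_exp_le[of y 2] by auto
    then have "exp y - 1 - y = exp t / 2 * y\<^sup>2" by (simp add: numeral_2_eq_2)
    then have "\<bar>exp y - 1 - y\<bar> = exp t / 2 * y\<^sup>2" by (simp only: abs_mult) simp
    also have "\<dots> \<le> exp \<bar>y\<bar> / 2 * y\<^sup>2" using t(1) by (intro mult_right_mono) auto
    finally show ?thesis .
  qed
  have bound: "\<bar>mgf (\<theta> + h) - mgf \<theta> - h * ?D\<bar> \<le> h\<^sup>2 * mgf (\<theta> + 2)" if h: "\<bar>h\<bar> \<le> 1" for h
  proof -
    let ?f = "\<lambda>m. exp ((\<theta> + h) * real (size m)) - exp (\<theta> * real (size m)) - h * (real (size m) * exp (\<theta> * real (size m)))"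
    have i: "integrable Q (\<lambda>m. exp ((\<theta> + h) * real (size m)))" "integrable Q (\<lambda>m. exp (\<theta> * real (size m)))"
      "integrable Q (\<lambda>m. h * (real (size m) * exp (\<theta> * real (size m))))"
      using size_exp integrable_mult_right[OF integrable_size_exp] by blast+
    have if': "integrable Q ?f"
      by (rule Bochner_Integration.integrable_diff[OF Bochner_Integration.integrable_diff[OF i(1) i(2)] i(3)])
    have "\<bar>mgf (\<theta> + h) - mgf \<theta> - h * ?D\<bar> = \<bar>\<integral>m. ?f m \<partial>Q\<bar>"
      by (simp add: Bochner_Integration.integral_diff[OF Bochner_Integration.integrable_diff[OF i(1) i(2)] i(3)]
          Bochner_Integration.integral_diff[OF i(1) i(2)])
    also have "\<dots> \<le> (\<integral>m. \<bar>?f m\<bar> \<partial>Q)" by (rule integral_abs_bound)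
    also have "\<dots> \<le> (\<integral>m. h\<^sup>2 * exp ((\<theta> + 2) * real (size m)) \<partial>Q)"
    proof (rule integral_mono)
      show "integrable Q (\<lambda>m. \<bar>?f m\<bar>)"
        by (rule integrable_abs[OF if'])
      show "integrable Q (\<lambda>m. h\<^sup>2 * exp ((\<theta> + 2) * real (size m)))" by (rule integrable_mult_right[OF size_exp])
      fix m :: "real multiset"
      let ?s = "real (size m)"
      have "?f m = exp (\<theta> * ?s) * (exp (h * ?s) - 1 - h * ?s)"
        by (simp add: distrib_right exp_add algebra_simps)
      then have "\<bar>?f m\<bar> = exp (\<theta> * ?s) * \<bar>exp (h * ?s) - 1 - h * ?s\<bar>" by (simp add: abs_mult)
      also have "\<dots> \<le> exp (\<theta> * ?s) * (exp \<bar>h * ?s\<bar> / 2 * (h * ?s)\<^sup>2)"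
        by (intro mult_left_mono quad) simp
      also have "\<dots> = h\<^sup>2 * (exp (\<theta> * ?s) * (exp \<bar>h * ?s\<bar> * (?s\<^sup>2 / 2)))" by (simp add: power_mult_distrib)
      also have "\<dots> \<le> h\<^sup>2 * (exp (\<theta> * ?s) * (exp ?s * exp ?s))"
      proof (intro mult_left_mono mult_mono)
        have "\<bar>h * ?s\<bar> \<le> 1 * ?s" unfolding abs_mult using h by (intro mult_mono) auto
        then show "exp \<bar>h * ?s\<bar> \<le> exp ?s" by simp
        show "?s\<^sup>2 / 2 \<le> exp ?s" using exp_lower_Taylor_quadratic[of ?s] by simp
      qed auto
      also have "exp (\<theta> * ?s) * (exp ?s * exp ?s) = exp ((\<theta> + 2) * ?s)"
        by (simp add: exp_add[symmetric] algebra_simps)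
      finally show "\<bar>?f m\<bar> \<le> h\<^sup>2 * exp ((\<theta> + 2) * ?s)" .
    qed
    also have "\<dots> = h\<^sup>2 * mgf (\<theta> + 2)" by simp
    finally show ?thesis .
  qed
  have "(mgf has_real_derivative ?D) (at \<theta>)"
    unfolding DERIV_def
  proof (rule LIM_zero_cancel, rule tendsto_0_le[where K = "mgf (\<theta> + 2)"])
    show "((\<lambda>h. h) \<longlongrightarrow> (0::real)) (at 0)" by (rule tendsto_ident_at)
    have "\<forall>\<^sub>F h in at (0::real). \<bar>h\<bar> < 1 \<and> h \<noteq> 0"
      unfolding eventually_at by (intro exI[of _ 1]) (auto simp: dist_real_def)
    then show "\<forall>\<^sub>F h in at 0. norm ((mgf (\<theta> + h) - mgf \<theta>) / h - ?D) \<le> norm h * mgf (\<theta> + 2)"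
    proof eventually_elim
      case (elim h)
      have "(mgf (\<theta> + h) - mgf \<theta>) / h - ?D = (mgf (\<theta> + h) - mgf \<theta> - h * ?D) / h"
        using elim by (simp add: diff_divide_distrib)
      then have "norm ((mgf (\<theta> + h) - mgf \<theta>) / h - ?D) = \<bar>mgf (\<theta> + h) - mgf \<theta> - h * ?D\<bar> / \<bar>h\<bar>" by simp
      also have "\<dots> \<le> (h\<^sup>2 * mgf (\<theta> + 2)) / \<bar>h\<bar>" using bound elim by (intro divide_right_mono) auto
      also have "\<dots> = norm h * mgf (\<theta> + 2)" using elim by (simp add: power2_eq_square abs_if field_simps)
      finally show ?case .
    qed
  qed
  then show ?thesis unfolding Lam_eq by (auto intro!: derivative_eq_intros)
qed

lemma Lam_rate_exponent: "rate_exponent Lam"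
proof
  show "Lam 0 = 0" by (simp add: Lam_eq)
  fix \<theta> :: real assume "\<theta> \<le> 0"
  then have "mgf \<theta> \<le> (\<integral>m. 1 \<partial>Q)"
    by (intro integral_mono size_exp finite_measure.integrable_const prob_space.finite_measure prob_space_Q)
       (simp add: mult_le_0_iff)
  then show "Lam \<theta> \<le> 0" using intensity_pos by (simp add: Lam_eq mult_le_0_iff)
qed

sublocale rate_exponent Lam by (rule Lam_rate_exponent)

text \<open>The derivative of \<open>Lam\<close> at 0, that is, the typical slope of the
  paths.\<close>

definition mean_rate :: real where
  "mean_rate = \<nu> * (\<integral>m. real (size m) \<partial>Q)"

lemma integrable_size: "integrable Q (\<lambda>m. real (size m))"
  using integrable_size_exp[of 0] by simp

text \<open>From \<open>1 + y \<le> exp y\<close>. Equivalently the Legendre transform is 0 at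
  \<open>mean_rate\<close>, which is why mixing a path with this slope costs nothing in the lower
  bound.\<close>

lemma Lam_ge_tangent: "\<theta> * mean_rate \<le> Lam \<theta>"
proof -
  have "(\<integral>m. 1 + \<theta> * real (size m) \<partial>Q) \<le> mgf \<theta>"
    by (intro integral_mono size_exp Bochner_Integration.integrable_add integrable_mult_right integrable_size
        finite_measure.integrable_const prob_space.finite_measure prob_space_Q) simp
  then have "\<theta> * (\<integral>m. real (size m) \<partial>Q) \<le> mgf \<theta> - 1"
  proof -
    have "integrable Q (\<lambda>m. \<theta> * real (size m))" "integrable Q (\<lambda>_. 1 :: real)"
      by (intro integrable_mult_right integrable_size finite_measure.integrable_const prob_space.finite_measure prob_space_Q)+
    then have "(\<integral>m. 1 + \<theta> * real (size m) \<partial>Q) = 1 + \<theta> * (\<integral>m. real (size m) \<partial>Q)"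
      by (simp add: Bochner_Integration.integral_add)
    then show "(\<integral>m. 1 + \<theta> * real (size m) \<partial>Q) \<le> mgf \<theta> \<Longrightarrow> \<theta> * (\<integral>m. real (size m) \<partial>Q) \<le> mgf \<theta> - 1" by linarith
  qed
  then have "\<nu> * (\<theta> * (\<integral>m. real (size m) \<partial>Q)) \<le> \<nu> * (mgf \<theta> - 1)"
    using intensity_pos by (intro mult_left_mono) auto
  then show ?thesis by (simp add: mean_rate_def Lam_eq mult_ac)
qed

lemma mean_rate_pos: "0 < mean_rate"
proof -
  interpret Q: prob_space Q by (rule prob_space_Q)
  have "1 \<le> (\<integral>m. real (size m) \<partial>Q)"
    by (rule Q.integral_ge_const[OF integrable_size]) (use AE_cluster in eventually_elim, simp)
  then show ?thesis using intensity_pos by (simp add: mean_rate_def)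
qed

text \<open>A cluster contains its immigrant, so its size is at least 1 almost surely. The resulting
  superlinear growth makes every positive slope attainable by tilting.\<close>

lemma Lam_ge_exp: "0 \<le> \<theta> \<Longrightarrow> \<nu> * (exp \<theta> - 1) \<le> Lam \<theta>"
proof -
  interpret Q: prob_space Q by (rule prob_space_Q)
  assume t: "0 \<le> \<theta>"
  have "exp \<theta> \<le> mgf \<theta>"
  proof (rule Q.integral_ge_const[OF size_exp], use AE_cluster in eventually_elim)
    case (elim m)
    then have "\<theta> * 1 \<le> \<theta> * real (size m)" using t by (intro mult_left_mono) auto
    then show ?case by simp
  qed
  then show ?thesis using intensity_pos by (simp add: Lam_eq)
qed

text \<open>The tilting parameter is a critical point of the coercive function \<open>\<theta> \<mapsto> \<Lambda>(\<theta>) - \<theta> x\<close>.\<close>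

lemma Lam_derivative_attains:
  assumes x: "0 < x"
  obtains \<theta> where "(Lam has_real_derivative x) (at \<theta>)"
proof -
  define \<phi> where "\<phi> \<theta> = Lam \<theta> - \<theta> * x" for \<theta>
  have \<phi>0: "\<phi> 0 = 0" by (simp add: \<phi>_def Lam_0)
  \<comment> \<open>Makes \<open>\<phi>\<close> positive at both ends: at \<open>R\<close> because
    \<open>\<nu> * (exp R - 1)\<close> exceeds \<open>\<nu> * R\<^sup>2 / 2\<close> and so
    \<open>R * x\<close>, at \<open>- R\<close> because \<open>Lam\<close> is at least
    \<open>- \<nu>\<close> while \<open>R * x > \<nu>\<close>. As \<open>\<phi> 0 = 0\<close>, the
    minimum is interior.\<close>
  define R where "R = max (2 * x / \<nu>) (\<nu> / x) + 1"
  have R: "R > 0" "R > 2 * x / \<nu>" "R > \<nu> / x"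
    using x intensity_pos by (auto simp: R_def max_def intro: add_nonneg_pos)
  have right: "\<phi> R > 0"
  proof -
    have "1 + R + R\<^sup>2 / 2 \<le> exp R" using R by (intro exp_lower_Taylor_quadratic) simp
    then have "R * (R / 2) < exp R - 1" using R by (simp add: power2_eq_square)
    then have "\<nu> * (R * (R / 2)) < \<nu> * (exp R - 1)" using intensity_pos by (rule mult_strict_left_mono)
    moreover have "x < \<nu> * (R / 2)" using R(2) intensity_pos by (simp add: field_simps)
    then have "R * x < R * (\<nu> * (R / 2))" using R(1) by (rule mult_strict_left_mono)
    moreover have "R * (\<nu> * (R / 2)) = \<nu> * (R * (R / 2))" by (simp only: mult_ac)
    ultimately show ?thesis unfolding \<phi>_def using Lam_ge_exp[of R] R(1) by linarith
  qed
  have left: "\<phi> (- R) > 0"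
  proof -
    have "- \<nu> \<le> Lam (- R)"
    proof -
      have "0 \<le> mgf (- R)" by simp
      then have "\<nu> * (-1) \<le> \<nu> * (mgf (- R) - 1)" using intensity_pos by (intro mult_left_mono) auto
      then show ?thesis by (simp add: Lam_eq)
    qed
    moreover have "\<nu> < R * x" using R(3) x by (simp add: field_simps)
    ultimately show ?thesis by (simp add: \<phi>_def)
  qed
  have D: "(\<phi> has_real_derivative (\<nu> * (\<integral>m. real (size m) * exp (\<theta> * real (size m)) \<partial>Q) - x)) (at \<theta>)" for \<theta>
    unfolding \<phi>_def by (auto intro!: derivative_eq_intros Lam_has_derivative)
  have "continuous_on {-R..R} \<phi>"
    by (intro continuous_at_imp_continuous_on ballI DERIV_isCont[OF D])
  then obtain \<theta> where \<theta>: "\<theta> \<in> {-R..R}" "\<And>y. y \<in> {-R..R} \<Longrightarrow> \<phi> \<theta> \<le> \<phi> y"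
    using continuous_attains_inf[of "{-R..R}" \<phi>] R by auto
  have "\<phi> \<theta> \<le> 0" using \<theta>(2)[of 0] R by (simp add: \<phi>0)
  then have "\<theta> \<noteq> R" "\<theta> \<noteq> - R" using left right by auto
  then have int: "- R < \<theta>" "\<theta> < R" using \<theta>(1) by auto
  have "\<nu> * (\<integral>m. real (size m) * exp (\<theta> * real (size m)) \<partial>Q) - x = 0"
  proof (rule DERIV_local_min[OF D])
    show "0 < min (\<theta> + R) (R - \<theta>)" using int by simp
    show "\<forall>y. \<bar>\<theta> - y\<bar> < min (\<theta> + R) (R - \<theta>) \<longrightarrow> \<phi> \<theta> \<le> \<phi> y"
      by (intro allI impI \<theta>(2)) auto
  qed
  then have "\<nu> * (\<integral>m. real (size m) * exp (\<theta> * real (size m)) \<partial>Q) = x" by simp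
  with Lam_has_derivative[of \<theta>] show ?thesis by (intro that[of \<theta>]) simp
qed

text \<open>A finite count means that finitely many clusters meet \<open>{0<..\<alpha>}\<close>, so
  the path is a finite sum of unit steps.\<close>

lemma count_path_cadlag:
  assumes fin: "count \<omega> \<alpha> < \<infinity>" and \<alpha>: "\<alpha> > 0"
  shows "scaled_count_path X C \<alpha> \<omega> \<in> cadlag_space"
proof -
  let ?g = "\<lambda>i t. real (size {#y \<in># C i \<omega>. X i \<omega> + y \<in> {0<..\<alpha> * t}#})"
  \<comment> \<open>The cadlag property on the whole line, which is stable under sums and free of
    endpoint cases; restriction to the unit interval comes last.\<close>
  define P where "P g \<longleftrightarrow> (\<forall>t. (g \<longlongrightarrow> g t) (at_right t)) \<and> (\<forall>t. \<exists>l. (g \<longlongrightarrow> l) (at_left t))" for g :: "real \<Rightarrow> real"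
  have Padd: "P (\<lambda>t. g t + h t)" if gh: "P g" "P h" for g h
    unfolding P_def
  proof (intro conjI allI)
    fix t
    show "((\<lambda>t. g t + h t) \<longlongrightarrow> g t + h t) (at_right t)" using gh by (intro tendsto_add) (auto simp: P_def)
    obtain l l' where "(g \<longlongrightarrow> l) (at_left t)" "(h \<longlongrightarrow> l') (at_left t)" using gh unfolding P_def by blast
    from tendsto_add[OF this] show "\<exists>l. ((\<lambda>t. g t + h t) \<longlongrightarrow> l) (at_left t)" by blast
  qed
  have Pconst: "P (\<lambda>_. c)" for c by (auto simp: P_def intro!: exI[of _ c])
  \<comment> \<open>The interval is closed on the right, so the step at \<open>c\<close> is
    right-continuous in \<open>t\<close>; a point \<open>c \<le> 0\<close> is never counted.\<close>
  have Pind: "P (\<lambda>t. if c \<in> {0<..\<alpha> * t} then 1 else 0)" for c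
    unfolding P_def
  proof (intro conjI allI)
    fix t
    have "\<forall>\<^sub>F s in at_right t. (if c \<in> {0<..\<alpha> * t} then 1 else 0) = (if c \<in> {0<..\<alpha> * s} then 1 else (0::real))"
    proof (cases "c \<le> \<alpha> * t")
      case True
      then have "c \<le> \<alpha> * s" if "t < s" for s using \<alpha> that by (smt (verit) mult_less_cancel_left_pos)
      with True show ?thesis using eventually_at_right_less[of t] by (auto elim!: eventually_mono)
    next
      case False
      then have "t < c / \<alpha>" using \<alpha> by (simp add: pos_less_divide_eq mult.commute)
      then have "\<forall>\<^sub>F s in at_right t. s \<in> {t<..<c / \<alpha>}" by (rule eventually_at_right_real)
      then show ?thesis
        by (rule eventually_mono) (use False \<alpha> in \<open>auto simp: pos_less_divide_eq mult.commute\<close>)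
    qed
    then show "((\<lambda>t. if c \<in> {0<..\<alpha> * t} then 1 else 0) \<longlongrightarrow> (if c \<in> {0<..\<alpha> * t} then 1 else (0::real))) (at_right t)"
      by (rule Lim_transform_eventually[OF tendsto_const])
    show "\<exists>l::real. ((\<lambda>t. if c \<in> {0<..\<alpha> * t} then 1 else 0) \<longlongrightarrow> l) (at_left t)"
    proof (cases "c < \<alpha> * t")
      case True
      then have "c / \<alpha> < t" using \<alpha> by (simp add: pos_divide_less_eq mult.commute)
      then have "\<forall>\<^sub>F s in at_left t. s \<in> {c / \<alpha><..<t}" by (rule eventually_at_left_real)
      then have "\<forall>\<^sub>F s in at_left t. (if 0 < c then 1 else 0) = (if c \<in> {0<..\<alpha> * s} then 1 else (0::real))"
        by (rule eventually_mono) (use \<alpha> in \<open>auto simp: pos_divide_less_eq mult.commute\<close>)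
      from Lim_transform_eventually[OF tendsto_const this] show ?thesis by blast
    next
      case False
      have "\<forall>\<^sub>F s in at_left t. s \<in> {t - 1<..<t}" by (rule eventually_at_left_real) simp
      then have "\<forall>\<^sub>F s in at_left t. 0 = (if c \<in> {0<..\<alpha> * s} then 1 else (0::real))"
      proof (rule eventually_mono)
        fix s assume "s \<in> {t - 1<..<t}"
        then have "\<alpha> * s < \<alpha> * t" using \<alpha> by simp
        with False show "0 = (if c \<in> {0<..\<alpha> * s} then 1 else (0::real))" by auto
      qed
      from Lim_transform_eventually[OF tendsto_const this] show ?thesis by blast
    qed
  qed
  have Psize: "P (\<lambda>t. real (size {#y \<in># m. x + y \<in> {0<..\<alpha> * t}#}))" for m x
  proof (induction m)
    case (add z m)
    have "(\<lambda>t. real (size {#y \<in># add_mset z m. x + y \<in> {0<..\<alpha> * t}#}))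
      = (\<lambda>t. (if x + z \<in> {0<..\<alpha> * t} then 1 else 0) + real (size {#y \<in># m. x + y \<in> {0<..\<alpha> * t}#}))"
      by (rule ext) simp
    then show ?case using Padd[OF Pind add.IH] by simp
  qed (simp add: Pconst)
  have Psum: "finite I \<Longrightarrow> P (\<lambda>t. \<Sum>i\<in>I. ?g i t)" for I
  proof (induction I rule: finite_induct)
    case (insert i F)
    show ?case unfolding sum.insert[OF insert.hyps] by (rule Padd[OF Psize insert.IH])
  qed (simp add: Pconst)
  define I where "I = {i. {#y \<in># C i \<omega>. X i \<omega> + y \<in> {0<..\<alpha>}#} \<noteq> {#}}"
  have finI: "finite I"
  proof (rule ccontr)
    assume inf: "infinite I"
    have "of_nat n \<le> count \<omega> \<alpha>" for n
    proof -
      obtain F where F: "finite F" "card F = n" "F \<subseteq> I" using infinite_arbitrarily_large[OF inf] by blast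
      have "(of_nat n :: ennreal) = (\<Sum>i\<in>F. 1)" using F by simp
      also have "\<dots> \<le> (\<Sum>i\<in>F. of_nat (size {#y \<in># C i \<omega>. X i \<omega> + y \<in> {0<..\<alpha>}#}))"
      proof (rule sum_mono)
        fix i assume "i \<in> F"
        then have "{#y \<in># C i \<omega>. X i \<omega> + y \<in> {0<..\<alpha>}#} \<noteq> {#}" using F unfolding I_def by blast
        then have "1 \<le> size {#y \<in># C i \<omega>. X i \<omega> + y \<in> {0<..\<alpha>}#}"
          unfolding nonempty_has_size One_nat_def Suc_le_eq .
        then have "(of_nat 1 :: ennreal) \<le> of_nat (size {#y \<in># C i \<omega>. X i \<omega> + y \<in> {0<..\<alpha>}#})" by (rule of_nat_mono)
        then show "(1::ennreal) \<le> of_nat (size {#y \<in># C i \<omega>. X i \<omega> + y \<in> {0<..\<alpha>}#})" by simp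
      qed
      also have "\<dots> \<le> count \<omega> \<alpha>" unfolding cluster_process_count_def by (rule sum_le_suminf) (use F in auto)
      finally show ?thesis .
    qed
    moreover obtain n where "count \<omega> \<alpha> < of_nat n" using fin by (metis ennreal_Ex_less_of_nat infinity_ennreal_def)
    ultimately show False by (meson leD)
  qed
  have eq: "scaled_count_path X C \<alpha> \<omega> t = (\<Sum>i\<in>I. ?g i t) / \<alpha>" if t: "t \<in> {0..1}" for t
  proof -
    have "\<alpha> * t \<le> \<alpha> * 1" using t \<alpha> by (intro mult_left_mono) auto
    then have sub: "{0<..\<alpha> * t} \<subseteq> {0<..\<alpha>}" by auto
    have "{#y \<in># C i \<omega>. X i \<omega> + y \<in> {0<..\<alpha> * t}#} = {#}" if "i \<notin> I" for i
    proof -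
      have "{#y \<in># C i \<omega>. X i \<omega> + y \<in> {0<..\<alpha>}#} = {#}" using that unfolding I_def by blast
      then show ?thesis using sub unfolding set_mset_eq_empty_iff[symmetric] set_mset_filter by blast
    qed
    then have "count \<omega> (\<alpha> * t) = (\<Sum>i\<in>I. of_nat (size {#y \<in># C i \<omega>. X i \<omega> + y \<in> {0<..\<alpha> * t}#}))"
      unfolding cluster_process_count_def by (intro suminf_finite[OF finI]) simp
    then have "enn2real (count \<omega> (\<alpha> * t)) = (\<Sum>i\<in>I. ?g i t)"
      by (simp add: ennreal_of_nat_eq_real_of_nat sum_nonneg)
    then show ?thesis using t by (simp add: scaled_count_path_def)
  qed
  have P: "P (\<lambda>t. \<Sum>i\<in>I. ?g i t)" by (rule Psum[OF finI])
  let ?V = "scaled_count_path X C \<alpha> \<omega>" and ?h = "\<lambda>t. (\<Sum>i\<in>I. ?g i t) / \<alpha>"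
  have r: "(?V \<longlongrightarrow> ?V t) (at_right t)" if t: "t \<in> {0..<1}" for t
  proof -
    have "(?h \<longlongrightarrow> ?h t) (at_right t)" using P \<alpha> unfolding P_def by (intro tendsto_divide tendsto_const) auto
    moreover have "\<forall>\<^sub>F s in at_right t. ?h s = ?V s"
      by (rule eventually_mono[OF eventually_at_right_real[of t 1]]) (use t eq in auto)
    ultimately have "(?V \<longlongrightarrow> ?h t) (at_right t)" by (rule Lim_transform_eventually)
    then show ?thesis using eq[of t] t by simp
  qed
  have l: "\<exists>l. (?V \<longlongrightarrow> l) (at_left t)" if t: "t \<in> {0<..1}" for t
  proof -
    obtain l where "((\<lambda>t. \<Sum>i\<in>I. ?g i t) \<longlongrightarrow> l) (at_left t)" using P unfolding P_def by blast
    then have "(?h \<longlongrightarrow> l / \<alpha>) (at_left t)" using \<alpha> by (intro tendsto_divide tendsto_const) auto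
    moreover have "\<forall>\<^sub>F s in at_left t. ?h s = ?V s"
      by (rule eventually_mono[OF eventually_at_left_real[of 0 t]]) (use t eq in auto)
    ultimately have "(?V \<longlongrightarrow> l / \<alpha>) (at_left t)" by (rule Lim_transform_eventually)
    then show ?thesis by blast
  qed
  show ?thesis unfolding cadlag_space_def using r l by (auto simp: scaled_count_path_def)
qed

end

section \<open>Estimates on a grid\<close>

context exponential_cluster_process begin

definition cell :: "real \<Rightarrow> nat \<Rightarrow> nat \<Rightarrow> real set" where
  "cell \<alpha> n j = {\<alpha> * (real j / real n)<..\<alpha> * (real (Suc j) / real n)}"

definition cell_mass :: "real \<Rightarrow> nat \<Rightarrow> nat \<Rightarrow> 'w \<Rightarrow> real" where
  "cell_mass \<alpha> n j \<omega> = enn2real (marked_sum (\<lambda>m. real (size m)) (cell \<alpha> n j) \<omega>)"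

lemma cell_mass_measurable [measurable]: "cell_mass \<alpha> n j \<in> borel_measurable M"
  unfolding cell_mass_def cell_def by measurable

lemma cell_borel: "cell \<alpha> n j \<in> sets borel" "bounded (cell \<alpha> n j)"
  by (auto simp: cell_def)

lemma cell_disjoint: 
  assumes "\<alpha> > 0"
  shows "disjoint_family_on (cell \<alpha> n) I"
  unfolding disjoint_family_on_def
proof (intro ballI impI)
  fix i j :: nat assume "i \<noteq> j"
  then have "real (Suc i) / real n \<le> real j / real n \<or> real (Suc j) / real n \<le> real i / real n"
    by (cases "i < j") (auto intro!: divide_right_mono)
  then have "\<alpha> * (real (Suc i) / real n) \<le> \<alpha> * (real j / real n) \<or> \<alpha> * (real (Suc j) / real n) \<le> \<alpha> * (real i / real n)"
    using mult_left_mono[OF _ less_imp_le[OF assms]] by blast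
  then show "cell \<alpha> n i \<inter> cell \<alpha> n j = {}" by (auto simp: cell_def)
qed

lemma measure_cell:
  assumes "\<alpha> > 0" "n > 0"
  shows "measure lborel (cell \<alpha> n j) = \<alpha> / real n"
proof -
  have "\<alpha> * (real (Suc j) / real n) - \<alpha> * (real j / real n) = \<alpha> / real n"
    by (simp add: add_divide_distrib distrib_left)
  moreover have "\<alpha> * (real j / real n) \<le> \<alpha> * (real (Suc j) / real n)"
    using assms by (intro mult_left_mono divide_right_mono) auto
  ultimately show ?thesis by (simp add: cell_def)
qed

lemma cell_mass_exp_moment:
  assumes "\<alpha> > 0" "n > 0"
  shows "(\<integral>\<^sup>+\<omega>. ennreal (exp (\<Sum>j<n. \<theta> j * cell_mass \<alpha> n j \<omega>)) \<partial>M) = ennreal (exp (\<alpha> * (\<Sum>j<n. Lam (\<theta> j) / real n)))"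
proof -
  have "(\<integral>\<^sup>+\<omega>. ennreal (exp (\<Sum>j<n. \<theta> j * cell_mass \<alpha> n j \<omega>)) \<partial>M)
    = ennreal (exp (\<Sum>j<n. \<nu> * measure lborel (cell \<alpha> n j) * ((\<integral>m. exp (\<theta> j * real (size m)) \<partial>Q) - 1)))"
    unfolding cell_mass_def
    by (rule marked_sum_exp_moment[where s = "\<lambda>_ m. real (size m)"])
       (use assms cell_borel cell_disjoint size_exp in \<open>auto simp: measure_cell\<close>)
  also have "(\<Sum>j<n. \<nu> * measure lborel (cell \<alpha> n j) * ((\<integral>m. exp (\<theta> j * real (size m)) \<partial>Q) - 1))
    = \<alpha> * (\<Sum>j<n. Lam (\<theta> j) / real n)"
    unfolding sum_distrib_left using assms by (intro sum.cong refl) (simp add: measure_cell Lam_eq)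
  finally show ?thesis .
qed

lemma AE_cell_mass_nat: "AE \<omega> in M. \<forall>j. cell_mass \<alpha> n j \<omega> \<in> \<nat>"
  unfolding AE_all_countable
proof
  fix j
  have "AE \<omega> in M. finite {i. X i \<omega> \<in> cell \<alpha> n j}" by (rule AE_finite_points[OF cell_borel])
  then show "AE \<omega> in M. cell_mass \<alpha> n j \<omega> \<in> \<nat>"
    by eventually_elim (simp add: cell_mass_def marked_sum_eq sum_nonneg flip: of_nat_sum)
qed

lemma sum_cell_mass:
  assumes \<alpha>: "\<alpha> > 0" and n: "n > 0"
  shows "AE \<omega> in M. \<forall>j. enn2real (total \<omega> (\<alpha> * (real j / real n))) = (\<Sum>i<j. cell_mass \<alpha> n i \<omega>)"
  unfolding AE_all_countable
proof
  fix j
  have "AE \<omega> in M. finite {i. X i \<omega> \<in> {0<..\<alpha> * (real j / real n)}}" by (rule AE_finite_points) auto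
  then show "AE \<omega> in M. enn2real (total \<omega> (\<alpha> * (real j / real n))) = (\<Sum>i<j. cell_mass \<alpha> n i \<omega>)"
  proof eventually_elim
    case (elim \<omega>)
    have U: "{0<..\<alpha> * (real k / real n)} = (\<Union>i<k. cell \<alpha> n i)" for k
    proof (induction k)
      case (Suc k)
      have "{0<..\<alpha> * (real (Suc k) / real n)} = {0<..\<alpha> * (real k / real n)} \<union> cell \<alpha> n k"
      proof -
        have "0 \<le> \<alpha> * (real k / real n)" "\<alpha> * (real k / real n) \<le> \<alpha> * (real (Suc k) / real n)"
          using \<alpha> by (auto intro!: mult_left_mono divide_right_mono)
        then show ?thesis unfolding cell_def by (rule ivl_disj_un_two(6)[symmetric])
      qed
      then show ?case using Suc by (simp add: lessThan_Suc Un_commute)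
    qed simp
    have fin: "finite {l. X l \<omega> \<in> cell \<alpha> n i}" if "i < j" for i
    proof (rule finite_subset[OF _ elim])
      show "{l. X l \<omega> \<in> cell \<alpha> n i} \<subseteq> {l. X l \<omega> \<in> {0<..\<alpha> * (real j / real n)}}"
        unfolding U using that by blast
    qed
    have "{l. X l \<omega> \<in> {0<..\<alpha> * (real j / real n)}} = (\<Union>i<j. {l. X l \<omega> \<in> cell \<alpha> n i})" unfolding U by auto
    then have "(\<Sum>l\<in>{l. X l \<omega> \<in> {0<..\<alpha> * (real j / real n)}}. real (size (C l \<omega>)))
      = (\<Sum>l\<in>(\<Union>i<j. {l. X l \<omega> \<in> cell \<alpha> n i}). real (size (C l \<omega>)))" by simp
    also have "\<dots> = (\<Sum>i<j. \<Sum>l\<in>{l. X l \<omega> \<in> cell \<alpha> n i}. real (size (C l \<omega>)))"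
      using fin cell_disjoint[OF \<alpha>, of n UNIV] by (intro sum.UNION_disjoint) (auto simp: disjoint_family_on_def)
    also have "\<dots> = (\<Sum>i<j. cell_mass \<alpha> n i \<omega>)"
      using fin by (intro sum.cong refl) (simp add: cell_mass_def marked_sum_eq sum_nonneg)
    finally have eq: "(\<Sum>l\<in>{l. X l \<omega> \<in> {0<..\<alpha> * (real j / real n)}}. real (size (C l \<omega>))) = (\<Sum>i<j. cell_mass \<alpha> n i \<omega>)" .
    have "0 \<le> (\<Sum>i<j. cell_mass \<alpha> n i \<omega>)" by (intro sum_nonneg) (simp add: cell_mass_def)
    moreover have "total \<omega> (\<alpha> * (real j / real n)) = ennreal (\<Sum>i<j. cell_mass \<alpha> n i \<omega>)"
      unfolding eq[symmetric] by (rule marked_sum_eq[OF elim]) simp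
    ultimately show ?case by simp
  qed
qed

lemma exp_mult_prob_le:
  assumes "\<alpha> > 0" "n > 0" and E [measurable]: "E \<in> sets M"
    and le: "\<And>\<omega>. \<omega> \<in> E \<Longrightarrow> c \<le> (\<Sum>j<n. \<theta> j * cell_mass \<alpha> n j \<omega>)"
  shows "emeasure M E \<le> ennreal (exp (\<alpha> * (\<Sum>j<n. Lam (\<theta> j) / real n) - c))"
proof -
  have "ennreal (exp c) * emeasure M E = (\<integral>\<^sup>+\<omega>. ennreal (exp c) * indicator E \<omega> \<partial>M)"
    by (rule nn_integral_cmult_indicator[symmetric]) measurable
  also have "\<dots> \<le> (\<integral>\<^sup>+\<omega>. ennreal (exp (\<Sum>j<n. \<theta> j * cell_mass \<alpha> n j \<omega>)) \<partial>M)"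
    by (intro nn_integral_mono) (auto simp: indicator_def le intro!: ennreal_leI)
  also have "\<dots> = ennreal (exp (\<alpha> * (\<Sum>j<n. Lam (\<theta> j) / real n)))" by (rule cell_mass_exp_moment) (use assms in auto)
  finally have "exp c * prob E \<le> exp (\<alpha> * (\<Sum>j<n. Lam (\<theta> j) / real n))"
    by (simp add: emeasure_eq_measure ennreal_mult[symmetric])
  then have "prob E \<le> exp (\<alpha> * (\<Sum>j<n. Lam (\<theta> j) / real n)) / exp c" by (simp add: pos_le_divide_eq mult.commute)
  also have "\<dots> = exp (\<alpha> * (\<Sum>j<n. Lam (\<theta> j) / real n) - c)" by (simp add: exp_diff)
  finally show ?thesis by (simp add: emeasure_eq_measure)
qed

lemma large_cell_mass:
  assumes "\<alpha> > 0" "j < n"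
  shows "emeasure M {\<omega> \<in> space M. \<alpha> * K < cell_mass \<alpha> n j \<omega>} \<le> ennreal (exp (\<alpha> * (Lam 1 / real n - K)))"
proof -
  let ?\<theta> = "\<lambda>i. if i = j then 1 else 0 :: real"
  have s: "(\<Sum>i<n. Lam (?\<theta> i) / real n) = Lam 1 / real n"
    using assms by (simp add: if_distrib[where f = Lam] if_distrib[where f = "\<lambda>x. x / real n"] Lam_0 cong: if_cong)
  have "emeasure M {\<omega> \<in> space M. \<alpha> * K < cell_mass \<alpha> n j \<omega>} \<le> ennreal (exp (\<alpha> * (\<Sum>i<n. Lam (?\<theta> i) / real n) - \<alpha> * K))"
    by (rule exp_mult_prob_le) (use assms in \<open>auto simp: if_distrib[where f = "\<lambda>x. x * _"] cong: if_cong\<close>)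
  then show ?thesis unfolding s by (simp add: right_diff_distrib)
qed

text \<open>The left side counts the events in the union bound of \<open>grid_upper_bound\<close>:
  \<open>n\<close> events of excessive mass and at most \<open>(K * \<alpha> + 1) ^ n\<close>
  lattice values.\<close>

lemma eventually_polynomial_le_exp:
  fixes K d :: real and n :: nat
  assumes "d > 0" "K \<ge> 0"
  shows "eventually (\<lambda>\<alpha>. real n + (K * \<alpha> + 1) ^ n \<le> exp (\<alpha> * d)) at_top"
proof -
  \<comment> \<open>For \<open>\<alpha> \<ge> 1\<close> this gives
    \<open>K * \<alpha> + 1 \<le> c * (\<alpha> * d)\<close>, so all powers are taken of the
    exponent \<open>\<alpha> * d\<close> itself.\<close>
  define c where "c = (K + 1) / d"
  have c: "c \<ge> 0" using assms by (simp add: c_def)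
  have lim: "filterlim (\<lambda>\<alpha>. \<alpha> * d) at_top at_top"
    using assms by (intro filterlim_at_top_mult_tendsto_pos[OF tendsto_const _ filterlim_ident])
  have "((\<lambda>\<alpha>. real n * ((\<alpha> * d) ^ 0 / exp (\<alpha> * d)) + c ^ n * ((\<alpha> * d) ^ n / exp (\<alpha> * d))) \<longlongrightarrow> real n * 0 + c ^ n * 0) at_top"
    by (intro tendsto_add tendsto_mult tendsto_const filterlim_compose[OF tendsto_power_div_exp_0 lim])
  then have "eventually (\<lambda>\<alpha>. real n * ((\<alpha> * d) ^ 0 / exp (\<alpha> * d)) + c ^ n * ((\<alpha> * d) ^ n / exp (\<alpha> * d)) < 1) at_top"
    by (rule order_tendstoD) simp
  then show ?thesis using eventually_ge_at_top[of 1]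
  proof eventually_elim
    case (elim \<alpha>)
    have "(real n * ((\<alpha> * d) ^ 0 / exp (\<alpha> * d)) + c ^ n * ((\<alpha> * d) ^ n / exp (\<alpha> * d))) * exp (\<alpha> * d) \<le> 1 * exp (\<alpha> * d)"
      using elim by (intro mult_right_mono) auto
    then have "real n + (c * (\<alpha> * d)) ^ n \<le> exp (\<alpha> * d)" by (simp add: distrib_right power_mult_distrib)
    moreover have "K * \<alpha> + 1 \<le> c * (\<alpha> * d)"
    proof -
      have "c * (\<alpha> * d) = (K + 1) * \<alpha>" using assms by (simp add: c_def)
      then show ?thesis using elim by (simp add: distrib_right)
    qed
    then have "(K * \<alpha> + 1) ^ n \<le> (c * (\<alpha> * d)) ^ n" using elim assms by (intro power_mono) auto
    ultimately show ?case by linarith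
  qed
qed

text \<open>The offending \<open>\<theta>\<close> may vary with \<open>\<omega>\<close>, so
  Chernoff's inequality cannot be applied to the whole event. The masses are integers: each lattice
  value has a fixed \<open>\<theta>\<close> of its own, and a union bound costs only a polynomial
  factor, absorbed by \<open>d\<close>.\<close>

lemma grid_upper_bound:
  assumes n: "n > 0" and a: "a \<ge> 0" and d: "d > 0"
  shows "eventually (\<lambda>\<alpha>. \<exists>U\<in>sets M. emeasure M U \<le> ennreal (exp (- \<alpha> * (a - d))) \<and>
    (AE \<omega> in M. (\<exists>\<theta>. a < (\<Sum>j<n. \<theta> j * (cell_mass \<alpha> n j \<omega> / \<alpha>) - Lam (\<theta> j) / real n)) \<longrightarrow> \<omega> \<in> U)) at_top"
proof -
  \<comment> \<open>With this threshold Chernoff's inequality at \<open>\<theta> = 1\<close> makes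
    each cell exceed \<open>\<alpha> * K\<close> with probability at most
    \<open>exp (- \<alpha> * a)\<close>.\<close>
  define K where "K = a + \<bar>Lam 1\<bar>"
  have K: "K \<ge> 0" using a by (simp add: K_def)
  show ?thesis using eventually_polynomial_le_exp[OF d K, of n] eventually_gt_at_top[of 0]
  proof eventually_elim
    case (elim \<alpha>)
    then have \<alpha>: "\<alpha> > 0" by simp
    let ?Z = "cell_mass \<alpha> n"
    let ?\<Phi> = "\<lambda>\<theta> z. \<Sum>j<n. \<theta> j * (z j / \<alpha>) - Lam (\<theta> j) / real n"
    define B where "B j = {\<omega> \<in> space M. \<alpha> * K < ?Z j \<omega>}" for j
    \<comment> \<open>The lattice values below the threshold that violate the constraint for some
      \<open>\<theta>\<close>; \<open>PiE\<close> makes the coordinates beyond \<open>n\<close>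
      irrelevant and the set finite.\<close>
    define S where "S = {k \<in> PiE {..<n} (\<lambda>_. {..nat \<lfloor>\<alpha> * K\<rfloor>}). \<exists>\<theta>. a < ?\<Phi> \<theta> (\<lambda>j. real (k j))}"
    define E where "E k = {\<omega> \<in> space M. \<forall>j<n. ?Z j \<omega> = real (k j)}" for k
    have [measurable]: "B j \<in> sets M" "E k \<in> sets M" for j k unfolding B_def E_def by measurable
    have finS: "finite S" unfolding S_def by (intro finite_subset[OF Collect_subset] finite_PiE) auto
    have "card S \<le> card (PiE {..<n} (\<lambda>_. {..nat \<lfloor>\<alpha> * K\<rfloor>}))"
      unfolding S_def by (intro card_mono finite_PiE) auto
    also have "\<dots> = Suc (nat \<lfloor>\<alpha> * K\<rfloor>) ^ n" by (simp add: card_PiE)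
    finally have "real (card S) \<le> real (Suc (nat \<lfloor>\<alpha> * K\<rfloor>) ^ n)" by (rule of_nat_mono)
    also have "\<dots> = real (Suc (nat \<lfloor>\<alpha> * K\<rfloor>)) ^ n" by (rule of_nat_power)
    also have "\<dots> \<le> (K * \<alpha> + 1) ^ n"
    proof (rule power_mono)
      have "0 \<le> \<alpha> * K" using \<alpha> K by simp
      then show "real (Suc (nat \<lfloor>\<alpha> * K\<rfloor>)) \<le> K * \<alpha> + 1" by (simp add: mult.commute)
    qed simp
    finally have cardS: "real (card S) \<le> (K * \<alpha> + 1) ^ n" .
    have PB: "prob (B j) \<le> exp (- \<alpha> * a)" if "j < n" for j
    proof -
      have "Lam 1 / real n \<le> \<bar>Lam 1\<bar>"
      proof -
        have "Lam 1 / real n \<le> \<bar>Lam 1\<bar> / real n" by (intro divide_right_mono) auto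
        also have "\<dots> \<le> \<bar>Lam 1\<bar>" using n by (simp add: divide_le_eq mult_le_cancel_left1)
        finally show ?thesis .
      qed
      then have "\<alpha> * (Lam 1 / real n - K) \<le> \<alpha> * (- a)" using \<alpha> by (intro mult_left_mono) (auto simp: K_def)
      then have "exp (\<alpha> * (Lam 1 / real n - K)) \<le> exp (- \<alpha> * a)" by simp
      moreover have "prob (B j) \<le> exp (\<alpha> * (Lam 1 / real n - K))"
        using large_cell_mass[OF \<alpha> that, of K] by (simp add: B_def emeasure_eq_measure)
      ultimately show ?thesis by linarith
    qed
    have PE: "prob (E k) \<le> exp (- \<alpha> * a)" if k: "k \<in> S" for k
    proof -
      obtain \<theta> where \<theta>: "a < ?\<Phi> \<theta> (\<lambda>j. real (k j))" using k by (auto simp: S_def)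
      have "emeasure M (E k) \<le> ennreal (exp (\<alpha> * (\<Sum>j<n. Lam (\<theta> j) / real n) - (\<Sum>j<n. \<theta> j * real (k j))))"
        by (rule exp_mult_prob_le) (use \<alpha> n in \<open>auto simp: E_def\<close>)
      then have "prob (E k) \<le> exp (\<alpha> * (\<Sum>j<n. Lam (\<theta> j) / real n) - (\<Sum>j<n. \<theta> j * real (k j)))"
        by (simp add: emeasure_eq_measure)
      moreover have "\<alpha> * (\<Sum>j<n. Lam (\<theta> j) / real n) - (\<Sum>j<n. \<theta> j * real (k j)) = - \<alpha> * ?\<Phi> \<theta> (\<lambda>j. real (k j))"
      proof -
        have "\<alpha> * ?\<Phi> \<theta> (\<lambda>j. real (k j)) = (\<Sum>j<n. \<theta> j * real (k j) - \<alpha> * (Lam (\<theta> j) / real n))"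
          unfolding sum_distrib_left using \<alpha> by (intro sum.cong refl) (simp add: right_diff_distrib)
        then show ?thesis by (simp add: sum_subtractf sum_distrib_left)
      qed
      moreover have "- \<alpha> * ?\<Phi> \<theta> (\<lambda>j. real (k j)) \<le> - \<alpha> * a" using \<theta> \<alpha> by (intro mult_left_mono_neg) auto
      ultimately show ?thesis by (metis exp_le_cancel_iff order_trans)
    qed
    let ?U = "(\<Union>j<n. B j) \<union> (\<Union>k\<in>S. E k)"
    have Um: "?U \<in> sets M" using finS by (intro sets.Un sets.finite_UN) auto
    have "prob ?U \<le> prob (\<Union>j<n. B j) + prob (\<Union>k\<in>S. E k)"
      using finS by (intro measure_Un_le sets.finite_UN) auto
    also have "\<dots> \<le> (\<Sum>j<n. prob (B j)) + (\<Sum>k\<in>S. prob (E k))"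
      using finS by (intro add_mono finite_measure_subadditive_finite) auto
    also have "\<dots> \<le> (\<Sum>j<n. exp (- \<alpha> * a)) + (\<Sum>k\<in>S. exp (- \<alpha> * a))"
      by (intro add_mono sum_mono PB PE) auto
    also have "\<dots> = (real n + real (card S)) * exp (- \<alpha> * a)" by (simp add: distrib_right)
    also have "\<dots> \<le> exp (\<alpha> * d) * exp (- \<alpha> * a)" using elim(1) cardS by (intro mult_right_mono) auto
    also have "\<dots> = exp (- \<alpha> * (a - d))" by (simp add: exp_add[symmetric] algebra_simps)
    finally have PU: "emeasure M ?U \<le> ennreal (exp (- \<alpha> * (a - d)))" by (simp add: emeasure_eq_measure)
    have "AE \<omega> in M. (\<exists>\<theta>. a < ?\<Phi> \<theta> (\<lambda>j. ?Z j \<omega>)) \<longrightarrow> \<omega> \<in> ?U"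
      using AE_cell_mass_nat[of \<alpha> n] AE_space
    proof eventually_elim
      case (elim \<omega>)
      show ?case
      proof (intro impI, rule ccontr)
        assume ex: "\<exists>\<theta>. a < ?\<Phi> \<theta> (\<lambda>j. ?Z j \<omega>)" and nU: "\<omega> \<notin> ?U"
        have "\<forall>j. \<exists>m. ?Z j \<omega> = real m" using elim(1) unfolding Nats_def by blast
        then obtain k0 where k0: "\<And>j. ?Z j \<omega> = real (k0 j)" by metis
        define k where "k = restrict k0 {..<n}"
        have k: "?Z j \<omega> = real (k j)" if "j < n" for j using k0 that by (simp add: k_def)
        have "k \<in> S" unfolding S_def
        proof (intro CollectI conjI)
          have "k0 j \<le> nat \<lfloor>\<alpha> * K\<rfloor>" if "j < n" for j
          proof -
            have "?Z j \<omega> \<le> \<alpha> * K" using nU that elim(2) by (auto simp: B_def not_less)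
            then have "real (k0 j) \<le> \<alpha> * K" unfolding k0 .
            then show ?thesis by (simp add: le_nat_floor)
          qed
          then show "k \<in> PiE {..<n} (\<lambda>_. {..nat \<lfloor>\<alpha> * K\<rfloor>})" by (auto simp: k_def)
          have "?\<Phi> \<theta> (\<lambda>j. real (k j)) = ?\<Phi> \<theta> (\<lambda>j. ?Z j \<omega>)" for \<theta>
            by (intro sum.cong refl) (simp add: k)
          then show "\<exists>\<theta>. a < ?\<Phi> \<theta> (\<lambda>j. real (k j))" using ex by simp
        qed
        moreover have "\<omega> \<in> E k" using elim(2) k by (auto simp: E_def)
        ultimately show False using nU by blast
      qed
    qed
    with Um PU show ?case by blast
  qed
qed

text \<open>All exponential moments of the crossing sums are available, so \<open>\<theta>\<close>
  can be chosen after \<open>b\<close>. The comparison therefore fails with a probability below any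
  prescribed exponential rate.\<close>

lemma grid_approximation:
  assumes n: "n > 0" and \<kappa>: "\<kappa> > 0"
  shows "eventually (\<lambda>\<alpha>. \<exists>U\<in>sets M. emeasure M U \<le> ennreal (exp (- \<alpha> * b)) \<and>
    (AE \<omega> in M. \<omega> \<notin> U \<longrightarrow> (\<forall>j\<le>n. \<bar>enn2real (count \<omega> (\<alpha> * (real j / real n))) / \<alpha> - (\<Sum>i<j. cell_mass \<alpha> n i \<omega>) / \<alpha>\<bar> \<le> \<kappa>))) at_top"
proof -
  \<comment> \<open>Each of the two crossing sums is allowed \<open>\<alpha> * \<kappa> / 2\<close>,
    so the exponent is \<open>\<alpha> * (\<bar>b\<bar> + 1)\<close>. The extra
    \<open>\<alpha>\<close> absorbs \<open>crossing_bound \<theta>\<close> and the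
    \<open>n + 1\<close> events.\<close>
  define \<theta> where "\<theta> = 2 * (\<bar>b\<bar> + 1) / \<kappa>"
  have \<theta>: "\<theta> \<ge> 0" using \<kappa> by (simp add: \<theta>_def)
  show ?thesis using eventually_ge_at_top[of "crossing_bound \<theta> + ln (real n + 1)"] eventually_gt_at_top[of 0]
  proof eventually_elim
    case (elim \<alpha>)
    then have \<alpha>: "\<alpha> > 0" by simp
    let ?t = "\<lambda>j. \<alpha> * (real j / real n)"
    have t0: "0 \<le> ?t j" for j using \<alpha> by simp
    define E where "E j = {\<omega> \<in> space M. ennreal (\<alpha> * \<kappa> / 2) < crossing (?t j) \<omega>}" for j
    have [measurable]: "E j \<in> sets M" for j unfolding E_def by measurable
    have PE: "prob (E j) \<le> exp (crossing_bound \<theta> - \<alpha> * (\<bar>b\<bar> + 1))" for j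
    proof -
      have "emeasure M (E j) \<le> ennreal (exp (crossing_bound \<theta> - \<theta> * (\<alpha> * \<kappa> / 2)))"
        unfolding E_def by (rule crossing_tail) (use \<theta> \<alpha> \<kappa> in auto)
      also have "\<theta> * (\<alpha> * \<kappa> / 2) = \<alpha> * (\<bar>b\<bar> + 1)" using \<kappa> by (simp add: \<theta>_def field_simps)
      finally show ?thesis by (simp add: emeasure_eq_measure)
    qed
    let ?U = "\<Union>j\<le>n. E j"
    have Um: "?U \<in> sets M" by (intro sets.finite_UN) auto
    have "prob ?U \<le> (\<Sum>j\<le>n. prob (E j))" by (intro finite_measure_subadditive_finite) auto
    also have "\<dots> \<le> (\<Sum>j\<le>n. exp (crossing_bound \<theta> - \<alpha> * (\<bar>b\<bar> + 1)))" by (intro sum_mono PE)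
    also have "\<dots> = exp (ln (real n + 1)) * exp (crossing_bound \<theta> - \<alpha> * (\<bar>b\<bar> + 1))" by simp
    also have "\<dots> = exp (ln (real n + 1) + crossing_bound \<theta> - \<alpha> * (\<bar>b\<bar> + 1))" by (simp only: exp_add[symmetric] add_diff_eq)
    also have "\<dots> \<le> exp (- \<alpha> * b)"
    proof (unfold exp_le_cancel_iff)
      have "\<alpha> * b \<le> \<alpha> * \<bar>b\<bar>" using \<alpha> by (intro mult_left_mono) auto
      then show "ln (real n + 1) + crossing_bound \<theta> - \<alpha> * (\<bar>b\<bar> + 1) \<le> - \<alpha> * b"
        using elim(1) by (simp add: distrib_left)
    qed
    finally have PU: "emeasure M ?U \<le> ennreal (exp (- \<alpha> * b))" by (simp add: emeasure_eq_measure)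
    have cf: "AE \<omega> in M. \<forall>j. count \<omega> (?t j) < \<infinity>" "AE \<omega> in M. \<forall>j. total \<omega> (?t j) < \<infinity>"
      unfolding AE_all_countable using AE_count_finite[OF t0] AE_total_finite by blast+
    have "AE \<omega> in M. \<omega> \<notin> ?U \<longrightarrow> (\<forall>j\<le>n. \<bar>enn2real (count \<omega> (?t j)) / \<alpha> - (\<Sum>i<j. cell_mass \<alpha> n i \<omega>) / \<alpha>\<bar> \<le> \<kappa>)"
      using cf sum_cell_mass[OF \<alpha> n] AE_space
    proof eventually_elim
      case (elim \<omega>)
      show ?case
      proof (intro impI allI)
        fix j assume nU: "\<omega> \<notin> ?U" and j: "j \<le> n"
        have r: "crossing (?t i) \<omega> \<le> ennreal (\<alpha> * \<kappa> / 2)" if "i \<le> n" for i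
          using nU that elim(4) by (auto simp: E_def not_less)
        have "crossing 0 \<omega> \<le> ennreal (\<alpha> * \<kappa> / 2)" using r[of 0] by simp
        then have rr: "crossing 0 \<omega> + crossing (?t j) \<omega> \<le> ennreal (\<alpha> * \<kappa> / 2) + ennreal (\<alpha> * \<kappa> / 2)"
          using r[OF j] by (rule add_mono)
        also have "\<dots> = ennreal (\<alpha> * \<kappa>)" using \<alpha> \<kappa> by (simp add: ennreal_plus[symmetric] del: ennreal_plus)
        finally have rr: "crossing 0 \<omega> + crossing (?t j) \<omega> \<le> ennreal (\<alpha> * \<kappa>)" .
        define N T where "N = enn2real (count \<omega> (?t j))" and "T = enn2real (total \<omega> (?t j))"
        have NT: "count \<omega> (?t j) = ennreal N" "total \<omega> (?t j) = ennreal T" "0 \<le> N" "0 \<le> T"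
          using elim(1,2) by (auto simp: N_def T_def less_top)
        have ak: "0 \<le> \<alpha> * \<kappa>" using \<alpha> \<kappa> by simp
        have "ennreal N \<le> ennreal T + ennreal (\<alpha> * \<kappa>)"
          using count_total_bounds(1)[OF t0[of j], of \<omega>] rr NT by (metis add.assoc add_left_mono order_trans)
        then have "N \<le> T + \<alpha> * \<kappa>" using NT ak by (simp add: ennreal_plus[symmetric] ennreal_le_iff del: ennreal_plus)
        moreover have "ennreal T \<le> ennreal N + ennreal (\<alpha> * \<kappa>)"
          using count_total_bounds(2)[OF t0[of j], of \<omega>] rr NT by (metis add.assoc add_left_mono order_trans)
        then have "T \<le> N + \<alpha> * \<kappa>" using NT ak by (simp add: ennreal_plus[symmetric] ennreal_le_iff del: ennreal_plus)
        ultimately have "\<bar>N - T\<bar> \<le> \<alpha> * \<kappa>" by linarith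
        then have "\<bar>N - T\<bar> / \<alpha> \<le> \<kappa>" using \<alpha> by (simp add: divide_le_eq mult.commute)
        moreover have "\<bar>N / \<alpha> - T / \<alpha>\<bar> = \<bar>N - T\<bar> / \<alpha>" using \<alpha> by (simp add: diff_divide_distrib[symmetric])
        moreover have "T = (\<Sum>i<j. cell_mass \<alpha> n i \<omega>)" using elim(3) by (simp add: T_def)
        ultimately show "\<bar>enn2real (count \<omega> (?t j)) / \<alpha> - (\<Sum>i<j. cell_mass \<alpha> n i \<omega>) / \<alpha>\<bar> \<le> \<kappa>"
          unfolding N_def by simp
      qed
    qed
    with Um PU show ?case by blast
  qed
qed

text \<open>Under the law tilted by \<open>W\<close> the masses concentrate near
  \<open>\<alpha> * (x j / n)\<close>, because \<open>x j\<close> is the derivative of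
  \<open>Lam\<close> at \<open>\<theta> j\<close>. Without changing the measure, the mean of
  \<open>W\<close> is split: on the good event \<open>W\<close> is at most \<open>exp D\<close>, and
  the bad events carry an exponentially small fraction of the mean.\<close>

lemma grid_lower_bound:
  assumes n: "n > 0" and \<kappa>: "\<kappa> > 0"
    and \<theta>: "\<And>j. (Lam has_real_derivative x j) (at (\<theta> j))"
  shows "eventually (\<lambda>\<alpha>. exp (- \<alpha> * ((\<Sum>j<n. \<theta> j * x j / real n - Lam (\<theta> j) / real n) + \<kappa> * (\<Sum>j<n. \<bar>\<theta> j\<bar>))) / 2
    \<le> prob {\<omega> \<in> space M. \<forall>j<n. \<bar>cell_mass \<alpha> n j \<omega> - \<alpha> * (x j / real n)\<bar> \<le> \<alpha> * \<kappa>}) at_top"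
proof -
  define L where "L = (\<Sum>j<n. Lam (\<theta> j) / real n)"
  define W where "W \<alpha> \<omega> = exp (\<Sum>j<n. \<theta> j * cell_mass \<alpha> n j \<omega>)" for \<alpha> \<omega>
  have [measurable]: "W \<alpha> \<in> borel_measurable M" for \<alpha> unfolding W_def by measurable
  \<comment> \<open>A further tilt by \<open>s * \<eta>\<close> in direction \<open>s = 1\<close> or
    \<open>s = -1\<close> costs at most \<open>\<eta> * (\<kappa> / 2)\<close> beyond the linear
    term, while a deviation by \<open>\<kappa>\<close> gains
    \<open>\<eta> * \<kappa>\<close>.\<close>
  have slope: "\<exists>\<eta>>0. Lam (\<theta> j + s * \<eta>) - Lam (\<theta> j) - s * \<eta> * x j \<le> \<eta> * (\<kappa> / 2)" if s: "\<bar>s\<bar> = 1" for j s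
  proof -
    have "(\<lambda>h. (Lam (\<theta> j + h) - Lam (\<theta> j)) / h) \<midarrow>0\<rightarrow> x j" using \<theta>[of j] by (simp add: DERIV_def)
    then have "\<forall>\<^sub>F h in at 0. dist ((Lam (\<theta> j + h) - Lam (\<theta> j)) / h) (x j) < \<kappa> / 2"
      using \<kappa> by (intro tendstoD) auto
    then obtain d where d: "d > 0" "\<And>h. h \<noteq> 0 \<Longrightarrow> \<bar>h\<bar> < d \<Longrightarrow> \<bar>(Lam (\<theta> j + h) - Lam (\<theta> j)) / h - x j\<bar> < \<kappa> / 2"
      unfolding eventually_at by (auto simp: dist_real_def)
    define \<eta> where "\<eta> = d / 2"
    have \<eta>: "\<eta> > 0" using d by (simp add: \<eta>_def)
    define h where "h = s * \<eta>"
    have h: "\<bar>h\<bar> = \<eta>" using s \<eta> by (simp add: h_def abs_mult)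
    have "h \<noteq> 0" "\<bar>h\<bar> < d" using h \<eta> d by (auto simp: \<eta>_def)
    then have "\<bar>(Lam (\<theta> j + h) - Lam (\<theta> j)) / h - x j\<bar> < \<kappa> / 2" by (rule d(2))
    then have "\<bar>h\<bar> * \<bar>(Lam (\<theta> j + h) - Lam (\<theta> j)) / h - x j\<bar> \<le> \<bar>h\<bar> * (\<kappa> / 2)" by (intro mult_left_mono) auto
    moreover have "\<bar>h\<bar> * \<bar>(Lam (\<theta> j + h) - Lam (\<theta> j)) / h - x j\<bar> = \<bar>Lam (\<theta> j + h) - Lam (\<theta> j) - h * x j\<bar>"
    proof -
      define A where "A = Lam (\<theta> j + h) - Lam (\<theta> j)"
      show ?thesis unfolding A_def[symmetric] abs_mult[symmetric] using \<open>h \<noteq> 0\<close> by (simp add: right_diff_distrib)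
    qed
    ultimately have "Lam (\<theta> j + h) - Lam (\<theta> j) - h * x j \<le> \<eta> * (\<kappa> / 2)" unfolding h by linarith
    then show ?thesis using \<eta> unfolding h_def by blast
  qed
  define bad where "bad \<alpha> j s = {\<omega> \<in> space M. \<alpha> * \<kappa> < s * (cell_mass \<alpha> n j \<omega> - \<alpha> * (x j / real n))}" for \<alpha> j s
  have [measurable]: "bad \<alpha> j s \<in> sets M" for \<alpha> j s unfolding bad_def by measurable
  have ex: "\<exists>c>0. \<forall>\<alpha>>0. (\<integral>\<^sup>+\<omega>. ennreal (W \<alpha> \<omega>) * indicator (bad \<alpha> j s) \<omega> \<partial>M) \<le> ennreal (exp (\<alpha> * L - \<alpha> * c))"
    if j: "j < n" and s: "\<bar>s\<bar> = 1" for j s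
  proof -
    obtain \<eta> where \<eta>: "\<eta> > 0" "Lam (\<theta> j + s * \<eta>) - Lam (\<theta> j) - s * \<eta> * x j \<le> \<eta> * (\<kappa> / 2)" using slope[OF s] by blast
    \<comment> \<open>Chernoff's inequality under the tilted law: shifting one coordinate multiplies
      the weight by a factor that is large on the bad event.\<close>
    define \<theta>' where "\<theta>' = \<theta>(j := \<theta> j + s * \<eta>)"
    have split: "(\<Sum>i<n. f (\<theta>' i) i) = (\<Sum>i<n. f (\<theta> i) i) + (f (\<theta> j + s * \<eta>) j - f (\<theta> j) j)" for f :: "real \<Rightarrow> nat \<Rightarrow> real"
    proof -
      have "(\<Sum>i<n. f (\<theta>' i) i) = f (\<theta>' j) j + (\<Sum>i\<in>{..<n} - {j}. f (\<theta>' i) i)" using j by (simp add: sum.remove)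
      also have "(\<Sum>i\<in>{..<n} - {j}. f (\<theta>' i) i) = (\<Sum>i\<in>{..<n} - {j}. f (\<theta> i) i)" by (intro sum.cong) (auto simp: \<theta>'_def)
      also have "\<dots> = (\<Sum>i<n. f (\<theta> i) i) - f (\<theta> j) j" using j by (simp add: sum.remove)
      finally show ?thesis by (simp add: \<theta>'_def)
    qed
    show ?thesis
    proof (intro exI[of _ "\<eta> * \<kappa> / 2"] conjI allI impI)
      show "0 < \<eta> * \<kappa> / 2" using \<eta> \<kappa> by simp
      fix \<alpha> :: real assume \<alpha>: "\<alpha> > 0"
      let ?c = "\<eta> * (\<alpha> * \<kappa> + s * \<alpha> * (x j / real n))"
      have "(\<integral>\<^sup>+\<omega>. ennreal (W \<alpha> \<omega>) * indicator (bad \<alpha> j s) \<omega> \<partial>M)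
        \<le> (\<integral>\<^sup>+\<omega>. ennreal (exp (- ?c)) * ennreal (exp (\<Sum>i<n. \<theta>' i * cell_mass \<alpha> n i \<omega>)) \<partial>M)"
      proof (rule nn_integral_mono)
        fix \<omega>
        show "ennreal (W \<alpha> \<omega>) * indicator (bad \<alpha> j s) \<omega> \<le> ennreal (exp (- ?c)) * ennreal (exp (\<Sum>i<n. \<theta>' i * cell_mass \<alpha> n i \<omega>))"
        proof (cases "\<omega> \<in> bad \<alpha> j s")
          case True
          then have "\<alpha> * \<kappa> \<le> s * (cell_mass \<alpha> n j \<omega> - \<alpha> * (x j / real n))" by (simp add: bad_def)
          then have "\<eta> * (\<alpha> * \<kappa>) \<le> \<eta> * (s * (cell_mass \<alpha> n j \<omega> - \<alpha> * (x j / real n)))" using \<eta> by (intro mult_left_mono) auto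
          then have "?c \<le> s * \<eta> * cell_mass \<alpha> n j \<omega>" by (simp add: algebra_simps)
          moreover have "(\<Sum>i<n. \<theta>' i * cell_mass \<alpha> n i \<omega>) = (\<Sum>i<n. \<theta> i * cell_mass \<alpha> n i \<omega>) + s * \<eta> * cell_mass \<alpha> n j \<omega>"
            using split[of "\<lambda>t i. t * cell_mass \<alpha> n i \<omega>"] by (simp add: distrib_right)
          ultimately have "(\<Sum>i<n. \<theta> i * cell_mass \<alpha> n i \<omega>) \<le> - ?c + (\<Sum>i<n. \<theta>' i * cell_mass \<alpha> n i \<omega>)" by linarith
          then have "W \<alpha> \<omega> \<le> exp (- ?c) * exp (\<Sum>i<n. \<theta>' i * cell_mass \<alpha> n i \<omega>)"
            unfolding W_def exp_add[symmetric] by simp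
          then show ?thesis using True by (simp add: ennreal_mult[symmetric] ennreal_leI)
        qed simp
      qed
      also have "\<dots> = ennreal (exp (- ?c)) * ennreal (exp (\<alpha> * (\<Sum>i<n. Lam (\<theta>' i) / real n)))"
        by (subst nn_integral_cmult) (use cell_mass_exp_moment[OF \<alpha> n, of \<theta>'] in auto)
      also have "\<dots> = ennreal (exp (\<alpha> * (\<Sum>i<n. Lam (\<theta>' i) / real n) - ?c))"
        by (simp add: ennreal_mult[symmetric] exp_add[symmetric])
      also have "\<dots> \<le> ennreal (exp (\<alpha> * L - \<alpha> * (\<eta> * \<kappa> / 2)))"
      proof (intro ennreal_leI, unfold exp_le_cancel_iff)
        have "(\<Sum>i<n. Lam (\<theta>' i) / real n) = L + (Lam (\<theta> j + s * \<eta>) - Lam (\<theta> j)) / real n"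
          unfolding L_def using split[of "\<lambda>t i. Lam t / real n"] by (simp add: diff_divide_distrib)
        also have "\<dots> \<le> L + (\<eta> * (\<kappa> / 2) + s * \<eta> * x j) / real n"
          using \<eta>(2) by (intro add_left_mono divide_right_mono) auto
        also have "\<dots> = L + \<eta> * (\<kappa> / 2) / real n + s * \<eta> * (x j / real n)" by (simp add: add_divide_distrib)
        also have "\<dots> \<le> L + \<eta> * (\<kappa> / 2) + s * \<eta> * (x j / real n)"
        proof -
          have "\<eta> * (\<kappa> / 2) / real n \<le> \<eta> * (\<kappa> / 2) / 1" using n \<eta> \<kappa> by (intro divide_left_mono) auto
          then show ?thesis by simp
        qed
        finally have "\<alpha> * (\<Sum>i<n. Lam (\<theta>' i) / real n) \<le> \<alpha> * (L + \<eta> * (\<kappa> / 2) + s * \<eta> * (x j / real n))"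
          using \<alpha> by (intro mult_left_mono) auto
        then show "\<alpha> * (\<Sum>i<n. Lam (\<theta>' i) / real n) - ?c \<le> \<alpha> * L - \<alpha> * (\<eta> * \<kappa> / 2)" by (simp add: algebra_simps)
      qed
      finally show "(\<integral>\<^sup>+\<omega>. ennreal (W \<alpha> \<omega>) * indicator (bad \<alpha> j s) \<omega> \<partial>M) \<le> ennreal (exp (\<alpha> * L - \<alpha> * (\<eta> * \<kappa> / 2)))" .
    qed
  qed
  \<comment> \<open>The rate \<open>c\<close> may depend on \<open>j\<close> and \<open>s\<close>
    but not on \<open>\<alpha>\<close>; it is fixed by choice so that finitely many decaying
    exponentials can be summed.\<close>
  define P where "P j s c \<longleftrightarrow> c > 0 \<and> (\<forall>\<alpha>>0. (\<integral>\<^sup>+\<omega>. ennreal (W \<alpha> \<omega>) * indicator (bad \<alpha> j s) \<omega> \<partial>M) \<le> ennreal (exp (\<alpha> * L - \<alpha> * c)))" for j s c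
  define c where "c j s = (SOME c. P j s c)" for j s
  have P: "P j s (c j s)" if "j < n" "s \<in> {1, -1}" for j s
  proof -
    have "\<bar>s\<bar> = 1" using that(2) by auto
    then have "\<exists>c. P j s c" using ex[OF that(1)] unfolding P_def by blast
    then show ?thesis unfolding c_def by (rule someI_ex)
  qed
  have c: "\<And>j s. j < n \<Longrightarrow> s \<in> {1, -1} \<Longrightarrow> c j s > 0"
    "\<And>j s \<alpha>. j < n \<Longrightarrow> s \<in> {1, -1} \<Longrightarrow> \<alpha> > 0 \<Longrightarrow>
      (\<integral>\<^sup>+\<omega>. ennreal (W \<alpha> \<omega>) * indicator (bad \<alpha> j s) \<omega> \<partial>M) \<le> ennreal (exp (\<alpha> * L - \<alpha> * c j s))"
    using P unfolding P_def by blast+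
  have "((\<lambda>\<alpha>. \<Sum>j<n. \<Sum>s\<in>{1, -1}. exp (- (\<alpha> * c j s))) \<longlongrightarrow> (\<Sum>j<n. \<Sum>s\<in>{1::real, -1}. 0)) at_top"
  proof (intro tendsto_sum)
    fix j s assume "j \<in> {..<n}" "s \<in> {1::real, -1}"
    then have "c j s > 0" using c(1) by simp
    then have "filterlim (\<lambda>\<alpha>. \<alpha> * c j s) at_top at_top"
      by (intro filterlim_at_top_mult_tendsto_pos[OF tendsto_const _ filterlim_ident])
    then have "filterlim (\<lambda>\<alpha>. - (\<alpha> * c j s)) at_bot at_top" by (simp add: filterlim_uminus_at_bot)
    then show "((\<lambda>\<alpha>. exp (- (\<alpha> * c j s))) \<longlongrightarrow> 0) at_top" by (rule filterlim_compose[OF exp_at_bot])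
  qed
  \<comment> \<open>At least half of the tilted mass thus remains on the good event, which is the
    origin of the division by 2 in the claim.\<close>
  then have "eventually (\<lambda>\<alpha>. (\<Sum>j<n. \<Sum>s\<in>{1, -1}. exp (- (\<alpha> * c j s))) < 1 / 2) at_top"
    by (rule order_tendstoD) simp
  then show ?thesis using eventually_gt_at_top[of 0]
  proof eventually_elim
    case (elim \<alpha>)
    then have \<alpha>: "\<alpha> > 0" by simp
    let ?G = "{\<omega> \<in> space M. \<forall>j<n. \<bar>cell_mass \<alpha> n j \<omega> - \<alpha> * (x j / real n)\<bar> \<le> \<alpha> * \<kappa>}"
    have [measurable]: "?G \<in> sets M" by measurable
    \<comment> \<open>Upper bound for the exponent of \<open>W\<close> on the good event.\<close>
    define D where "D = \<alpha> * ((\<Sum>j<n. \<theta> j * (x j / real n)) + \<kappa> * (\<Sum>j<n. \<bar>\<theta> j\<bar>))"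
    have "ennreal (exp (\<alpha> * L)) = (\<integral>\<^sup>+\<omega>. ennreal (W \<alpha> \<omega>) \<partial>M)"
      unfolding W_def L_def by (rule cell_mass_exp_moment[OF \<alpha> n, symmetric])
    also have "\<dots> \<le> (\<integral>\<^sup>+\<omega>. ennreal (exp D) * indicator ?G \<omega> + (\<Sum>j<n. \<Sum>s\<in>{1, -1}. ennreal (W \<alpha> \<omega>) * indicator (bad \<alpha> j s) \<omega>) \<partial>M)"
    proof (rule nn_integral_mono)
      fix \<omega> assume \<omega>: "\<omega> \<in> space M"
      show "ennreal (W \<alpha> \<omega>) \<le> ennreal (exp D) * indicator ?G \<omega> + (\<Sum>j<n. \<Sum>s\<in>{1, -1}. ennreal (W \<alpha> \<omega>) * indicator (bad \<alpha> j s) \<omega>)"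
      proof (cases "\<omega> \<in> ?G")
        case True
        have "(\<Sum>j<n. \<theta> j * cell_mass \<alpha> n j \<omega>) \<le> (\<Sum>j<n. \<alpha> * (\<theta> j * (x j / real n) + \<kappa> * \<bar>\<theta> j\<bar>))"
        proof (rule sum_mono)
          fix j assume "j \<in> {..<n}"
          then have "\<bar>cell_mass \<alpha> n j \<omega> - \<alpha> * (x j / real n)\<bar> \<le> \<alpha> * \<kappa>" using True by simp
          then have "\<bar>\<theta> j\<bar> * \<bar>cell_mass \<alpha> n j \<omega> - \<alpha> * (x j / real n)\<bar> \<le> \<bar>\<theta> j\<bar> * (\<alpha> * \<kappa>)" by (intro mult_left_mono) auto
          then have "\<theta> j * (cell_mass \<alpha> n j \<omega> - \<alpha> * (x j / real n)) \<le> \<bar>\<theta> j\<bar> * (\<alpha> * \<kappa>)"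
            unfolding abs_mult[symmetric] by linarith
          then show "\<theta> j * cell_mass \<alpha> n j \<omega> \<le> \<alpha> * (\<theta> j * (x j / real n) + \<kappa> * \<bar>\<theta> j\<bar>)" by (simp add: algebra_simps)
        qed
        also have "\<dots> = D" by (simp add: D_def sum_distrib_left sum.distrib distrib_left)
        finally have "ennreal (W \<alpha> \<omega>) \<le> ennreal (exp D)" unfolding W_def by (intro ennreal_leI) simp
        then show ?thesis using True by (simp add: add_increasing2)
      next
        case False
        then obtain j where j: "j < n" "\<alpha> * \<kappa> < \<bar>cell_mass \<alpha> n j \<omega> - \<alpha> * (x j / real n)\<bar>" using \<omega> by (auto simp: not_le)
        have "\<exists>s\<in>{1, -1}. \<omega> \<in> bad \<alpha> j s"
        proof (cases "0 \<le> cell_mass \<alpha> n j \<omega> - \<alpha> * (x j / real n)")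
          case True
          then have "\<omega> \<in> bad \<alpha> j 1" using \<omega> j(2) by (simp add: bad_def)
          then show ?thesis by blast
        next
          case False
          then have "\<omega> \<in> bad \<alpha> j (- 1)" using \<omega> j(2) by (simp add: bad_def)
          then show ?thesis by blast
        qed
        then obtain s where s: "s \<in> {1, -1}" "\<omega> \<in> bad \<alpha> j s" by blast
        have "ennreal (W \<alpha> \<omega>) = ennreal (W \<alpha> \<omega>) * indicator (bad \<alpha> j s) \<omega>" using s by simp
        also have "\<dots> \<le> (\<Sum>s\<in>{1, -1}. ennreal (W \<alpha> \<omega>) * indicator (bad \<alpha> j s) \<omega>)"
          by (rule member_le_sum[OF s(1)]) auto
        also have "\<dots> \<le> (\<Sum>j<n. \<Sum>s\<in>{1, -1}. ennreal (W \<alpha> \<omega>) * indicator (bad \<alpha> j s) \<omega>)"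
          by (rule member_le_sum[where f = "\<lambda>j. \<Sum>s\<in>{1, -1}. ennreal (W \<alpha> \<omega>) * indicator (bad \<alpha> j s) \<omega>"]) (use j in auto)
        finally show ?thesis using False by simp
      qed
    qed
    also have "\<dots> = ennreal (exp D) * emeasure M ?G + (\<Sum>j<n. \<Sum>s\<in>{1, -1}. \<integral>\<^sup>+\<omega>. ennreal (W \<alpha> \<omega>) * indicator (bad \<alpha> j s) \<omega> \<partial>M)"
    proof -
      have m: "(\<lambda>\<omega>. ennreal (W \<alpha> \<omega>) * indicator (bad \<alpha> j s) \<omega>) \<in> borel_measurable M" for j s by measurable
      have "(\<integral>\<^sup>+\<omega>. (\<Sum>j<n. \<Sum>s\<in>{1, -1}. ennreal (W \<alpha> \<omega>) * indicator (bad \<alpha> j s) \<omega>) \<partial>M)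
        = (\<Sum>j<n. \<integral>\<^sup>+\<omega>. (\<Sum>s\<in>{1, -1}. ennreal (W \<alpha> \<omega>) * indicator (bad \<alpha> j s) \<omega>) \<partial>M)"
        by (rule nn_integral_sum) (intro borel_measurable_sum m)
      also have "\<dots> = (\<Sum>j<n. \<Sum>s\<in>{1, -1}. \<integral>\<^sup>+\<omega>. ennreal (W \<alpha> \<omega>) * indicator (bad \<alpha> j s) \<omega> \<partial>M)"
        by (rule sum.cong[OF refl], rule nn_integral_sum, rule m)
      finally have S: "(\<integral>\<^sup>+\<omega>. (\<Sum>j<n. \<Sum>s\<in>{1, -1}. ennreal (W \<alpha> \<omega>) * indicator (bad \<alpha> j s) \<omega>) \<partial>M)
        = (\<Sum>j<n. \<Sum>s\<in>{1, -1}. \<integral>\<^sup>+\<omega>. ennreal (W \<alpha> \<omega>) * indicator (bad \<alpha> j s) \<omega> \<partial>M)" .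
      have G: "(\<integral>\<^sup>+\<omega>. ennreal (exp D) * indicator ?G \<omega> \<partial>M) = ennreal (exp D) * emeasure M ?G"
        by (rule nn_integral_cmult_indicator) measurable
      show ?thesis unfolding S[symmetric] G[symmetric]
      proof (rule nn_integral_add)
        show "(\<lambda>\<omega>. ennreal (exp D) * indicator ?G \<omega>) \<in> borel_measurable M" by measurable
        show "(\<lambda>\<omega>. \<Sum>j<n. \<Sum>s\<in>{1, -1}. ennreal (W \<alpha> \<omega>) * indicator (bad \<alpha> j s) \<omega>) \<in> borel_measurable M"
          by (intro borel_measurable_sum m)
      qed
    qed
    also have "\<dots> \<le> ennreal (exp D) * ennreal (prob ?G) + (\<Sum>j<n. \<Sum>s\<in>{1, -1}. ennreal (exp (\<alpha> * L - \<alpha> * c j s)))"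
      using c(2) \<alpha> unfolding emeasure_eq_measure by (intro add_left_mono sum_mono) auto
    also have "\<dots> = ennreal (exp D * prob ?G + (\<Sum>j<n. \<Sum>s\<in>{1, -1}. exp (\<alpha> * L - \<alpha> * c j s)))"
    proof -
      define E where "E j s = exp (\<alpha> * L - \<alpha> * c j s)" for j s
      have E: "0 \<le> E j s" for j s by (simp add: E_def)
      have "(\<Sum>j<n. \<Sum>s\<in>{1, -1}. ennreal (E j s)) = (\<Sum>j<n. ennreal (\<Sum>s\<in>{1, -1}. E j s))"
        by (rule sum.cong[OF refl], rule sum_ennreal, rule E)
      also have "\<dots> = ennreal (\<Sum>j<n. \<Sum>s\<in>{1, -1}. E j s)" by (rule sum_ennreal) (rule sum_nonneg, rule E)
      finally have S: "(\<Sum>j<n. \<Sum>s\<in>{1, -1}. ennreal (E j s)) = ennreal (\<Sum>j<n. \<Sum>s\<in>{1, -1}. E j s)" .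
      have "0 \<le> (\<Sum>j<n. \<Sum>s\<in>{1, -1}. E j s)" by (intro sum_nonneg E)
      then show ?thesis unfolding E_def[symmetric] S by (simp only: ennreal_mult'[symmetric] ennreal_plus[symmetric] exp_ge_zero mult_nonneg_nonneg measure_nonneg)
    qed
    finally have "exp (\<alpha> * L) \<le> exp D * prob ?G + (\<Sum>j<n. \<Sum>s\<in>{1, -1}. exp (\<alpha> * L - \<alpha> * c j s))"
      by (subst (asm) ennreal_le_iff) (auto intro!: add_nonneg_nonneg sum_nonneg)
    also have "(\<Sum>j<n. \<Sum>s\<in>{1, -1}. exp (\<alpha> * L - \<alpha> * c j s)) = exp (\<alpha> * L) * (\<Sum>j<n. \<Sum>s\<in>{1, -1}. exp (- (\<alpha> * c j s)))"
      unfolding sum_distrib_left by (intro sum.cong refl) (simp add: exp_add[symmetric])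
    also have "exp (\<alpha> * L) * (\<Sum>j<n. \<Sum>s\<in>{1, -1}. exp (- (\<alpha> * c j s))) \<le> exp (\<alpha> * L) * (1 / 2)"
      using elim(1) by (intro mult_left_mono) auto
    finally have "exp (\<alpha> * L) / 2 \<le> exp D * prob ?G" by simp
    then have "exp (- D) * (exp (\<alpha> * L) / 2) \<le> exp (- D) * (exp D * prob ?G)" by (intro mult_left_mono) auto
    also have "\<dots> = prob ?G" by (simp add: mult.assoc[symmetric] exp_add[symmetric])
    finally have le: "exp (- D) * (exp (\<alpha> * L) / 2) \<le> prob ?G" .
    have A: "(\<Sum>j<n. \<theta> j * x j / real n - Lam (\<theta> j) / real n) = (\<Sum>j<n. \<theta> j * (x j / real n)) - L"
      by (simp add: L_def sum_subtractf)
    have "- \<alpha> * ((\<Sum>j<n. \<theta> j * (x j / real n)) - L + \<kappa> * (\<Sum>j<n. \<bar>\<theta> j\<bar>)) = - D + \<alpha> * L"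
      unfolding D_def by (simp add: right_diff_distrib distrib_left)
    then show ?case unfolding A using le by (simp only: exp_add times_divide_eq_right)
  qed
qed

end

section \<open>Large deviations of the paths\<close>

lemma grid_cell_bracket:
  fixes t :: real
  assumes "0 \<le> t" "t \<le> 1" "n > 0"
  obtains j where "j < n" "real j / real n \<le> t" "t \<le> real (Suc j) / real n"
proof (cases "t = 1")
  case True
  show ?thesis
  proof (rule that[of "n - 1"])
    show "real (n - 1) / real n \<le> t" using assms True by simp
    show "t \<le> real (Suc (n - 1)) / real n" using assms True by simp
  qed (use assms in simp)
next
  case False
  define j where "j = nat \<lfloor>real n * t\<rfloor>"
  have "real n * t < real n * 1" using False assms by (intro mult_strict_left_mono) auto
  then have j: "j < n" unfolding j_def using assms by (simp add: nat_less_iff floor_less_iff)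
  have "real j \<le> real n * t" "real n * t < real j + 1" unfolding j_def using assms by simp_all
  then show ?thesis using assms j by (intro that[of j]) (auto simp: field_simps)
qed

text \<open>Within a cell both paths lie between their values at the ends. The uniform error is thus
  the error at grid points plus the increment of \<open>g\<close> alone, and nothing about the jumps
  of \<open>V\<close> enters.\<close>

lemma monotone_paths_close:
  fixes V g :: "real \<Rightarrow> real"
  assumes V: "\<And>s t. 0 \<le> s \<Longrightarrow> s \<le> t \<Longrightarrow> t \<le> 1 \<Longrightarrow> V s \<le> V t"
    and g: "\<And>s t. 0 \<le> s \<Longrightarrow> s \<le> t \<Longrightarrow> t \<le> 1 \<Longrightarrow> g s \<le> g t"
    and n: "n > 0" and close: "\<And>j. j \<le> n \<Longrightarrow> \<bar>V (real j / real n) - g (real j / real n)\<bar> \<le> \<kappa>"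
    and inc: "\<And>j. j < n \<Longrightarrow> g (real (Suc j) / real n) - g (real j / real n) \<le> \<epsilon>"
    and t: "t \<in> {0..1}"
  shows "\<bar>V t - g t\<bar> \<le> \<kappa> + \<epsilon>"
proof -
  obtain j where j: "j < n" "real j / real n \<le> t" "t \<le> real (Suc j) / real n"
    using grid_cell_bracket[of t n] t n by auto
  have b: "0 \<le> real j / real n" "real (Suc j) / real n \<le> 1" using j n by auto
  have "V (real j / real n) \<le> V t" "V t \<le> V (real (Suc j) / real n)"
    "g (real j / real n) \<le> g t" "g t \<le> g (real (Suc j) / real n)"
    using j(2,3) b t by (auto intro!: V g)
  then show ?thesis
    using close[of j] close[of "Suc j"] inc[OF j(1)] j(1) by (auto simp: abs_le_iff)
qed

lemma scaled_ln_ereal_le: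
  assumes "\<alpha> > 0" "p \<le> ennreal (exp (\<alpha> * c))"
  shows "ereal (1 / \<alpha>) * ln_ereal p \<le> ereal c"
proof (cases "p = 0")
  case True
  then show ?thesis using assms(1) by (simp add: ln_ereal_def)
next
  case False
  have "p < \<infinity>" using assms(2) by (auto intro: order_le_less_trans)
  then obtain r where r: "p = ennreal r" "r > 0" using False by (cases p) (auto simp: ennreal_eq_0_iff not_le[symmetric])
  then have "r \<le> exp (\<alpha> * c)" using assms(2) by (simp add: ennreal_le_iff)
  then have "ln r \<le> ln (exp (\<alpha> * c))" using r by (subst ln_le_cancel_iff) auto
  then have "ln r \<le> \<alpha> * c" by simp
  then have "1 / \<alpha> * ln r \<le> 1 / \<alpha> * (\<alpha> * c)" using assms(1) by (intro mult_left_mono) auto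
  then show ?thesis using r assms(1) False by (simp add: ln_ereal_def)
qed

lemma scaled_ln_ereal_ge:
  assumes "\<alpha> > 0" "ennreal (exp (\<alpha> * c)) \<le> p"
  shows "ereal c \<le> ereal (1 / \<alpha>) * ln_ereal p"
proof (cases "p = \<infinity>")
  case True
  then show ?thesis using assms(1) by (simp add: ln_ereal_def)
next
  case False
  then obtain r where r: "p = ennreal r" "r \<ge> 0" by (cases p) auto
  then have e: "exp (\<alpha> * c) \<le> r" using assms(2) by (simp add: ennreal_le_iff)
  then have r0: "r > 0" using exp_gt_zero[of "\<alpha> * c"] by linarith
  have "ln (exp (\<alpha> * c)) \<le> ln r" using e r0 by (subst ln_le_cancel_iff) auto
  then have "1 / \<alpha> * (\<alpha> * c) \<le> 1 / \<alpha> * ln r" using assms(1) by (intro mult_left_mono) auto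
  then show ?thesis using r r0 assms(1) by (simp add: ln_ereal_def ennreal_eq_0_iff)
qed

lemma outer_measure_of_le:
  assumes "A \<subseteq> B" "B \<in> sets M" shows "outer_measure_of M A \<le> emeasure M B"
  unfolding outer_measure_of_def by (rule INF_lower) (use assms in auto)

lemma inner_measure_of_ge:
  assumes "B \<subseteq> A" "B \<in> sets M" shows "emeasure M B \<le> inner_measure_of M A"
  unfolding inner_measure_of_def by (rule SUP_upper) (use assms in auto)

context exponential_cluster_process begin

abbreviation V :: "real \<Rightarrow> 'w \<Rightarrow> real \<Rightarrow> real" where
  "V \<equiv> scaled_count_path X C"

text \<open>The finiteness of the count matters here: \<open>enn2real\<close> sends an infinite
  count to 0 and would break monotonicity.\<close>

lemma V_mono:
  assumes "count \<omega> \<alpha> < \<infinity>" "\<alpha> > 0" "0 \<le> s" "s \<le> t" "t \<le> 1"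
  shows "V \<alpha> \<omega> s \<le> V \<alpha> \<omega> t"
proof -
  have "\<alpha> * t \<le> \<alpha> * 1" using assms by (intro mult_left_mono) auto
  then have "count \<omega> (\<alpha> * t) < \<infinity>" using count_mono[of "\<alpha> * t" \<alpha> \<omega>] assms(1) by (auto intro: order_le_less_trans)
  moreover have "count \<omega> (\<alpha> * s) \<le> count \<omega> (\<alpha> * t)" using assms by (intro count_mono mult_left_mono) auto
  ultimately have "enn2real (count \<omega> (\<alpha> * s)) \<le> enn2real (count \<omega> (\<alpha> * t))" by (intro enn2real_mono) auto
  then show ?thesis using assms by (simp add: scaled_count_path_def divide_right_mono)
qed

lemma AE_V_cadlag:
  assumes "\<alpha> > 0" shows "AE \<omega> in M. V \<alpha> \<omega> \<in> cadlag_space"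
  using AE_count_finite[OF less_imp_le[OF assms]] by eventually_elim (rule count_path_cadlag[OF _ assms])

text \<open>Outside two exceptional events the interpolated masses belong to \<open>level a\<close>
  and the path is uniformly within \<open>e\<close> of them. By the choice of \<open>e\<close> the
  path is then not in \<open>F\<close>.\<close>

lemma path_upper_bound:
  assumes F: "closedin cadlag_uniform_topology F" and disj: "level a \<inter> F = {}" and a: "a \<ge> 0" and d: "d > 0"
  shows "eventually (\<lambda>\<alpha>. outer_measure_of M {\<omega> \<in> space M. V \<alpha> \<omega> \<in> F} \<le> ennreal (exp (\<alpha> * (d - a)))) at_top"
proof -
  obtain e where e: "e > 0" "\<And>f h. f \<in> level a \<Longrightarrow> h \<in> F \<Longrightarrow> (\<And>t. t \<in> {0..1} \<Longrightarrow> \<bar>h t - f t\<bar> \<le> e) \<Longrightarrow> False"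
    using level_separation[OF F disj] by blast
  obtain n where n: "n > 0" "\<And>f n' j. f \<in> level a \<Longrightarrow> n' \<ge> n \<Longrightarrow> j < n' \<Longrightarrow>
      f (real (Suc j) / real n') - f (real j / real n') \<le> e / 2"
    using level_grid_small[of "e / 2" a] e by auto
  have e2: "e / 2 > 0" and d2: "d / 2 > 0" using e d by auto
  show ?thesis
    using grid_upper_bound[OF n(1) a d2] grid_approximation[OF n(1) e2, of a]
      eventually_ge_at_top[of "2 * ln 2 / d"] eventually_gt_at_top[of 0]
  proof eventually_elim
    case (elim \<alpha>)
    then have \<alpha>: "\<alpha> > 0" by simp
    obtain U1 where U1: "U1 \<in> sets M" "emeasure M U1 \<le> ennreal (exp (- \<alpha> * (a - d / 2)))"
      "AE \<omega> in M. (\<exists>\<theta>. a < (\<Sum>j<n. \<theta> j * (cell_mass \<alpha> n j \<omega> / \<alpha>) - Lam (\<theta> j) / real n)) \<longrightarrow> \<omega> \<in> U1"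
      using elim(1) by blast
    obtain U2 where U2: "U2 \<in> sets M" "emeasure M U2 \<le> ennreal (exp (- \<alpha> * a))"
      "AE \<omega> in M. \<omega> \<notin> U2 \<longrightarrow> (\<forall>j\<le>n. \<bar>enn2real (count \<omega> (\<alpha> * (real j / real n))) / \<alpha> - (\<Sum>i<j. cell_mass \<alpha> n i \<omega>) / \<alpha>\<bar> \<le> e / 2)"
      using elim(2) by blast
    have "AE \<omega> in M. V \<alpha> \<omega> \<in> F \<longrightarrow> \<omega> \<in> U1 \<union> U2"
      using U1(3) U2(3) AE_count_finite[OF less_imp_le[OF \<alpha>]]
    proof eventually_elim
      case (elim \<omega>)
      show ?case
      proof (intro impI, rule ccontr)
        assume VF: "V \<alpha> \<omega> \<in> F" and nU: "\<omega> \<notin> U1 \<union> U2"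
        \<comment> \<open>The cumulative scaled masses; avoiding \<open>U1\<close> is exactly the
          hypothesis of \<open>linear_interpolant_level\<close> for them.\<close>
        define z where "z j = (\<Sum>i<j. cell_mass \<alpha> n i \<omega>) / \<alpha>" for j
        have z0: "z 0 = 0" by (simp add: z_def)
        have zinc: "z (Suc j) - z j = cell_mass \<alpha> n j \<omega> / \<alpha>" for j
          by (simp add: z_def add_divide_distrib)
        have lev: "linear_interpolant n z \<in> level a"
          by (rule linear_interpolant_level[where z = z, OF n(1) z0])
             (use elim(1) nU in \<open>auto simp: zinc not_less\<close>)
        show False
        proof (rule e(2)[OF lev VF])
          fix t :: real assume t: "t \<in> {0..1}"
          have "\<bar>V \<alpha> \<omega> t - linear_interpolant n z t\<bar> \<le> e / 2 + e / 2"
          proof (rule monotone_paths_close[where n = n and V = "V \<alpha> \<omega>" and g = "linear_interpolant n z"])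
            show "V \<alpha> \<omega> s \<le> V \<alpha> \<omega> t" if "0 \<le> s" "s \<le> t" "t \<le> 1" for s t
              by (rule V_mono[OF elim(3) \<alpha> that])
            show "linear_interpolant n z s \<le> linear_interpolant n z t" if "0 \<le> s" "s \<le> t" "t \<le> 1" for s t
              by (rule level_mono[OF lev that])
            show "linear_interpolant n z (real (Suc j) / real n) - linear_interpolant n z (real j / real n) \<le> e / 2" if "j < n" for j
              by (rule n(2)[OF lev order.refl that])
            fix j assume j: "j \<le> n"
            then have "real j / real n \<in> {0..1}" using n(1) by simp
            then have "V \<alpha> \<omega> (real j / real n) = enn2real (count \<omega> (\<alpha> * (real j / real n))) / \<alpha>"
              by (simp add: scaled_count_path_def)
            moreover have "linear_interpolant n z (real j / real n) = (\<Sum>i<j. cell_mass \<alpha> n i \<omega>) / \<alpha>"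
              using linear_interpolant_grid[where z = z, OF n(1) j z0] by (simp only: z_def)
            ultimately show "\<bar>V \<alpha> \<omega> (real j / real n) - linear_interpolant n z (real j / real n)\<bar> \<le> e / 2"
              using elim(2) nU j by simp
          qed (use n t in auto)
          then show "\<bar>V \<alpha> \<omega> t - linear_interpolant n z t\<bar> \<le> e" by simp
        qed
      qed
    qed
    then obtain N where N: "{\<omega> \<in> space M. \<not> (V \<alpha> \<omega> \<in> F \<longrightarrow> \<omega> \<in> U1 \<union> U2)} \<subseteq> N" "N \<in> null_sets M"
      unfolding eventually_ae_filter by blast
    \<comment> \<open>The event \<open>V \<alpha> \<omega> \<in> F\<close> need not be measurable,
      so the null set of the almost sure statement is added to obtain a measurable cover.\<close>
    let ?B = "(U1 \<union> U2) \<union> N"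
    have B: "?B \<in> sets M" using U1(1) U2(1) N(2) by (auto intro: null_setsD2)
    have "outer_measure_of M {\<omega> \<in> space M. V \<alpha> \<omega> \<in> F} \<le> emeasure M ?B"
      by (rule outer_measure_of_le[OF _ B]) (use N(1) in auto)
    also have "\<dots> = emeasure M (U1 \<union> U2)" using U1(1) U2(1) N(2) by (intro emeasure_Un_null_set) auto
    also have "\<dots> \<le> emeasure M U1 + emeasure M U2" using U1(1) U2(1) by (rule emeasure_subadditive)
    also have "\<dots> \<le> ennreal (exp (- \<alpha> * (a - d / 2))) + ennreal (exp (- \<alpha> * (a - d / 2)))"
    proof (rule add_mono[OF U1(2)])
      have "- \<alpha> * a \<le> - \<alpha> * (a - d / 2)" using \<alpha> d by (intro mult_left_mono_neg) auto
      then show "emeasure M U2 \<le> ennreal (exp (- \<alpha> * (a - d / 2)))"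
        by (intro order_trans[OF U2(2)] ennreal_leI) simp
    qed
    also have "\<dots> = ennreal (2 * exp (- \<alpha> * (a - d / 2)))" by (simp add: ennreal_plus[symmetric] del: ennreal_plus)
    also have "\<dots> \<le> ennreal (exp (\<alpha> * (d - a)))"
    proof (rule ennreal_leI)
      have "ln 2 \<le> \<alpha> * (d / 2)" using elim(3) d by (simp add: field_simps)
      then have "exp (ln 2) \<le> exp (\<alpha> * (d / 2))" by (subst exp_le_cancel_iff)
      then have "2 * exp (- \<alpha> * (a - d / 2)) \<le> exp (\<alpha> * (d / 2)) * exp (- \<alpha> * (a - d / 2))"
        by (intro mult_right_mono) auto
      also have "\<dots> = exp (\<alpha> * (d - a))" by (simp add: exp_add[symmetric] field_simps)
      finally show "2 * exp (- \<alpha> * (a - d / 2)) \<le> exp (\<alpha> * (d - a))" .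
    qed
    finally show ?case .
  qed
qed

text \<open>The masses are steered towards the slopes of \<open>f\<close> on a fine grid, perturbed
  towards the mean rate so that all slopes are positive and a tilting parameter exists. The
  perturbation does not raise the cost above \<open>a\<close>.\<close>

lemma path_lower_bound:
  assumes f: "f \<in> level a" and U: "openin cadlag_uniform_topology U" "f \<in> U" and d: "d > 0"
  shows "eventually (\<lambda>\<alpha>. ennreal (exp (\<alpha> * (- a - d))) \<le> inner_measure_of M {\<omega> \<in> space M. V \<alpha> \<omega> \<in> U}) at_top"
proof -
  have a: "0 \<le> a" by (rule level_nonneg[OF f])
  obtain e where e: "e > 0" "\<And>h. h \<in> cadlag_space \<Longrightarrow> (\<And>t. t \<in> {0..1} \<Longrightarrow> \<bar>h t - f t\<bar> \<le> e) \<Longrightarrow> h \<in> U"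
    using openin_cadlagD[OF U] by blast
  obtain n where n: "n > 0" "\<And>f n' j. f \<in> level a \<Longrightarrow> n' \<ge> n \<Longrightarrow> j < n' \<Longrightarrow>
      f (real (Suc j) / real n') - f (real j / real n') \<le> e / 4"
    using level_grid_small[of "e / 4" a] e by auto
  have f1: "0 \<le> f 1" using level_mono[OF f, of 0 1] level_0[OF f] by simp
  \<comment> \<open>Mixing with weight \<open>\<eta>\<close> moves grid values of the path by at
    most \<open>\<eta> * (f 1 + mean_rate)\<close>, and this is to stay below
    \<open>e / 4\<close>.\<close>
  define \<eta> where "\<eta> = min (1 / 2) (e / (4 * (f 1 + mean_rate)))"
  have mr: "f 1 + mean_rate > 0" using f1 mean_rate_pos by simp
  have \<eta>: "0 < \<eta>" "\<eta> \<le> 1 / 2" "\<eta> * (f 1 + mean_rate) \<le> e / 4"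
  proof -
    show "\<eta> \<le> 1 / 2" unfolding \<eta>_def by (rule min.cobounded1)
    have "0 < e / (4 * (f 1 + mean_rate))" using e mr by (intro divide_pos_pos) auto
    then show "0 < \<eta>" unfolding \<eta>_def by (simp only: min_less_iff_conj) simp
    have cancel: "e / (4 * q) * q = e / 4" if "q > 0" for q using that by simp
    have "\<eta> * (f 1 + mean_rate) \<le> e / (4 * (f 1 + mean_rate)) * (f 1 + mean_rate)"
      using mr unfolding \<eta>_def by (intro mult_right_mono min.cobounded2) auto
    also have "\<dots> = e / 4" by (rule cancel[OF mr])
    finally show "\<eta> * (f 1 + mean_rate) \<le> e / 4" .
  qed
  define D where "D j = f (real (Suc j) / real n) - f (real j / real n)" for j
  \<comment> \<open>On the cells \<open>j < n\<close> the maximum equals \<open>D j\<close>. For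
    larger \<open>j\<close> it keeps \<open>x j\<close> positive, since
    \<open>grid_lower_bound\<close> asks for a tilting parameter at every index.\<close>
  define x where "x j = (1 - \<eta>) * (real n * max 0 (D j)) + \<eta> * mean_rate" for j
  have "x j > 0" for j
  proof -
    have "0 \<le> (1 - \<eta>) * (real n * max 0 (D j))" using \<eta> by (intro mult_nonneg_nonneg) auto
    moreover have "0 < \<eta> * mean_rate" using \<eta> mean_rate_pos by simp
    ultimately show ?thesis unfolding x_def by linarith
  qed
  then have "\<exists>\<theta>. (Lam has_real_derivative x j) (at \<theta>)" for j using Lam_derivative_attains by blast
  then obtain \<theta> where \<theta>: "\<And>j. (Lam has_real_derivative x j) (at (\<theta> j))" by metis
  have D0: "max 0 (D j) = D j" if "j < n" for j
    using level_grid_step[OF f that] by (simp add: D_def)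
  have cost: "(\<Sum>j<n. \<theta> j * x j / real n - Lam (\<theta> j) / real n) \<le> a"
  proof -
    have "(\<Sum>j<n. \<theta> j * x j / real n - Lam (\<theta> j) / real n)
      = (\<Sum>j<n. (1 - \<eta>) * (\<theta> j * D j - Lam (\<theta> j) / real n) + \<eta> * ((\<theta> j * mean_rate - Lam (\<theta> j)) / real n))"
    proof (intro sum.cong refl)
      fix j assume "j \<in> {..<n}"
      then have "x j = (1 - \<eta>) * (real n * D j) + \<eta> * mean_rate" using D0 by (simp add: x_def)
      then have "\<theta> j * x j / real n = (1 - \<eta>) * (\<theta> j * D j) + \<eta> * (\<theta> j * mean_rate / real n)"
        using n(1) by (simp add: distrib_left add_divide_distrib mult_ac)
      then show "\<theta> j * x j / real n - Lam (\<theta> j) / real n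
        = (1 - \<eta>) * (\<theta> j * D j - Lam (\<theta> j) / real n) + \<eta> * ((\<theta> j * mean_rate - Lam (\<theta> j)) / real n)"
        by (simp add: diff_divide_distrib algebra_simps)
    qed
    also have "\<dots> = (1 - \<eta>) * Phi n \<theta> f + \<eta> * (\<Sum>j<n. (\<theta> j * mean_rate - Lam (\<theta> j)) / real n)"
      by (simp add: sum.distrib sum_distrib_left Phi_def D_def)
    also have "\<dots> \<le> (1 - \<eta>) * a + \<eta> * 0"
    proof (intro add_mono mult_left_mono)
      show "Phi n \<theta> f \<le> a" by (rule level_Phi[OF f n(1)])
      show "(\<Sum>j<n. (\<theta> j * mean_rate - Lam (\<theta> j)) / real n) \<le> 0"
        using Lam_ge_tangent by (intro sum_nonpos) (simp add: divide_le_0_iff)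
    qed (use \<eta> in auto)
    also have "\<dots> \<le> 1 * a + 0" using a \<eta> by (intro add_mono mult_right_mono) auto
    finally show ?thesis by simp
  qed
  define S where "S = (\<Sum>j<n. \<bar>\<theta> j\<bar>)"
  have S: "0 \<le> S" by (simp add: S_def sum_nonneg)
  \<comment> \<open>The first bound limits the accumulated fluctuation of \<open>n\<close> masses to
    \<open>e / 8\<close>, the second the loss \<open>\<kappa> * S\<close> in the exponent to
    \<open>d / 2\<close>.\<close>
  define \<kappa> where "\<kappa> = min (e / (8 * real n)) (d / (2 * (S + 1)))"
  have \<kappa>: "\<kappa> > 0" "real n * \<kappa> \<le> e / 8" "\<kappa> * S \<le> d / 2"
  proof -
    show "\<kappa> > 0" using e n d S by (auto simp: \<kappa>_def)
    have "real n * \<kappa> \<le> real n * (e / (8 * real n))" by (intro mult_left_mono) (auto simp: \<kappa>_def)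
    then show "real n * \<kappa> \<le> e / 8" using n by simp
    have cancel: "d / (2 * q) * q = d / 2" if "q > 0" for q using that by simp
    have "\<kappa> * S \<le> d / (2 * (S + 1)) * (S + 1)"
      unfolding \<kappa>_def using S d by (intro mult_mono min.cobounded2) auto
    also have "\<dots> = d / 2" by (rule cancel) (use S in simp)
    finally show "\<kappa> * S \<le> d / 2" .
  qed
  have e8: "e / 8 > 0" using e by simp
  show ?thesis
    using grid_lower_bound[OF n(1) \<kappa>(1), of x \<theta>] \<theta> grid_approximation[OF n(1) e8, of "a + d"]
  proof -
    assume gl: "(\<And>j. (Lam has_real_derivative x j) (at (\<theta> j))) \<Longrightarrow>
      \<forall>\<^sub>F \<alpha> in at_top. exp (- \<alpha> * ((\<Sum>j<n. \<theta> j * x j / real n - Lam (\<theta> j) / real n) + \<kappa> * (\<Sum>j<n. \<bar>\<theta> j\<bar>))) / 2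
        \<le> prob {\<omega> \<in> space M. \<forall>j<n. \<bar>cell_mass \<alpha> n j \<omega> - \<alpha> * (x j / real n)\<bar> \<le> \<alpha> * \<kappa>}"
      and ga: "\<forall>\<^sub>F \<alpha> in at_top. \<exists>U\<in>sets M. emeasure M U \<le> ennreal (exp (- \<alpha> * (a + d))) \<and>
        (AE \<omega> in M. \<omega> \<notin> U \<longrightarrow> (\<forall>j\<le>n. \<bar>enn2real (count \<omega> (\<alpha> * (real j / real n))) / \<alpha> - (\<Sum>i<j. cell_mass \<alpha> n i \<omega>) / \<alpha>\<bar> \<le> e / 8))"
    show ?thesis using gl[OF \<theta>] ga eventually_ge_at_top[of "2 * ln 4 / d"] eventually_gt_at_top[of 0]
    proof eventually_elim
      case (elim \<alpha>)
      then have \<alpha>: "\<alpha> > 0" by simp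
      let ?G = "{\<omega> \<in> space M. \<forall>j<n. \<bar>cell_mass \<alpha> n j \<omega> - \<alpha> * (x j / real n)\<bar> \<le> \<alpha> * \<kappa>}"
      have [measurable]: "?G \<in> sets M" by measurable
      obtain U2 where U2: "U2 \<in> sets M" "emeasure M U2 \<le> ennreal (exp (- \<alpha> * (a + d)))"
        "AE \<omega> in M. \<omega> \<notin> U2 \<longrightarrow> (\<forall>j\<le>n. \<bar>enn2real (count \<omega> (\<alpha> * (real j / real n))) / \<alpha> - (\<Sum>i<j. cell_mass \<alpha> n i \<omega>) / \<alpha>\<bar> \<le> e / 8)"
        using elim(2) by blast
      have "AE \<omega> in M. \<omega> \<in> ?G - U2 \<longrightarrow> V \<alpha> \<omega> \<in> U"
        using U2(3) AE_count_finite[OF less_imp_le[OF \<alpha>]]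
      proof eventually_elim
        case (elim \<omega>)
        show ?case
        proof
          assume \<omega>: "\<omega> \<in> ?G - U2"
          show "V \<alpha> \<omega> \<in> U"
          proof (rule e(2)[OF count_path_cadlag[OF elim(2) \<alpha>]])
            fix t :: real assume t: "t \<in> {0..1}"
            \<comment> \<open>The error budget: crossing clusters, fluctuation of the masses, mixing
              with the mean rate, and the increment of \<open>f\<close> over one cell.\<close>
            have "\<bar>V \<alpha> \<omega> t - f t\<bar> \<le> (e / 8 + (e / 8 + e / 4)) + e / 4"
            proof (rule monotone_paths_close[where n = n and V = "V \<alpha> \<omega>" and g = f])
              show "V \<alpha> \<omega> s \<le> V \<alpha> \<omega> t" if "0 \<le> s" "s \<le> t" "t \<le> 1" for s t
                by (rule V_mono[OF elim(2) \<alpha> that])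
              show "f s \<le> f t" if "0 \<le> s" "s \<le> t" "t \<le> 1" for s t
                by (rule level_mono[OF f that])
              show "f (real (Suc j) / real n) - f (real j / real n) \<le> e / 4" if "j < n" for j
                by (rule n(2)[OF f order.refl that])
              fix j assume j: "j \<le> n"
              have u: "real j / real n \<in> {0..1}" using n(1) j by simp
              have v: "V \<alpha> \<omega> (real j / real n) = enn2real (count \<omega> (\<alpha> * (real j / real n))) / \<alpha>"
                using u by (simp add: scaled_count_path_def)
              have 1: "\<bar>V \<alpha> \<omega> (real j / real n) - (\<Sum>i<j. cell_mass \<alpha> n i \<omega>) / \<alpha>\<bar> \<le> e / 8"
                unfolding v using elim(1) \<omega> j by blast
              have 2: "\<bar>(\<Sum>i<j. cell_mass \<alpha> n i \<omega>) / \<alpha> - (\<Sum>i<j. x i / real n)\<bar> \<le> e / 8"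
              proof -
                have "(\<Sum>i<j. cell_mass \<alpha> n i \<omega>) / \<alpha> - (\<Sum>i<j. x i / real n) = (\<Sum>i<j. (cell_mass \<alpha> n i \<omega> - \<alpha> * (x i / real n)) / \<alpha>)"
                  using \<alpha> by (simp add: sum_divide_distrib sum_subtractf[symmetric] diff_divide_distrib)
                also have "\<bar>\<dots>\<bar> \<le> (\<Sum>i<j. \<bar>(cell_mass \<alpha> n i \<omega> - \<alpha> * (x i / real n)) / \<alpha>\<bar>)" by (rule sum_abs)
                also have "\<dots> \<le> (\<Sum>i<j. \<kappa>)"
                proof (rule sum_mono)
                  fix i assume "i \<in> {..<j}"
                  then have "\<bar>cell_mass \<alpha> n i \<omega> - \<alpha> * (x i / real n)\<bar> \<le> \<alpha> * \<kappa>" using \<omega> j by auto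
                  then show "\<bar>(cell_mass \<alpha> n i \<omega> - \<alpha> * (x i / real n)) / \<alpha>\<bar> \<le> \<kappa>"
                    using \<alpha> by (simp add: abs_divide divide_le_eq mult.commute)
                qed
                also have "\<dots> \<le> real n * \<kappa>" using j \<kappa>(1) by simp
                finally show ?thesis using \<kappa>(2) by linarith
              qed
              have 3: "\<bar>(\<Sum>i<j. x i / real n) - f (real j / real n)\<bar> \<le> e / 4"
              proof -
                have "(\<Sum>i<j. x i / real n) = (\<Sum>i<j. (1 - \<eta>) * D i + \<eta> * (mean_rate / real n))"
                  using j n(1) D0 by (intro sum.cong refl) (simp add: x_def add_divide_distrib)
                also have "\<dots> = (1 - \<eta>) * (\<Sum>i<j. D i) + \<eta> * (real j / real n * mean_rate)"
                  by (simp add: sum.distrib sum_distrib_left)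
                also have "(\<Sum>i<j. D i) = f (real j / real n)"
                  unfolding D_def using sum_lessThan_telescope[of "\<lambda>i. f (real i / real n)" j] level_0[OF f] by simp
                finally have eq: "(\<Sum>i<j. x i / real n) - f (real j / real n) = \<eta> * (real j / real n * mean_rate - f (real j / real n))"
                  by (simp add: algebra_simps)
                have "0 \<le> f (real j / real n)" "f (real j / real n) \<le> f 1"
                  using level_mono[OF f, of 0 "real j / real n"] level_mono[OF f, of "real j / real n" 1] level_0[OF f] u by auto
                moreover have "0 \<le> real j / real n * mean_rate" "real j / real n * mean_rate \<le> 1 * mean_rate"
                  using mult_right_mono[of "real j / real n" 1 mean_rate] u mean_rate_pos by auto
                ultimately have "\<bar>real j / real n * mean_rate - f (real j / real n)\<bar> \<le> f 1 + mean_rate"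
                  unfolding abs_le_iff using f1 mean_rate_pos by linarith
                then have "\<eta> * \<bar>real j / real n * mean_rate - f (real j / real n)\<bar> \<le> \<eta> * (f 1 + mean_rate)"
                  using \<eta>(1) by (intro mult_left_mono) auto
                then show ?thesis unfolding eq abs_mult abs_of_pos[OF \<eta>(1)] using \<eta>(3) by linarith
              qed
              show "\<bar>V \<alpha> \<omega> (real j / real n) - f (real j / real n)\<bar> \<le> e / 8 + (e / 8 + e / 4)"
                using 1 2 3 by linarith
            qed (use n t in auto)
            then show "\<bar>V \<alpha> \<omega> t - f t\<bar> \<le> e" using e(1) by linarith
          qed
        qed
      qed
      then obtain N where N: "{\<omega> \<in> space M. \<not> (\<omega> \<in> ?G - U2 \<longrightarrow> V \<alpha> \<omega> \<in> U)} \<subseteq> N" "N \<in> null_sets M"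
        unfolding eventually_ae_filter by blast
      let ?B = "(?G - U2) - N"
      have B: "?B \<in> sets M" using sets.Diff[OF sets.Diff[OF \<open>?G \<in> sets M\<close> U2(1)] null_setsD2[OF N(2)]] .
      have "emeasure M ?B \<le> inner_measure_of M {\<omega> \<in> space M. V \<alpha> \<omega> \<in> U}"
        by (rule inner_measure_of_ge[OF _ B]) (use N(1) in auto)
      moreover have "emeasure M ?B = emeasure M (?G - U2)" 
        by (rule emeasure_Diff_null_set[OF N(2) sets.Diff[OF \<open>?G \<in> sets M\<close> U2(1)]])
      moreover have "ennreal (exp (\<alpha> * (- a - d))) \<le> emeasure M (?G - U2)"
      proof -
        have "prob ?G - prob U2 \<le> prob (?G - U2)"
        proof -
          have "prob ?G \<le> prob ((?G - U2) \<union> U2)" using U2(1) by (intro finite_measure_mono) auto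
          also have "\<dots> \<le> prob (?G - U2) + prob U2" using U2(1) by (intro measure_Un_le) auto
          finally show ?thesis by simp
        qed
        moreover have "prob U2 \<le> exp (- \<alpha> * (a + d))" using U2(2) by (simp add: emeasure_eq_measure)
        moreover have "exp (- \<alpha> * (a + d / 2)) / 2 \<le> prob ?G"
        proof -
          have "\<alpha> * ((\<Sum>j<n. \<theta> j * x j / real n - Lam (\<theta> j) / real n) + \<kappa> * S) \<le> \<alpha> * (a + d / 2)"
            using \<alpha> cost \<kappa>(3) by (intro mult_left_mono add_mono) auto
          then have "exp (- \<alpha> * (a + d / 2)) \<le> exp (- \<alpha> * ((\<Sum>j<n. \<theta> j * x j / real n - Lam (\<theta> j) / real n) + \<kappa> * S))"
            by simp
          with elim(1) show ?thesis unfolding S_def by linarith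
        qed
        \<comment> \<open>After division by 2 the good event keeps at least
          \<open>2 * exp (- \<alpha> * (a + d))\<close>, of which \<open>U2\<close> removes at most
          one copy.\<close>
        moreover have "4 * exp (- \<alpha> * (a + d)) \<le> exp (- \<alpha> * (a + d / 2))"
        proof -
          have "ln 4 \<le> \<alpha> * (d / 2)" using elim(3) d by (simp add: field_simps)
          then have "exp (ln 4) \<le> exp (\<alpha> * (d / 2))" by (subst exp_le_cancel_iff)
          then have "4 * exp (- \<alpha> * (a + d)) \<le> exp (\<alpha> * (d / 2)) * exp (- \<alpha> * (a + d))" by (intro mult_right_mono) auto
          also have "\<dots> = exp (- \<alpha> * (a + d / 2))" by (simp add: exp_add[symmetric] field_simps)
          finally show ?thesis .
        qed
        moreover have "exp (\<alpha> * (- a - d)) = exp (- \<alpha> * (a + d))" by (simp add: algebra_simps)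
        moreover have "0 < exp (- \<alpha> * (a + d))" by simp
        ultimately have "exp (\<alpha> * (- a - d)) \<le> prob (?G - U2)" by linarith
        then show ?thesis by (simp add: emeasure_eq_measure ennreal_leI)
      qed
      ultimately show ?case by simp
    qed
  qed
qed

text \<open>The two halves of the integral representation combine here. It transfers closedness and
  compactness of the level sets to the rate function.\<close>

lemma rate_sublevel:
  assumes "0 \<le> a"
  shows "{f \<in> topspace cadlag_uniform_topology. path_rate_function Lam f \<le> ennreal a} = level a"
  using level_imp_rate_le rate_le_imp_level[OF _ _ assms] level_cadlag by auto

section \<open>Assembling the large deviation principle\<close>

lemma rate_good: "good_rate_function cadlag_uniform_topology (path_rate_function Lam)"
  unfolding good_rate_function_def
proof (intro conjI allI impI)
  show "lower_semicontinuous_map cadlag_uniform_topology (path_rate_function Lam)"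
    unfolding lower_semicontinuous_map_def
  proof
    fix a :: ennreal
    show "closedin cadlag_uniform_topology {x \<in> topspace cadlag_uniform_topology. path_rate_function Lam x \<le> a}"
    proof (cases a)
      case (real r)
      then show ?thesis using rate_sublevel[of r] level_closedin[of r] by simp
    next
      case top
      then have "{x \<in> topspace cadlag_uniform_topology. path_rate_function Lam x \<le> a} = topspace cadlag_uniform_topology" by simp
      then show ?thesis by (simp only: closedin_topspace)
    qed
  qed
  fix a :: real assume "0 \<le> a"
  then show "compactin cadlag_uniform_topology {x \<in> topspace cadlag_uniform_topology. path_rate_function Lam x \<le> ennreal a}"
    using rate_sublevel[of a] level_compactin[of a] by simp
qed

lemma ldp_lower:
  assumes U: "openin cadlag_uniform_topology U" and UB: "U \<subseteq> B"
  shows "- enn2ereal (INF f \<in> U. path_rate_function Lam f)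
    \<le> Liminf at_top (\<lambda>\<alpha>. ereal (1 / \<alpha>) * ln_ereal (inner_measure_of M {\<omega> \<in> space M. V \<alpha> \<omega> \<in> B}))" (is "_ \<le> ?L")
proof -
  have "- ?L \<le> enn2ereal (path_rate_function Lam f)" if f: "f \<in> U" for f
  proof (cases "path_rate_function Lam f")
    case (real a)
    have fc: "f \<in> cadlag_space" using openin_subset[OF U] f by auto
    have lev: "f \<in> level a" by (rule rate_le_imp_level[OF fc]) (use real in auto)
    have "ereal (- a - d) \<le> ?L" if d: "d > 0" for d
    proof (rule Liminf_bounded)
      show "\<forall>\<^sub>F \<alpha> in at_top. ereal (- a - d) \<le> ereal (1 / \<alpha>) * ln_ereal (inner_measure_of M {\<omega> \<in> space M. V \<alpha> \<omega> \<in> B})"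
        using path_lower_bound[OF lev U f d] eventually_gt_at_top[of 0]
      proof eventually_elim
        case (elim \<alpha>)
        have "inner_measure_of M {\<omega> \<in> space M. V \<alpha> \<omega> \<in> U} \<le> inner_measure_of M {\<omega> \<in> space M. V \<alpha> \<omega> \<in> B}"
          unfolding inner_measure_of_def using UB by (intro SUP_subset_mono) auto
        with elim(1) have "ennreal (exp (\<alpha> * (- a - d))) \<le> inner_measure_of M {\<omega> \<in> space M. V \<alpha> \<omega> \<in> B}" by (rule order_trans)
        then show ?case by (rule scaled_ln_ereal_ge[OF elim(2)])
      qed
    qed
    then have le: "ereal (- a) \<le> ?L + ereal d" if "d > 0" for d
      using add_right_mono[of "ereal (- a - d)" ?L "ereal d"] that by simp
    have "ereal (- a) \<le> ?L" by (rule ereal_le_epsilon2) (use le in auto)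
    then show ?thesis using real by (simp add: ereal_uminus_le_reorder)
  qed simp
  \<comment> \<open>The infimum lives in \<open>ennreal\<close>, so the bound is passed through
    \<open>e2ennreal\<close>. If \<open>- ?L\<close> is negative it is truncated, but then the claim
    is trivial.\<close>
  then have "e2ennreal (- ?L) \<le> path_rate_function Lam f" if "f \<in> U" for f
    using e2ennreal_mono[of "- ?L" "enn2ereal (path_rate_function Lam f)"] that by simp
  then have le: "e2ennreal (- ?L) \<le> (INF f \<in> U. path_rate_function Lam f)" by (rule INF_greatest)
  have "- ?L \<le> enn2ereal (INF f \<in> U. path_rate_function Lam f)"
  proof (cases "0 \<le> - ?L")
    case True
    then have "- ?L = enn2ereal (e2ennreal (- ?L))" by (rule enn2ereal_e2ennreal[symmetric])
    also have "\<dots> \<le> enn2ereal (INF f \<in> U. path_rate_function Lam f)" using le by (simp add: less_eq_ennreal.rep_eq)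
    finally show ?thesis .
  next
    case False
    then have "- ?L \<le> 0" by simp
    then show ?thesis by (rule order_trans) simp
  qed
  then show ?thesis by (simp add: ereal_uminus_le_reorder)
qed

lemma ldp_upper:
  assumes F: "closedin cadlag_uniform_topology F" and BF: "B \<subseteq> F"
  shows "Limsup at_top (\<lambda>\<alpha>. ereal (1 / \<alpha>) * ln_ereal (outer_measure_of M {\<omega> \<in> space M. V \<alpha> \<omega> \<in> B}))
    \<le> - enn2ereal (INF f \<in> F. path_rate_function Lam f)" (is "?L \<le> - enn2ereal ?I")
proof (rule ccontr)
  assume "\<not> ?thesis"
  then have "- enn2ereal ?I < ?L" by simp
  \<comment> \<open>If the bound failed, some \<open>r\<close> would lie strictly between.
    Logarithms of probabilities are at most 0, so \<open>r < 0\<close>, and \<open>a = - r\<close>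
    is a positive level below the infimum over \<open>F\<close>; hence \<open>level a\<close> misses
    \<open>F\<close>.\<close>
  then obtain r where r: "- enn2ereal ?I < ereal r" "ereal r < ?L" using ereal_dense2 by blast
  have mono: "outer_measure_of M {\<omega> \<in> space M. V \<alpha> \<omega> \<in> B} \<le> outer_measure_of M {\<omega> \<in> space M. V \<alpha> \<omega> \<in> F}" for \<alpha>
    using BF by (intro outer_measure_of_mono) auto
  have "?L \<le> ereal 0"
  proof (rule Limsup_bounded)
    show "\<forall>\<^sub>F \<alpha> in at_top. ereal (1 / \<alpha>) * ln_ereal (outer_measure_of M {\<omega> \<in> space M. V \<alpha> \<omega> \<in> B}) \<le> ereal 0"
      using eventually_gt_at_top[of 0]
    proof eventually_elim
      case (elim \<alpha>)
      have "outer_measure_of M {\<omega> \<in> space M. V \<alpha> \<omega> \<in> B} \<le> emeasure M (space M)"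
        by (rule outer_measure_of_le) auto
      then show ?case using scaled_ln_ereal_le[OF elim, of _ 0] by (simp add: emeasure_space_1)
    qed
  qed
  with r(2) have "ereal r < ereal 0" by (rule less_le_trans)
  then have r0: "r < 0" by simp
  define a where "a = - r"
  have a: "a > 0" using r0 by (simp add: a_def)
  have aI: "ereal a < enn2ereal ?I" using r(1) by (simp add: a_def ereal_uminus_less_reorder)
  have disj: "level a \<inter> F = {}"
  proof (rule ccontr)
    assume "level a \<inter> F \<noteq> {}"
    then obtain f where f: "f \<in> level a" "f \<in> F" by blast
    have "?I \<le> path_rate_function Lam f" by (rule INF_lower[OF f(2)])
    also have "\<dots> \<le> ennreal a" by (rule level_imp_rate_le[OF f(1)])
    finally have "enn2ereal ?I \<le> enn2ereal (ennreal a)" by (simp add: less_eq_ennreal.rep_eq)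
    then show False using aI a by simp
  qed
  \<comment> \<open>A second intermediate value provides the slack \<open>d = r' - r\<close> that
    the exponential bound consumes.\<close>
  obtain r' where r': "ereal r < ereal r'" "ereal r' < ?L" using r(2) ereal_dense2 by blast
  have d: "r' - r > 0" using r'(1) by simp
  have "?L \<le> ereal r'"
  proof (rule Limsup_bounded)
    show "\<forall>\<^sub>F \<alpha> in at_top. ereal (1 / \<alpha>) * ln_ereal (outer_measure_of M {\<omega> \<in> space M. V \<alpha> \<omega> \<in> B}) \<le> ereal r'"
      using path_upper_bound[OF F disj less_imp_le[OF a] d] eventually_gt_at_top[of 0]
    proof eventually_elim
      case (elim \<alpha>)
      have "r' - r - a = r'" by (simp add: a_def)
      with elim(1) have "outer_measure_of M {\<omega> \<in> space M. V \<alpha> \<omega> \<in> F} \<le> ennreal (exp (\<alpha> * r'))" by simp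
      then show ?case by (intro scaled_ln_ereal_le[OF elim(2)] order_trans[OF mono])
    qed
  qed
  with r'(2) show False by simp
qed

theorem large_deviations:
  "large_deviation_principle M cadlag_uniform_topology V (\<lambda>\<alpha>. \<alpha>) (path_rate_function Lam)"
  unfolding large_deviation_principle_def
proof (intro conjI ballI allI impI)
  show "AE \<omega> in M. V \<alpha> \<omega> \<in> topspace cadlag_uniform_topology" if "\<alpha> > 0" for \<alpha>
    using AE_V_cadlag[OF that] by simp
  show "lower_semicontinuous_map cadlag_uniform_topology (path_rate_function Lam)"
    using rate_good by (simp add: good_rate_function_def)
  show "ldp_speed (\<lambda>\<alpha>. \<alpha>)"
    by (auto simp: ldp_speed_def filterlim_ident intro!: mono_onI measurable_restrict_space1)
  fix B assume "B \<in> sigma_sets (topspace cadlag_uniform_topology) {U. openin cadlag_uniform_topology U}"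
  moreover have "{U. openin cadlag_uniform_topology U} \<subseteq> Pow (topspace cadlag_uniform_topology)"
    using openin_subset by blast
  ultimately have B: "B \<subseteq> topspace cadlag_uniform_topology" using sigma_sets_into_sp by blast
  show "- enn2ereal (INF x\<in>cadlag_uniform_topology interior_of B. path_rate_function Lam x)
    \<le> Liminf at_top (\<lambda>\<alpha>. ereal (1 / \<alpha>) * ln_ereal (inner_measure_of M {\<omega> \<in> space M. V \<alpha> \<omega> \<in> B}))"
    by (rule ldp_lower[OF openin_interior_of interior_of_subset])
  show "Limsup at_top (\<lambda>\<alpha>. ereal (1 / \<alpha>) * ln_ereal (outer_measure_of M {\<omega> \<in> space M. V \<alpha> \<omega> \<in> B}))
    \<le> - enn2ereal (INF x\<in>cadlag_uniform_topology closure_of B. path_rate_function Lam x)"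
    by (rule ldp_upper[OF closedin_closure_of closure_of_subset[OF B]])
qed

end

theorem theorem4p4:
  fixes M :: "'w measure" and \<nu> :: real
    and X :: "nat \<Rightarrow> 'w \<Rightarrow> real" and C :: "nat \<Rightarrow> 'w \<Rightarrow> real multiset"
    and Q :: "real multiset measure"
  assumes "poisson_cluster_process M \<nu> X C Q"
    and "\<And>\<theta>::real. integrable Q (\<lambda>m. exp (\<theta> * real (size m)))"
    and "\<And>\<theta>::real. integrable Q (\<lambda>m. cluster_radius m * exp (\<theta> * real (size m)))"
  shows "large_deviation_principle M cadlag_uniform_topology (scaled_count_path X C) (\<lambda>\<alpha>. \<alpha>)
           (path_rate_function (cluster_Lambda \<nu> Q))
       \<and> good_rate_function cadlag_uniform_topology (path_rate_function (cluster_Lambda \<nu> Q))"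
proof -
  interpret exponential_cluster_process M \<nu> X C Q
    by (intro exponential_cluster_process.intro exponential_cluster_process_axioms.intro assms)
  show ?thesis using large_deviations rate_good by blast
qed

end
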